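(* Let $(X,d)$ be a metric space with bounded geometry. Then the following properties of $X$ are equivalent: (1) property A; (2) uniform local amenability $\mathrm{ULA}_\mu$; (3) the metric sparsification property (MSP); (4) the operator norm localization property (ONL).
   Context: Metric spaces are assumed nonempty. For $x\in X$ and $S>0$, $N(x,S)=\{y\in X : d(x,y)\le S\}$ denotes the closed ball. $(X,d)$ has bounded geometry if $\sup_{x\in X}|N(x,S)|<\infty$ for every $S>0$ (in particular $X$ is discrete). Property A: for every $R>0$ and $\epsilon>0$ there exist $S>0$ and finite subsets $A_x\subseteq X\times\mathbb{N}$ ($x\in X$) such that (i) if $d(y,z)\le R$, then $|A_y\bigtriangleup A_z|<\epsilon\,|A_y\cap A_z|$, where $\bigtriangleup$ is the symmetric difference; and (ii) $A_x\subseteq N(x,S)\times\mathbb{N}$ for every $x\in X$. Uniform local amenability $\mathrm{ULA}_\mu$: for every $R>0$ and $\epsilon>0$ there exists $S>0$ such that for every probability measure $\mu$ on $X$ there is a finite subset $E\subseteq X$ with $\mathrm{diam}(E)\le S$ and $\mu(\partial_R E)<\epsilon\,\mu(E)$, where $\partial_R E=\{x\in X\setminus E : d(x,E)\le R\}$. Metric sparsification property (MSP): there exist a constant $0<c\le1$ and a non-decreasing function $f\colon\mathbb{N}\to\mathbb{N}$ such that for every $m\in\mathbb{N}$ and every finite positive Borel measure $\mu$ on $X$ there is a Borel subset $\Omega=\bigsqcup_{i\in I}\Omega_i$ of $X$ (a disjoint union) such that $d(\Omega_i,\Omega_j)\ge m$ for all $i\ne j$, $\mathrm{diam}(\Omega_i)\le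 f(m)$ for all $i\in I$, and $\mu(\Omega)\ge c\,\mu(X)$. Operator norm localization property (ONL): let $\mathcal{H}$ be a separable infinite-dimensional Hilbert space. Let $\nu$ be a positive (nonzero) locally finite Borel measure on $X$. A bounded operator $a$ on $L^2((X,\nu),\mathcal{H})=L^2(X,\nu)\otimes\mathcal{H}$ can be written, since $X$ is discrete, as a matrix $a=[a_{y,z}]$ indexed by the points $y,z\in X$ of positive $\nu$-measure, with entries $a_{y,z}\in\mathbb{B}(\mathcal{H})$; its propagation is $\sup\{d(y,z) : a_{y,z}\neq 0\}$ (equal to $0$ if $a=0$). For a function $f\colon\mathbb{N}\to\mathbb{N}$ and a constant $0<c\le 1$, $(X,\nu)$ has ONL relative to $f$ with constant $c$ if for every $R\in\mathbb{N}$ and every bounded operator $a$ on $L^2((X,\nu),\mathcal{H})$ of propagation at most $R$ there is a nonzero vector $\zeta\in L^2((X,\nu),\mathcal{H})$ with $\mathrm{diam}(\mathrm{supp}(\zeta))\le f(R)$ and $c\,\|a\|\,\|\zeta\|\le\|a\zeta\|$. The space $X$ has ONL if there exist a constant $0<c\le1$ and a function $f\colon\mathbb{N}\to\mathbb{N}$ such that for every positive locally finite Borel measure $\nu$ on $X$, $(X,\nu)$ has ONL relative to $f$ with constant $c$. *)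

theory Defs
  imports "HOL-Probability.Probability"
begin

section \<open>Complex Hilbert spaces\<close>

text \<open>
  Complex Hilbert spaces: a complete normed space whose norm comes from a complex inner product,
  conjugate-linear in the first argument. Positive definiteness of the inner product is a
  consequence of the last axiom, since the norm is non-negative and definite.
\<close>

class complex_hilbert = banach +
  fixes scaleC :: "complex \<Rightarrow> 'a \<Rightarrow> 'a" (infixr "*\<^sub>C" 75)
    and cinner :: "'a \<Rightarrow> 'a \<Rightarrow> complex"
  assumes scaleC_add_right: "c *\<^sub>C (x + y) = c *\<^sub>C x + c *\<^sub>C y"
    and scaleC_add_left: "(b + c) *\<^sub>C x = b *\<^sub>C x + c *\<^sub>C x"
    and scaleC_scaleC: "b *\<^sub>C c *\<^sub>C x = (b * c) *\<^sub>C x"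
    and scaleR_scaleC: "r *\<^sub>R x = complex_of_real r *\<^sub>C x"
    and cinner_commute: "cinner x y = cnj (cinner y x)"
    and cinner_add_right: "cinner x (y + z) = cinner x y + cinner x z"
    and cinner_scaleC_right: "cinner x (c *\<^sub>C y) = c * cinner x y"
    and norm_eq_sqrt_cinner: "norm x = sqrt (Re (cinner x x))"

lemma vector_space_scaleC: "vector_space ((*\<^sub>C) :: complex \<Rightarrow> 'h \<Rightarrow> 'h::complex_hilbert)"
proof
  show "1 *\<^sub>C x = x" for x :: 'h
    using scaleR_scaleC[of 1 x] by simp
qed (simp_all add: scaleC_add_right scaleC_add_left scaleC_scaleC)

definition infinite_dimensional :: "'h::complex_hilbert itself \<Rightarrow> bool" where
  "infinite_dimensional H \<longleftrightarrow>
     \<not> (\<exists>B::'h set. finite B \<and> module.span (*\<^sub>C) B = UNIV)"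

section \<open>Bounded geometry, property A, uniform local amenability, sparsification\<close>

text \<open>The metric space is the universe of a type of class \<open>metric_space\<close>, which is nonempty.\<close>

definition bounded_geometry :: "'a::metric_space itself \<Rightarrow> bool" where
  "bounded_geometry X \<longleftrightarrow>
     (\<forall>S>0. \<exists>K::nat. \<forall>x::'a. finite (cball x S) \<and> card (cball x S) \<le> K)"

definition property_A :: "'a::metric_space itself \<Rightarrow> bool" where
  "property_A X \<longleftrightarrow>
     (\<forall>R>0. \<forall>\<epsilon>>0. \<exists>S>0. \<exists>A :: 'a \<Rightarrow> ('a \<times> nat) set.
        (\<forall>x. finite (A x)) \<and>
        (\<forall>y z. dist y z \<le> R \<longrightarrow>
           real (card (sym_diff (A y) (A z))) < \<epsilon> * real (card (A y \<inter> A z))) \<and>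
        (\<forall>x. A x \<subseteq> cball x S \<times> UNIV))"

text \<open>The library's \<open>diameter\<close> is only meaningful on bounded sets; the diameter of an unbounded
  set is infinite here.\<close>

definition diam_le :: "'a::metric_space set \<Rightarrow> real \<Rightarrow> bool" where
  "diam_le E r \<longleftrightarrow> bounded E \<and> diameter E \<le> r"

text \<open>The library has \<open>infdist x {} = 0\<close>; the distance to the empty set is infinite here.\<close>

definition outer_boundary :: "real \<Rightarrow> 'a::metric_space set \<Rightarrow> 'a set" where
  "outer_boundary R E = {x. x \<notin> E \<and> E \<noteq> {} \<and> infdist x E \<le> R}"

definition ULA_mu :: "'a::metric_space itself \<Rightarrow> bool" where
  "ULA_mu X \<longleftrightarrow>
     (\<forall>R>0. \<forall>\<epsilon>>0. \<exists>S>0. \<forall>\<mu> :: 'a measure. prob_space \<mu> \<and> sets \<mu> = sets borel \<longrightarrow>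
        (\<exists>E. finite E \<and> diam_le E S \<and>
             measure \<mu> (outer_boundary R E) < \<epsilon> * measure \<mu> E))"

text \<open>
  The disjoint family \<open>(\<Omega>\<^sub>i)\<close> is given by the set \<open>P\<close> of its members (empty members may be dropped).
  The distance between two members is bounded below pointwise, as the library's \<open>setdist\<close> is \<open>0\<close>
  when one of the sets is empty.
\<close>

definition MSP :: "'a::metric_space itself \<Rightarrow> bool" where
  "MSP X \<longleftrightarrow>
     (\<exists>c::real. \<exists>f :: nat \<Rightarrow> nat. 0 < c \<and> c \<le> 1 \<and> mono f \<and>
       (\<forall>m. \<forall>\<mu> :: 'a measure. finite_measure \<mu> \<and> sets \<mu> = sets borel \<longrightarrow>
         (\<exists>P :: 'a set set. \<Union>P \<in> sets borel \<and> disjoint P \<and>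
            (\<forall>U\<in>P. \<forall>V\<in>P. U \<noteq> V \<longrightarrow> (\<forall>x\<in>U. \<forall>y\<in>V. real m \<le> dist x y)) \<and>
            (\<forall>U\<in>P. diam_le U (real (f m))) \<and>
            c * measure \<mu> UNIV \<le> measure \<mu> (\<Union>P))))"


section \<open>Operator norm localization\<close>

definition locally_finite_measure :: "'a::topological_space measure \<Rightarrow> bool" where
  "locally_finite_measure \<nu> \<longleftrightarrow> (\<forall>x. \<exists>U. open U \<and> x \<in> U \<and> emeasure \<nu> U < \<infinity>)"

text \<open>
  The space of square-integrable functions with values in the Hilbert space. Since the underlying
  space is countable and discrete, every class of functions modulo equality almost everywhere
  has exactly one representative vanishing at all points of measure zero, and we use these
  representatives as the elements of the space.
\<close>

definition L2 :: "'a::metric_space measure \<Rightarrow> ('a \<Rightarrow> 'h::complex_hilbert) set" where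
  "L2 \<nu> = {\<xi> \<in> borel_measurable \<nu>. integrable \<nu> (\<lambda>x. (norm (\<xi> x))\<^sup>2) \<and>
             (\<forall>x. emeasure \<nu> {x} = 0 \<longrightarrow> \<xi> x = 0)}"

definition L2_norm :: "'a::metric_space measure \<Rightarrow> ('a \<Rightarrow> 'h::complex_hilbert) \<Rightarrow> real" where
  "L2_norm \<nu> \<xi> = sqrt (\<integral>x. (norm (\<xi> x))\<^sup>2 \<partial>\<nu>)"

text \<open>Operators are functions of which only the values on \<^term>\<open>L2 \<nu>\<close> matter.\<close>

definition L2_bounded_operator ::
    "'a::metric_space measure \<Rightarrow> (('a \<Rightarrow> 'h::complex_hilbert) \<Rightarrow> ('a \<Rightarrow> 'h)) \<Rightarrow> bool" where
  "L2_bounded_operator \<nu> a \<longleftrightarrow>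
     (\<forall>\<xi>\<in>L2 \<nu>. a \<xi> \<in> L2 \<nu>) \<and>
     (\<forall>\<xi>\<in>L2 \<nu>. \<forall>\<eta>\<in>L2 \<nu>. a (\<lambda>x. \<xi> x + \<eta> x) = (\<lambda>x. a \<xi> x + a \<eta> x)) \<and>
     (\<forall>c. \<forall>\<xi>\<in>L2 \<nu>. a (\<lambda>x. c *\<^sub>C \<xi> x) = (\<lambda>x. c *\<^sub>C a \<xi> x)) \<and>
     (\<exists>K. \<forall>\<xi>\<in>L2 \<nu>. L2_norm \<nu> (a \<xi>) \<le> K * L2_norm \<nu> \<xi>)"

text \<open>As for the library's \<open>onorm\<close>, the zero vector contributes \<open>0 / 0 = 0\<close> to the supremum.\<close>

definition L2_onorm ::
    "'a::metric_space measure \<Rightarrow> (('a \<Rightarrow> 'h::complex_hilbert) \<Rightarrow> ('a \<Rightarrow> 'h)) \<Rightarrow> real" where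
  "L2_onorm \<nu> a = (SUP \<xi>\<in>L2 \<nu>. L2_norm \<nu> (a \<xi>) / L2_norm \<nu> \<xi>)"

text \<open>
  Matrix entries, normalized so that \<open>(a \<xi>) y = (\<Sum>z. a\<^sub>y\<^sub>z (\<xi> z))\<close>. The entries with respect to the
  orthonormal basis of normalized point masses differ from these by positive scalar factors, so
  the propagation is the same. It is valued in the extended non-negative reals, where the supremum
  of the empty set is \<open>0\<close>.
\<close>

definition matrix_entry ::
    "(('a \<Rightarrow> 'h::complex_hilbert) \<Rightarrow> ('a \<Rightarrow> 'h)) \<Rightarrow> 'a \<Rightarrow> 'a \<Rightarrow> 'h \<Rightarrow> 'h" where
  "matrix_entry a y z = (\<lambda>h. a (\<lambda>x. if x = z then h else 0) y)"

definition propagation ::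
    "'a::metric_space measure \<Rightarrow> (('a \<Rightarrow> 'h::complex_hilbert) \<Rightarrow> ('a \<Rightarrow> 'h)) \<Rightarrow> ennreal" where
  "propagation \<nu> a =
     Sup {ennreal (dist y z) | y z. emeasure \<nu> {y} > 0 \<and> emeasure \<nu> {z} > 0 \<and>
                                     matrix_entry a y z \<noteq> (\<lambda>h. 0)}"

definition ONL_relative ::
    "'h::complex_hilbert itself \<Rightarrow> 'a::metric_space measure \<Rightarrow> (nat \<Rightarrow> nat) \<Rightarrow> real \<Rightarrow> bool" where
  "ONL_relative H \<nu> f c \<longleftrightarrow>
     (\<forall>R::nat. \<forall>a :: ('a \<Rightarrow> 'h) \<Rightarrow> ('a \<Rightarrow> 'h).
        L2_bounded_operator \<nu> a \<and> propagation \<nu> a \<le> of_nat R \<longrightarrow>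
        (\<exists>\<zeta>\<in>L2 \<nu>. \<zeta> \<noteq> (\<lambda>x. 0) \<and> diam_le (support_on UNIV \<zeta>) (real (f R)) \<and>
           c * L2_onorm \<nu> a * L2_norm \<nu> \<zeta> \<le> L2_norm \<nu> (a \<zeta>)))"

definition ONL :: "'a::metric_space itself \<Rightarrow> 'h::complex_hilbert itself \<Rightarrow> bool" where
  "ONL X H \<longleftrightarrow>
     (\<exists>c::real. \<exists>f :: nat \<Rightarrow> nat. 0 < c \<and> c \<le> 1 \<and>
       (\<forall>\<nu> :: 'a measure.
          sets \<nu> = sets borel \<and> emeasure \<nu> UNIV \<noteq> 0 \<and> locally_finite_measure \<nu> \<longrightarrow>
          ONL_relative H \<nu> f c))"

end

theory Submission
  imports Defs
begin

text \<open>
  Cycle: property A \<open>\<Rightarrow>\<close> \<open>ULA\<^sub>\<mu>\<close> \<open>\<Rightarrow>\<close> MSP \<open>\<Rightarrow>\<close> ONL \<open>\<Rightarrow>\<close> \<open>ULA\<^sub>\<mu>\<close> \<open>\<Rightarrow>\<close> property A.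

  Failure of \<open>ULA\<^sub>\<mu>\<close> for a probability measure \<open>\<mu>\<close> means \<open>\<mu>(\<partial>E) \<ge> \<epsilon> \<mu>(E)\<close> for all small sets \<open>E\<close>; slicing
  into level sets turns this into a lower bound for the variation of functions with small
  support. Against property A, it is applied to \<open>x \<mapsto> 1\<^bsub>A_x\<^esub>(p) / |A_x|\<close> for every point \<open>p\<close>.
  Against ONL, take the conductances \<open>\<mu> x + \<mu> y\<close> on the pairs at distance at most \<open>R\<close>, the
  resulting degree measure \<open>\<nu>\<close>, the lazy random walk \<open>P\<close> and the operator \<open>a = (\<mu>/\<nu>)\<^sup>1\<^sup>/\<^sup>2 P\<^sup>n\<close> on
  \<open>L\<^sup>2(\<nu>)\<close>: constant vectors show that the norm of \<open>a\<close> is bounded below uniformly in \<open>n\<close>, whereas the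
  energy of \<open>P\<^sup>n \<zeta>\<close> is \<open>O(1/n)\<close>, so \<open>a \<zeta>\<close> is small for localized \<open>\<zeta>\<close>. MSP follows from
  \<open>ULA\<^sub>\<mu>\<close> by greedily cutting out pieces with small boundary. Property A follows by
  duality on finite sets (Ville's theorem) and compactness.
\<close>

text \<open>Everything depends on the order of quantifiers: the scale \<open>S\<close> must be fixed
  before the measure is known. In the passage from ONL this is possible because every constant of
  the walk depends only on \<open>R\<close>, \<epsilon>, the localization data and a bound
  \<open>K\<close> on the size of \<open>R\<close>-balls. The number \<open>n\<close> of steps is
  chosen from these, and localization at propagation about \<open>n R\<close> then dictates
  \<open>S\<close>. The degree measure has total mass at most \<open>2 K\<close>, but at a point
  with heavy neighbours it can be far larger than \<mu>. Isoperimetry thus controls only the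
  \<mu>-mass of a function, and the factor in front of the power of \<open>P\<close> turns the
  \<nu>-norm of the image into exactly that mass. Laziness makes \<open>P\<close> a positive
  operator, which is what forces the decay of energy. In the passage to property A, duality produces
  a kernel only on finite sets, but with a scale that does not depend on the set. Its defining
  conditions are closed under pointwise limits because the sums in them run over finite balls.
  Rounding its values to multiples of \<open>1 / N\<close> then gives finite sets.\<close>

section \<open>Discreteness\<close>

lemma diam_le_I:
  assumes "\<And>x y. x \<in> E \<Longrightarrow> y \<in> E \<Longrightarrow> dist x y \<le> r" "0 \<le> r"
  shows "diam_le E r"
  unfolding diam_le_def
proof
  show "bounded E"
    unfolding bounded_any_center using assms(1)
    by (metis bounded_any_center bounded_def bounded_empty ex_in_conv)
  show "diameter E \<le> r"
    using assms by (auto simp: diameter_def intro!: cSUP_least)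
qed

lemma diam_le_D:
  assumes "diam_le E r" "x \<in> E" "y \<in> E"
  shows "dist x y \<le> r"
  using assms diameter_bounded_bound[of E x y] by (auto simp: diam_le_def)

text \<open>The infimum over a nonempty finite set is attained; for the empty set both sides are
  empty by the convention in \<open>outer_boundary\<close>.\<close>

lemma outer_boundary_finite:
  assumes "finite E"
  shows "outer_boundary R E = {x. x \<notin> E \<and> (\<exists>y\<in>E. dist x y \<le> R)}"
proof (cases "E = {}")
  case False
  have "infdist x E = Min ((\<lambda>a. dist x a) ` E)" for x
    using False assms by (simp add: infdist_notempty cInf_eq_Min)
  then show ?thesis
    using False assms by (auto simp: outer_boundary_def Min_le_iff)
qed (simp add: outer_boundary_def)

context
  assumes bg: "bounded_geometry TYPE('a::metric_space)"
begin

lemma finite_cball: "finite (cball (x::'a) r)"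
proof -
  \<comment> \<open>\<open>bounded_geometry\<close> speaks of positive radii only, hence the maximum
    with 1.\<close>
  have "finite (cball x (max r 1))"
    using bg unfolding bounded_geometry_def by (metis less_max_iff_disj zero_less_one)
  then show ?thesis
    by (rule rev_finite_subset) auto
qed

lemma finite_of_bounded: "bounded (E::'a set) \<Longrightarrow> finite E"
  by (meson bounded_subset_cball finite_cball finite_subset)

lemma finite_of_diam_le: "diam_le (E::'a set) r \<Longrightarrow> finite E"
  by (simp add: diam_le_def finite_of_bounded)

lemma finite_neighbourhood:
  assumes "finite (F::'a set)"
  shows "finite {x. \<exists>y\<in>F. dist x y \<le> R}"
proof -
  have "{x. \<exists>y\<in>F. dist x y \<le> R} = (\<Union>y\<in>F. cball y R)"
    by (auto simp: dist_commute)
  then show ?thesis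
    using assms finite_cball by simp
qed

lemma finite_outer_boundary: "finite E \<Longrightarrow> finite (outer_boundary R (E::'a set))"
  by (rule finite_subset[OF _ finite_neighbourhood[of E R]]) (auto simp: outer_boundary_finite)

text \<open>Removing from a unit ball its finitely many other points leaves a singleton, so the
  topology is discrete. Every set is then Borel, and every function is measurable.\<close>

lemma open_any: "open (A::'a set)"
proof -
  have "open {x}" for x :: 'a
  proof -
    have "{x} = ball x 1 - (cball x 1 - {x})"
      by auto
    then show ?thesis
      by (metis open_Diff open_ball finite_imp_closed finite_Diff finite_cball)
  qed
  then have "open (\<Union>x\<in>A. {x})"
    by blast
  then show ?thesis
    by simp
qed

lemma sets_borel_UNIV: "sets (borel :: 'a measure) = UNIV"
  using open_any by (auto intro: borel_open)

lemma UNIV_eq_Union_cball: "(UNIV::'a set) = (\<Union>n::nat. cball x (real n))"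
  by (auto simp: real_arch_simple)

context
  fixes \<nu> :: "'a measure"
  assumes sets_nu: "sets \<nu> = sets borel"
begin

lemma sets_discrete: "sets \<nu> = UNIV" and space_discrete: "space \<nu> = UNIV"
  using sets_nu sets_borel_UNIV sets_eq_imp_space_eq[OF sets_nu] by auto

lemma measurable_discrete: "f \<in> measurable \<nu> N \<longleftrightarrow> range f \<subseteq> space N"
  by (auto simp: measurable_def sets_discrete space_discrete)

lemma nn_integral_finite_part:
  "finite F \<Longrightarrow> (\<integral>\<^sup>+x. f x * indicator F x \<partial>\<nu>) = (\<Sum>x\<in>F. f x * emeasure \<nu> {x})"
  by (rule nn_integral_indicator_finite) (auto simp: sets_discrete)

lemma sum_le_nn_integral:
  "finite F \<Longrightarrow> (\<Sum>x\<in>F. f x * emeasure \<nu> {x}) \<le> (\<integral>\<^sup>+x. f x \<partial>\<nu>)"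
  unfolding nn_integral_finite_part[symmetric]
  by (intro nn_integral_mono) (auto simp: indicator_def)

text \<open>The finite balls around a fixed point exhaust the space, so monotone convergence reduces
  the integral to finite partial sums. Later estimates on infinite sums are all made on such partial
  sums.\<close>

lemma nn_integral_leI:
  assumes "\<And>F. finite F \<Longrightarrow> (\<Sum>x\<in>F. f x * emeasure \<nu> {x}) \<le> B"
  shows "(\<integral>\<^sup>+x. f x \<partial>\<nu>) \<le> B"
proof -
  define D where "D n = cball (undefined::'a) (real n)" for n :: nat
  have mono: "incseq D"
    by (auto simp: incseq_def D_def)
  have *: "f x = (SUP n. f x * indicator (D n) x)" for x
  proof (rule antisym)
    obtain n where "x \<in> D n"
      using UNIV_eq_Union_cball[of undefined] unfolding D_def by blast
    then show "f x \<le> (SUP n. f x * indicator (D n) x)"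
      by (intro SUP_upper2[of n]) auto
  qed (auto intro!: SUP_least simp: indicator_def)
  have "(\<integral>\<^sup>+x. f x \<partial>\<nu>) = (\<integral>\<^sup>+x. (SUP n. f x * indicator (D n) x) \<partial>\<nu>)"
    using * by simp
  also have "\<dots> = (SUP n. \<integral>\<^sup>+x. f x * indicator (D n) x \<partial>\<nu>)"
    using mono
    by (intro nn_integral_monotone_convergence_SUP)
       (auto simp: measurable_discrete incseq_def le_fun_def indicator_def)
  also have "\<dots> \<le> B"
    using assms finite_cball by (auto intro!: SUP_least simp: nn_integral_finite_part D_def)
  finally show ?thesis .
qed

end

end

section \<open>Level sets and isoperimetry\<close>

context
  assumes bg: "bounded_geometry TYPE('a::metric_space)"
begin

text \<open>Layer by layer, by induction on the size of the support: subtracting the least positive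
  value \<open>t\<close> leaves a function \<open>h\<close> with smaller support, and the layer
  removed is \<open>t\<close> times the indicator of the support \<open>E\<close>, to which
  isoperimetry applies. The set \<open>F\<close> contains the \<open>R\<close>-neighbourhood of the
  support, so all sums are finite and the boundary of every layer is counted.\<close>

lemma coarea:
  fixes m g :: "'a \<Rightarrow> real"
  assumes iso: "\<And>E. finite E \<Longrightarrow> E \<noteq> {} \<Longrightarrow> diam_le E S \<Longrightarrow> \<epsilon> * sum m E \<le> sum m (outer_boundary R E)"
    and m: "\<And>x. 0 \<le> m x" and F: "finite F" and R: "0 \<le> R" and S: "0 \<le> S"
    and "\<And>x y. g x \<noteq> 0 \<Longrightarrow> dist x y \<le> R \<Longrightarrow> y \<in> F"
    and "\<And>x. 0 \<le> g x"
    and "\<And>x y. g x \<noteq> 0 \<Longrightarrow> g y \<noteq> 0 \<Longrightarrow> dist x y \<le> S"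
  shows "\<epsilon> * (\<Sum>x\<in>F. m x * g x) \<le> (\<Sum>x\<in>F. m x * (\<Sum>y\<in>cball x R. \<bar>g y - g x\<bar>))"
  using assms(6-)
proof (induction "card {x. g x \<noteq> 0}" arbitrary: g rule: less_induct)
  case (less g)
  define E where "E = {x. g x \<noteq> 0}"
  have EF: "E \<subseteq> F"
    using less.prems(1)[of x x for x] R by (auto simp: E_def)
  then have finE: "finite E"
    using F finite_subset by blast
  show ?case
  proof (cases "E = {}")
    case True
    then have "g x = 0" for x
      by (auto simp: E_def)
    then show ?thesis
      by simp
  next
    case False
    define t where "t = Min (g ` E)"
    define h where "h x = (if x \<in> E then g x - t else 0)" for x
    define i where "i x = (if x \<in> E then 1 else 0::real)" for x
    have t_le: "t \<le> g x" if "x \<in> E" for x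
      using that finE by (simp add: t_def)
    have "t \<in> g ` E"
      using finE False by (simp add: t_def)
    then obtain x0 where x0: "x0 \<in> E" "t = g x0"
      by auto
    then have "0 < t"
      using less.prems(2)[of x0] by (auto simp: E_def less_le)
    have supp_h: "{x. h x \<noteq> 0} \<subseteq> E"
      by (auto simp: h_def split: if_splits)
    moreover have "h x0 = 0"
      using x0 by (simp add: h_def)
    ultimately have "{x. h x \<noteq> 0} \<subset> E"
      using x0 by auto
    then have "card {x. h x \<noteq> 0} < card {x. g x \<noteq> 0}"
      unfolding E_def[symmetric] using finE psubset_card_mono by blast
    then have IH: "\<epsilon> * (\<Sum>x\<in>F. m x * h x) \<le> (\<Sum>x\<in>F. m x * (\<Sum>y\<in>cball x R. \<bar>h y - h x\<bar>))"
    proof (rule less.hyps)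
      fix x y
      show "0 \<le> h x"
        using t_le by (auto simp: h_def)
      show "h x \<noteq> 0 \<Longrightarrow> dist x y \<le> R \<Longrightarrow> y \<in> F"
        using supp_h less.prems(1)[of x y] unfolding E_def by auto
      show "h x \<noteq> 0 \<Longrightarrow> h y \<noteq> 0 \<Longrightarrow> dist x y \<le> S"
        using supp_h less.prems(3)[of x y] unfolding E_def by auto
    qed
    have g_eq: "g x = h x + t * i x" for x
      by (auto simp: h_def i_def E_def)
    \<comment> \<open>The variation splits without cancellation: \<open>h\<close> and
      \<open>i\<close> are both non-decreasing functions of \<open>g\<close>, so their increments
      between two points never have opposite signs.\<close>
    have "\<bar>g y - g x\<bar> = \<bar>h y - h x\<bar> + t * \<bar>i y - i x\<bar>" for x y
      using t_le[of x] t_le[of y] \<open>0 < t\<close> by (auto simp: h_def i_def E_def)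
    then have rhs: "(\<Sum>x\<in>F. m x * (\<Sum>y\<in>cball x R. \<bar>g y - g x\<bar>)) =
       (\<Sum>x\<in>F. m x * (\<Sum>y\<in>cball x R. \<bar>h y - h x\<bar>)) + t * (\<Sum>x\<in>F. m x * (\<Sum>y\<in>cball x R. \<bar>i y - i x\<bar>))"
      by (simp add: sum.distrib sum_distrib_left algebra_simps)
    have lhs: "\<epsilon> * (\<Sum>x\<in>F. m x * g x) = \<epsilon> * (\<Sum>x\<in>F. m x * h x) + t * (\<epsilon> * (\<Sum>x\<in>F. m x * i x))"
      unfolding g_eq by (simp add: sum.distrib sum_distrib_left algebra_simps)
    have "diam_le E S"
      using less.prems(3) S by (intro diam_le_I) (auto simp: E_def)
    then have "\<epsilon> * sum m E \<le> sum m (outer_boundary R E)"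
      using iso finE False by blast
    \<comment> \<open>A boundary point has a point of \<open>E\<close> within distance
      \<open>R\<close>, where the indicator jumps by 1; its inner sum is therefore at least
      1.\<close>
    also have "\<dots> \<le> (\<Sum>x\<in>outer_boundary R E. m x * (\<Sum>y\<in>cball x R. \<bar>i y - i x\<bar>))"
    proof (rule sum_mono)
      fix x assume "x \<in> outer_boundary R E"
      then obtain y where y: "x \<notin> E" "y \<in> E" "dist x y \<le> R"
        using finE by (auto simp: outer_boundary_finite)
      have "\<bar>i y - i x\<bar> \<le> (\<Sum>y\<in>cball x R. \<bar>i y - i x\<bar>)"
        using y finite_cball[OF bg] by (intro member_le_sum) auto
      then have "1 \<le> (\<Sum>y\<in>cball x R. \<bar>i y - i x\<bar>)"
        using y by (simp add: i_def)
      then show "m x \<le> m x * (\<Sum>y\<in>cball x R. \<bar>i y - i x\<bar>)"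
        using m[of x] by (simp add: mult_le_cancel_left1)
    qed
    also have "\<dots> \<le> (\<Sum>x\<in>F. m x * (\<Sum>y\<in>cball x R. \<bar>i y - i x\<bar>))"
    proof (rule sum_mono2[OF F])
      show "outer_boundary R E \<subseteq> F"
        using less.prems(1) finE by (auto simp: outer_boundary_finite E_def dist_commute)
    qed (auto intro!: mult_nonneg_nonneg m sum_nonneg)
    also have "sum m E = (\<Sum>x\<in>F. m x * i x)"
      using EF F by (intro sum.mono_neutral_cong_left) (auto simp: i_def)
    finally show ?thesis
      using IH \<open>0 < t\<close> unfolding lhs rhs by (intro add_mono mult_left_mono) auto
  qed
qed

end

section \<open>Point weights and finite forms of uniform local amenability\<close>

definition weight_measure :: "('a \<Rightarrow> real) \<Rightarrow> 'a measure" where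
  "weight_measure w = density (count_space UNIV) (\<lambda>x. ennreal (w x))"

lemma emeasure_weight_measure_singleton: "emeasure (weight_measure w) {x} = ennreal (w x)"
  by (subst weight_measure_def, subst emeasure_density) (simp_all add: nn_integral_count_space'[of "{x}"])

lemma emeasure_weight_measure_finite_support:
  assumes "finite Y" "\<And>x. x \<notin> Y \<Longrightarrow> w x = 0" "\<And>x. 0 \<le> w x"
  shows "emeasure (weight_measure w) A = ennreal (sum w (A \<inter> Y))"
proof -
  have "emeasure (weight_measure w) A = (\<integral>\<^sup>+x. ennreal (w x) * indicator A x \<partial>count_space UNIV)"
    unfolding weight_measure_def by (rule emeasure_density) auto
  also have "\<dots> = (\<Sum>x\<in>A \<inter> Y. ennreal (w x) * indicator A x)"
    using assms by (intro nn_integral_count_space') (auto simp: indicator_def)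
  also have "\<dots> = (\<Sum>x\<in>A \<inter> Y. ennreal (w x))"
    by (intro sum.cong) auto
  finally show ?thesis
    using assms(3) by simp
qed

context
  assumes bg: "bounded_geometry TYPE('a::metric_space)"
begin

lemma sets_weight_measure: "sets (weight_measure w) = sets (borel :: 'a measure)"
  by (simp add: weight_measure_def sets_borel_UNIV[OF bg])

lemma measure_finite_set:
  fixes \<mu> :: "'a measure"
  assumes "sets \<mu> = sets borel" "finite_measure \<mu>" "finite F"
  shows "measure \<mu> F = (\<Sum>x\<in>F. measure \<mu> {x})"
  using assms sets_discrete[OF bg assms(1)]
  by (intro finite_measure.finite_measure_eq_sum_singleton) auto

text \<open>Inner regularity with respect to finite sets: if all finite subsets of \<open>A\<close>
  had mass at most \<open>r\<close>, then so would \<open>A\<close>, by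
  \<open>nn_integral_leI\<close>.\<close>

lemma finite_subset_measure:
  fixes \<mu> :: "'a measure"
  assumes sets: "sets \<mu> = sets borel" and fin: "finite_measure \<mu>" and less: "r < measure \<mu> A" and "0 \<le> r"
  obtains F where "finite F" "F \<subseteq> A" "r < (\<Sum>x\<in>F. measure \<mu> {x})"
proof (rule ccontr)
  note thesisI = that
  assume "\<not> thesis"
  then have *: "(\<Sum>x\<in>F. measure \<mu> {x}) \<le> r" if "finite F" "F \<subseteq> A" for F
    using that thesisI by (meson not_le)
  have "(\<integral>\<^sup>+x. indicator A x \<partial>\<mu>) \<le> ennreal r"
  proof (rule nn_integral_leI[OF bg sets])
    fix F :: "'a set" assume F: "finite F"
    have "(\<Sum>x\<in>F. indicator A x * emeasure \<mu> {x}) = (\<Sum>x\<in>F \<inter> A. emeasure \<mu> {x})"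
      using F by (intro sum.mono_neutral_cong_right) (auto simp: indicator_def)
    also have "\<dots> = ennreal (\<Sum>x\<in>F \<inter> A. measure \<mu> {x})"
      using fin by (simp add: finite_measure.emeasure_eq_measure)
    finally show "(\<Sum>x\<in>F. indicator A x * emeasure \<mu> {x}) \<le> ennreal r"
      using *[of "F \<inter> A"] F by (simp add: ennreal_leI)
  qed
  then have "emeasure \<mu> A \<le> ennreal r"
    using sets_discrete[OF bg sets] by simp
  then show False
    using less \<open>0 \<le> r\<close> fin by (simp add: finite_measure.emeasure_eq_measure)
qed

text \<open>Normalizing the weights on \<open>Y\<close> and extending them by zero gives a
  probability measure; both sides of the inequality scale alike. The point is that \<open>S\<close>
  serves all \<open>Y\<close> and \<open>w\<close>.\<close>

lemma ULA_mu_finite_weights: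
  fixes R \<epsilon> :: real
  assumes "ULA_mu TYPE('a)" "0 < R" "0 < \<epsilon>"
  obtains S where "0 < S" "\<And>(w :: 'a \<Rightarrow> real) Y. finite Y \<Longrightarrow> (\<And>x. x \<in> Y \<Longrightarrow> 0 \<le> w x) \<Longrightarrow> 0 < sum w Y \<Longrightarrow>
     \<exists>E. finite E \<and> diam_le E S \<and> sum w (outer_boundary R E \<inter> Y) < \<epsilon> * sum w (E \<inter> Y)"
proof -
  obtain S where S: "0 < S" "\<And>\<mu> :: 'a measure. prob_space \<mu> \<Longrightarrow> sets \<mu> = sets borel \<Longrightarrow>
        (\<exists>E. finite E \<and> diam_le E S \<and> measure \<mu> (outer_boundary R E) < \<epsilon> * measure \<mu> E)"
    using assms(1)[unfolded ULA_mu_def, rule_format, OF assms(2,3)] by auto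
  show thesis
  proof (rule that[OF S(1)])
    fix w :: "'a \<Rightarrow> real" and Y :: "'a set"
    assume Y: "finite Y" "\<And>x. x \<in> Y \<Longrightarrow> 0 \<le> w x" "0 < sum w Y"
    define v where "v x = (if x \<in> Y then w x / sum w Y else 0)" for x
    have sum_v: "sum v (A \<inter> Y) = sum w (A \<inter> Y) / sum w Y" for A
      by (simp add: v_def sum_divide_distrib)
    have em: "emeasure (weight_measure v) A = ennreal (sum w (A \<inter> Y) / sum w Y)" for A
      unfolding sum_v[symmetric] using Y
      by (intro emeasure_weight_measure_finite_support) (auto simp: v_def intro!: divide_nonneg_pos)
    then have m: "measure (weight_measure v) A = sum w (A \<inter> Y) / sum w Y" for A
      unfolding measure_def em using Y by (intro enn2real_ennreal divide_nonneg_pos sum_nonneg) auto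
    have "prob_space (weight_measure v)"
      using em[of UNIV] Y by (intro prob_spaceI) (auto simp: weight_measure_def)
    then obtain E where E: "finite E" "diam_le E S"
      "measure (weight_measure v) (outer_boundary R E) < \<epsilon> * measure (weight_measure v) E"
      using S(2) sets_weight_measure by blast
    then show "\<exists>E. finite E \<and> diam_le E S \<and> sum w (outer_boundary R E \<inter> Y) < \<epsilon> * sum w (E \<inter> Y)"
      using Y(3) by (intro exI[of _ E]) (simp add: m field_simps)
  qed
qed

text \<open>Shaped for a proof by contradiction: the point masses \<open>w\<close> of a measure
  without a good set \<open>E\<close> at scale \<open>S\<close> satisfy all four premises. More than
  half of the total mass 1 sits on a finite set, which is enough to keep the lower bounds of the
  later arguments away from zero.\<close>

lemma ULA_mu_I:
  assumes "\<And>R \<epsilon>. 0 < R \<Longrightarrow> 0 < \<epsilon> \<Longrightarrow> \<exists>S>0. \<forall>w :: 'a \<Rightarrow> real.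
     (\<forall>x. 0 \<le> w x) \<longrightarrow> (\<forall>F. finite F \<longrightarrow> sum w F \<le> 1) \<longrightarrow> (\<exists>F. finite F \<and> 1/2 < sum w F) \<longrightarrow>
     (\<forall>E. finite E \<longrightarrow> E \<noteq> {} \<longrightarrow> diam_le E S \<longrightarrow> \<epsilon> * sum w E \<le> sum w (outer_boundary R E)) \<longrightarrow> False"
  shows "ULA_mu TYPE('a)"
  unfolding ULA_mu_def
proof (intro allI impI)
  fix R \<epsilon> :: real assume R: "0 < R" and e: "0 < \<epsilon>"
  obtain S where S: "0 < S" "\<And>w :: 'a \<Rightarrow> real. (\<And>x. 0 \<le> w x) \<Longrightarrow>
     (\<And>F. finite F \<Longrightarrow> sum w F \<le> 1) \<Longrightarrow> (\<exists>F. finite F \<and> 1/2 < sum w F) \<Longrightarrow>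
     (\<And>E. finite E \<Longrightarrow> E \<noteq> {} \<Longrightarrow> diam_le E S \<Longrightarrow> \<epsilon> * sum w E \<le> sum w (outer_boundary R E)) \<Longrightarrow> False"
    using assms[OF R e] by metis
  show "\<exists>S>0. \<forall>\<mu>::'a measure. prob_space \<mu> \<and> sets \<mu> = sets borel \<longrightarrow>
            (\<exists>E. finite E \<and> diam_le E S \<and> measure \<mu> (outer_boundary R E) < \<epsilon> * measure \<mu> E)"
  proof (intro exI[of _ S] conjI allI impI S(1))
    fix \<mu> :: "'a measure" assume "prob_space \<mu> \<and> sets \<mu> = sets borel"
    then have \<mu>: "prob_space \<mu>" "sets \<mu> = sets borel" "finite_measure \<mu>"
      by (auto simp: prob_space_def)
    interpret prob_space \<mu> by fact
    define w where "w x = measure \<mu> {x}" for x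
    have w: "measure \<mu> F = sum w F" if "finite F" for F
      unfolding w_def using measure_finite_set \<mu> that by blast
    show "\<exists>E. finite E \<and> diam_le E S \<and> measure \<mu> (outer_boundary R E) < \<epsilon> * measure \<mu> E"
    proof (rule ccontr)
      assume neg: "\<not> ?thesis"
      show False
      proof (rule S(2))
        show "0 \<le> w x" for x
          by (simp add: w_def)
        show "sum w F \<le> 1" if "finite F" for F
          using w[OF that] prob_le_1[of F] by simp
        show "\<exists>F. finite F \<and> 1/2 < sum w F"
          using finite_subset_measure[OF \<mu>(2,3), of "1/2" UNIV] prob_space
            space_discrete[OF bg \<mu>(2)] unfolding w_def by auto
        show "\<epsilon> * sum w E \<le> sum w (outer_boundary R E)" if "finite E" "diam_le E S" for E
          using neg that w[of E] w[of "outer_boundary R E"] finite_outer_boundary[OF bg]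
          by (metis not_le)
      qed
    qed
  qed
qed

end

section \<open>From property A to uniform local amenability\<close>

lemma sum_diff_normalized_indicator_le:
  assumes fin: "finite A" "finite B" "finite P"
    and less: "real (card (sym_diff A B)) < \<delta> * real (card (A \<inter> B))"
  shows "(\<Sum>p\<in>P. \<bar>(if p \<in> A then 1 / real (card A) else 0) - (if p \<in> B then 1 / real (card B) else 0)\<bar>) \<le> 2 * \<delta>"
    (is "(\<Sum>p\<in>P. ?f p) \<le> _")
proof -
  define a b i d where "a = real (card A)" "b = real (card B)" "i = real (card (A \<inter> B))"
    "d = real (card (sym_diff A B))"
  have [simp]: "finite (A \<inter> B)" "finite (sym_diff A B)"
    using fin by auto
  \<comment> \<open>The strict inequality forces the intersection to be nonempty, since a
    cardinality is never below zero.\<close>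
  have "i \<noteq> 0"
    using less by (auto simp: a_b_i_d_def)
  then have i: "0 < i"
    by (simp only: a_b_i_d_def of_nat_0_less_iff of_nat_eq_0_iff neq0_conv)
  have le: "i \<le> a" "i \<le> b"
    using fin by (auto simp: a_b_i_d_def card_mono)
  have "card A = card (A \<inter> B) + card (A - B)" "card B = card (A \<inter> B) + card (B - A)"
    using fin by (auto simp: card_Diff_subset_Int Int_commute card_mono)
  moreover have "card (sym_diff A B) = card (A - B) + card (B - A)"
    using fin by (intro card_Un_disjoint) auto
  ultimately have ab: "\<bar>a - b\<bar> \<le> d"
    by (simp add: a_b_i_d_def)
  have d: "d / i \<le> \<delta>"
    using less i by (simp add: a_b_i_d_def field_simps)
  have "(\<Sum>p\<in>P. ?f p) \<le> (\<Sum>p\<in>(A \<inter> B) \<union> sym_diff A B. ?f p)"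
  proof -
    have "(\<Sum>p\<in>P. ?f p) = (\<Sum>p\<in>P \<inter> (A \<union> B). ?f p)"
      using fin by (intro sum.mono_neutral_right) auto
    also have "\<dots> \<le> (\<Sum>p\<in>(A \<inter> B) \<union> sym_diff A B. ?f p)"
      using fin by (intro sum_mono2) auto
    finally show ?thesis .
  qed
  also have "\<dots> = (\<Sum>p\<in>A \<inter> B. ?f p) + (\<Sum>p\<in>sym_diff A B. ?f p)"
    using fin by (intro sum.union_disjoint) auto
  \<comment> \<open>On the intersection the values \<open>1 / a\<close> and \<open>1 / b\<close>
    differ by at most \<open>d / (a * b)\<close>; on the symmetric difference only one of them
    occurs, and it is at most \<open>1 / i\<close>. Each part contributes at most
    \<open>d / i\<close> in total.\<close>
  also have "\<dots> \<le> (\<Sum>p\<in>A \<inter> B. d / (a * b)) + (\<Sum>p\<in>sym_diff A B. 1 / i)"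
  proof (intro add_mono sum_mono)
    fix p assume "p \<in> A \<inter> B"
    then have "?f p = \<bar>1 / a - 1 / b\<bar>"
      by (simp add: a_b_i_d_def)
    also have "\<dots> = \<bar>a - b\<bar> / (a * b)"
    proof -
      have "1 / a - 1 / b = (b - a) / (a * b)"
        using i le by (simp add: field_simps)
      then show ?thesis
        using i le by (simp add: abs_minus_commute)
    qed
    also have "\<dots> \<le> d / (a * b)"
      using i le ab by (intro divide_right_mono) auto
    finally show "?f p \<le> d / (a * b)" .
  next
    fix p assume "p \<in> sym_diff A B"
    then have "?f p = 1 / a \<or> ?f p = 1 / b"
      by (auto simp: a_b_i_d_def)
    then show "?f p \<le> 1 / i"
      using i le by (auto simp: frac_le)
  qed
  also have "\<dots> = i * d / (a * b) + d / i"
    by (simp add: a_b_i_d_def)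
  also have "i * d / (a * b) \<le> d / i"
  proof -
    have "i * (i * d) \<le> a * (b * d)"
      using i le by (intro mult_mono) (auto simp: a_b_i_d_def)
    then show ?thesis
      using i le by (simp add: field_simps)
  qed
  finally show ?thesis
    using d by simp
qed

context
  assumes bg: "bounded_geometry TYPE('a::metric_space)"
begin

text \<open>For fixed \<open>p\<close> the function \<open>g p\<close> lives in an
  \<open>S\<close>-ball, so \<open>coarea\<close> applies at scale \<open>2 * S\<close>; for fixed
  \<open>x\<close> the values \<open>g p x\<close> sum to 1 over \<open>p\<close>. Adding the
  inequalities over \<open>p\<close> bounds \<epsilon> times the mass by the averaged variation of
  the normalized indicators, which property A makes small.\<close>

lemma property_A_imp_ULA_mu:
  assumes "property_A TYPE('a)"
  shows "ULA_mu TYPE('a)"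
proof (rule ULA_mu_I[OF bg])
  fix R \<epsilon> :: real assume R: "0 < R" and e: "0 < \<epsilon>"
  obtain K :: nat where K: "\<And>x::'a. card (cball x R) \<le> K"
    using bg R unfolding bounded_geometry_def by metis
  \<comment> \<open>At most \<open>K\<close> neighbours with variation \<open>2 * \<delta>\<close>
    each have to stay within half of \<epsilon>; the added 1 keeps the denominator positive.\<close>
  define \<delta> where "\<delta> = \<epsilon> / (4 * (real K + 1))"
  have \<delta>: "0 < \<delta>"
    using e by (simp add: \<delta>_def)
  have K\<delta>: "real K * (2 * \<delta>) \<le> \<epsilon> / 2"
    using e by (simp add: \<delta>_def field_simps)
  obtain S and A :: "'a \<Rightarrow> ('a \<times> nat) set" where S: "0 < S" and finA: "\<And>x. finite (A x)"
    and A: "\<And>y z. dist y z \<le> R \<Longrightarrow> real (card (sym_diff (A y) (A z))) < \<delta> * real (card (A y \<inter> A z))"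
    and subA: "\<And>x. A x \<subseteq> cball x S \<times> UNIV"
    using assms R \<delta> unfolding property_A_def by metis
  \<comment> \<open>For the pair \<open>x\<close>, \<open>x\<close> the symmetric difference is
    empty, and the strict inequality makes \<open>A x\<close> nonempty.\<close>
  have neA: "A x \<noteq> {}" for x
    using A[of x x] R by auto
  define g where "g p x = (if p \<in> A x then 1 / real (card (A x)) else 0)" for p x
  have g_supp: "dist x (fst p) \<le> S" if "g p x \<noteq> 0" for p x
    using that subA[of x] by (auto simp: g_def split: if_splits)
  show "\<exists>S>0. \<forall>w :: 'a \<Rightarrow> real.
     (\<forall>x. 0 \<le> w x) \<longrightarrow> (\<forall>F. finite F \<longrightarrow> sum w F \<le> 1) \<longrightarrow> (\<exists>F. finite F \<and> 1/2 < sum w F) \<longrightarrow>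
     (\<forall>E. finite E \<longrightarrow> E \<noteq> {} \<longrightarrow> diam_le E S \<longrightarrow> \<epsilon> * sum w E \<le> sum w (outer_boundary R E)) \<longrightarrow> False"
  proof (intro exI[of _ "2 * S"] conjI allI impI)
    show "0 < 2 * S"
      using S by simp
    fix w :: "'a \<Rightarrow> real"
    assume w: "\<forall>x. 0 \<le> w x" and sum1: "\<forall>F. finite F \<longrightarrow> sum w F \<le> 1"
      and half: "\<exists>F. finite F \<and> 1/2 < sum w F"
      and iso: "\<forall>E. finite E \<longrightarrow> E \<noteq> {} \<longrightarrow> diam_le E (2 * S) \<longrightarrow> \<epsilon> * sum w E \<le> sum w (outer_boundary R E)"
    obtain F0 where F0: "finite F0" "1/2 < sum w F0"
      using half by blast
    \<comment> \<open>\<open>P\<close> collects all indices that are met by \<open>F0\<close>, and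
      \<open>F\<close> contains the \<open>R\<close>-neighbourhood of the support of each
      \<open>g p\<close> with \<open>p\<close> in \<open>P\<close>, as \<open>coarea\<close>
      demands.\<close>
    define P where "P = (\<Union>x\<in>F0. A x)"
    define F where "F = (\<Union>p\<in>P. cball (fst p) (S + R))"
    have finP: "finite P" and finF: "finite F"
      using F0 finA finite_cball[OF bg] by (auto simp: P_def F_def)
    have F0F: "F0 \<subseteq> F"
    proof
      fix x assume "x \<in> F0"
      moreover obtain p where "p \<in> A x"
        using neA by blast
      ultimately show "x \<in> F"
        using subA[of x] R unfolding F_def P_def by (force simp: dist_commute)
    qed
    have "\<epsilon> * (\<Sum>x\<in>F. w x * g p x) \<le> (\<Sum>x\<in>F. w x * (\<Sum>y\<in>cball x R. \<bar>g p y - g p x\<bar>))" if "p \<in> P" for p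
    proof (rule coarea[OF bg, where S = "2 * S"])
      fix x y assume *: "g p x \<noteq> 0"
      show "y \<in> F" if "dist x y \<le> R"
      proof -
        have "dist (fst p) y \<le> S + R"
          using dist_triangle[of "fst p" y x] g_supp[OF *] that by (simp add: dist_commute)
        then show ?thesis
          using \<open>p \<in> P\<close> by (auto simp: F_def)
      qed
      show "dist x y \<le> 2 * S" if "g p y \<noteq> 0"
        using dist_triangle[of x y "fst p"] g_supp[OF *] g_supp[OF that] by (simp add: dist_commute)
    qed (use iso w finF R S in \<open>auto simp: g_def\<close>)
    then have "(\<Sum>p\<in>P. \<epsilon> * (\<Sum>x\<in>F. w x * g p x)) \<le> (\<Sum>p\<in>P. \<Sum>x\<in>F. w x * (\<Sum>y\<in>cball x R. \<bar>g p y - g p x\<bar>))"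
      by (rule sum_mono)
    also have "\<dots> = (\<Sum>x\<in>F. w x * (\<Sum>y\<in>cball x R. \<Sum>p\<in>P. \<bar>g p y - g p x\<bar>))"
      by (subst sum.swap, simp add: sum_distrib_left[symmetric], subst sum.swap, simp)
    also have "\<dots> \<le> (\<Sum>x\<in>F. w x * (\<epsilon> / 2))"
    proof (intro sum_mono mult_left_mono)
      fix x
      have "(\<Sum>p\<in>P. \<bar>g p y - g p x\<bar>) \<le> 2 * \<delta>" if "y \<in> cball x R" for y
        unfolding g_def using finA finP that
        by (intro sum_diff_normalized_indicator_le A) (auto simp: dist_commute)
      then have "(\<Sum>y\<in>cball x R. \<Sum>p\<in>P. \<bar>g p y - g p x\<bar>) \<le> real (card (cball x R)) * (2 * \<delta>)"
        by (rule sum_bounded_above)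
      also have "\<dots> \<le> real K * (2 * \<delta>)"
        using K[of x] \<delta> by (intro mult_right_mono) auto
      finally show "(\<Sum>y\<in>cball x R. \<Sum>p\<in>P. \<bar>g p y - g p x\<bar>) \<le> \<epsilon> / 2"
        using K\<delta> by simp
    qed (use w in auto)
    also have "\<dots> \<le> \<epsilon> / 2"
    proof -
      have "sum w F \<le> 1"
        using sum1 finF by blast
      then show ?thesis
        using e mult_right_mono[of "sum w F" 1 "\<epsilon> / 2"] by (simp only: sum_distrib_right[symmetric] mult_1)
    qed
    finally have upper: "(\<Sum>p\<in>P. \<epsilon> * (\<Sum>x\<in>F. w x * g p x)) \<le> \<epsilon> / 2" .
    \<comment> \<open>Over \<open>F0\<close> nothing of the sum over \<open>p\<close> is missing
      from \<open>P\<close>; at the other points of \<open>F\<close> non-negativity is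
      enough.\<close>
    have "sum w F0 = (\<Sum>x\<in>F0. w x * (\<Sum>p\<in>P. g p x))"
    proof (rule sum.cong)
      fix x assume x: "x \<in> F0"
      have "(\<Sum>p\<in>P. g p x) = (\<Sum>p\<in>A x. 1 / real (card (A x)))"
        unfolding g_def using x finP by (intro sum.mono_neutral_cong_right) (auto simp: P_def)
      then show "w x = w x * (\<Sum>p\<in>P. g p x)"
        using finA[of x] neA[of x] by simp
    qed simp
    also have "\<dots> \<le> (\<Sum>x\<in>F. w x * (\<Sum>p\<in>P. g p x))"
      using F0F finF w by (intro sum_mono2) (auto intro!: mult_nonneg_nonneg sum_nonneg simp: g_def)
    also have "\<dots> = (\<Sum>p\<in>P. \<Sum>x\<in>F. w x * g p x)"
      by (subst sum.swap) (simp add: sum_distrib_left)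
    finally have "\<epsilon> / 2 < (\<Sum>p\<in>P. \<epsilon> * (\<Sum>x\<in>F. w x * g p x))"
      using F0(2) e by (simp add: sum_distrib_left[symmetric] field_simps)
    with upper show False
      by simp
  qed
qed

end

section \<open>From uniform local amenability to metric sparsification\<close>

context
  assumes bg: "bounded_geometry TYPE('a::metric_space)"
begin

text \<open>Greedy selection: \<open>D\<close> is kept as a piece, its boundary \<open>B\<close> is
  discarded to separate it from the remainder \<open>Z\<close>, and the selection continues in
  \<open>Z\<close>. Each \<open>B\<close> is lighter than its \<open>D\<close>, whence the factor 2.
  The hypothesis ranges over all finite \<open>Y\<close> because it is applied to the weights
  restricted to the successive remainders.\<close>

lemma sparse_family_of_isoperimetry:
  fixes w :: "'a \<Rightarrow> real"
  assumes iso: "\<And>Y. finite Y \<Longrightarrow> 0 < sum w Y \<Longrightarrow>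
        \<exists>E. finite E \<and> diam_le E S \<and> sum w (outer_boundary R E \<inter> Y) < sum w (E \<inter> Y)"
    and w: "\<And>x. 0 \<le> w x" and S: "0 \<le> S" and "finite Y"
  shows "\<exists>P. disjoint P \<and> \<Union>P \<subseteq> Y \<and> (\<forall>U\<in>P. diam_le U S) \<and>
     (\<forall>U\<in>P. \<forall>V\<in>P. U \<noteq> V \<longrightarrow> (\<forall>x\<in>U. \<forall>y\<in>V. R \<le> dist x y)) \<and> sum w Y \<le> 2 * sum w (\<Union>P)"
  using \<open>finite Y\<close>
proof (induction "card Y" arbitrary: Y rule: less_induct)
  case less
  show ?case
  proof (cases "0 < sum w Y")
    case False
    then show ?thesis
      by (intro exI[of _ "{}"]) auto
  next
    case True
    then obtain E where E: "finite E" "diam_le E S"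
        "sum w (outer_boundary R E \<inter> Y) < sum w (E \<inter> Y)"
      using iso less.prems by blast
    define D where "D = E \<inter> Y"
    define B where "B = outer_boundary R E \<inter> Y"
    have "0 \<le> sum w B"
      using w by (simp add: sum_nonneg)
    then have "D \<noteq> {}"
      using E(3) by (auto simp: D_def B_def)
    have BD: "B \<inter> D = {}" and subs: "B \<subseteq> Y" "D \<subseteq> Y"
      by (auto simp: B_def D_def outer_boundary_def)
    define Z where "Z = Y - D - B"
    have finZ: "finite Z" "finite B" "finite D"
      using less.prems by (auto simp: Z_def B_def D_def)
    have "Z \<subset> Y"
      using \<open>D \<noteq> {}\<close> subs by (auto simp: Z_def)
    then obtain P where P: "disjoint P" "\<Union>P \<subseteq> Z" "\<And>U. U \<in> P \<Longrightarrow> diam_le U S"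
       "\<And>U V x y. U \<in> P \<Longrightarrow> V \<in> P \<Longrightarrow> U \<noteq> V \<Longrightarrow> x \<in> U \<Longrightarrow> y \<in> V \<Longrightarrow> R \<le> dist x y"
       "sum w Z \<le> 2 * sum w (\<Union>P)"
      using less.hyps[of Z] finZ less.prems psubset_card_mono by metis
    have far: "R \<le> dist x y" if "x \<in> D" "y \<in> Z" for x y
    proof (rule ccontr)
      assume "\<not> R \<le> dist x y"
      then show False
        using that E(1) by (auto simp: Z_def D_def B_def outer_boundary_finite dist_commute not_le)
    qed
    have D_diam: "diam_le D S"
      using diam_le_D[OF E(2)] S by (intro diam_le_I) (auto simp: D_def)
    have disj: "D \<inter> \<Union>P = {}"
      using P(2) by (auto simp: Z_def)
    have "sum w Y = sum w Z + sum w D + sum w B"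
    proof -
      have "Y = (Z \<union> D) \<union> B"
        using subs by (auto simp: Z_def)
      moreover have "sum w ((Z \<union> D) \<union> B) = sum w (Z \<union> D) + sum w B" "sum w (Z \<union> D) = sum w Z + sum w D"
        using finZ BD by (intro sum.union_disjoint; auto simp: Z_def)+
      ultimately show ?thesis
        by simp
    qed
    also have "\<dots> \<le> 2 * sum w (\<Union>P) + 2 * sum w D"
      using P(5) E(3) by (simp add: B_def D_def)
    also have "\<dots> = 2 * sum w (D \<union> \<Union>P)"
      using finZ disj finite_subset[OF P(2)] by (simp add: sum.union_disjoint)
    finally have "sum w Y \<le> 2 * sum w (\<Union>(insert D P))"
      by simp
    moreover have "disjoint (insert D P)"
      using P(1) disj by (auto simp: disjoint_def)
    moreover have "R \<le> dist x y" if uv: "U \<in> insert D P" "V \<in> insert D P" "U \<noteq> V" "x \<in> U" "y \<in> V" for U V x y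
    proof -
      consider "U \<in> P" "V \<in> P" | "U = D" "V \<in> P" | "U \<in> P" "V = D"
        using uv by blast
      then show ?thesis
      proof cases
        case 1
        then show ?thesis
          using P(4) uv by blast
      next
        case 2
        then show ?thesis
          using P(2) far uv by blast
      next
        case 3
        then show ?thesis
          using P(2) far uv by (metis Union_iff dist_commute subsetD)
      qed
    qed
    moreover have "\<Union>(insert D P) \<subseteq> Y"
      using P(2) subs by (auto simp: Z_def)
    ultimately show ?thesis
      using D_diam P(3) by (intro exI[of _ "insert D P"]) auto
  qed
qed

lemma ULA_mu_imp_MSP:
  assumes "ULA_mu TYPE('a)"
  shows "MSP TYPE('a)"
proof -
  \<comment> \<open>Boundary ratio 1 at radius \<open>m + 1\<close>; the shift keeps the radius
    positive when \<open>m = 0\<close>.\<close>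
  define Q :: "nat \<Rightarrow> real \<Rightarrow> bool" where "Q m S \<longleftrightarrow> 0 < S \<and> (\<forall>(w :: 'a \<Rightarrow> real) Y. finite Y \<longrightarrow> (\<forall>x. 0 \<le> w x) \<longrightarrow>
     0 < sum w Y \<longrightarrow>
     (\<exists>E. finite E \<and> diam_le E S \<and> sum w (outer_boundary (real m + 1) E \<inter> Y) < sum w (E \<inter> Y)))" for m S
  have "\<exists>S. Q m S" for m
    by (rule ULA_mu_finite_weights[OF bg assms, of "real m + 1" 1]) (auto simp: Q_def)
  then obtain S where Q: "Q m (S m)" for m
    by metis
  have S: "0 < S m" for m
    using Q[of m] by (simp add: Q_def)
  \<comment> \<open>The scales \<open>S m\<close> were chosen independently of each other; the
    running maximum makes them monotone.\<close>
  define f where "f m = nat \<lceil>Max (S ` {..m})\<rceil>" for m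
  have f: "S m \<le> real (f m)" for m
  proof -
    have "S m \<le> Max (S ` {..m})"
      by (intro Max_ge) auto
    also have "\<dots> \<le> real (f m)"
      by (simp add: f_def real_nat_ceiling_ge)
    finally show ?thesis .
  qed
  have mono: "mono f"
    unfolding f_def
    by (intro monoI nat_mono ceiling_mono Max_mono) auto
  show ?thesis
    unfolding MSP_def
  \<comment> \<open>One factor 1/2 is lost in passing to a finite set \<open>Y\<close>, the other in
    the greedy selection.\<close>
  proof (intro exI[of _ "1/4"] exI[of _ f] conjI mono allI impI)
    fix m and \<mu> :: "'a measure" assume "finite_measure \<mu> \<and> sets \<mu> = sets borel"
    then have \<mu>: "finite_measure \<mu>" "sets \<mu> = sets borel"
      by auto
    interpret finite_measure \<mu> by fact
    define w where "w x = measure \<mu> {x}" for x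
    obtain Y where Y: "finite Y" "measure \<mu> UNIV / 2 \<le> sum w Y"
    proof (cases "measure \<mu> UNIV = 0")
      case False
      then have "measure \<mu> UNIV / 2 < measure \<mu> UNIV"
        by (simp add: zero_less_measure_iff)
      then show thesis
        using finite_subset_measure[OF bg \<mu>(2,1), of "measure \<mu> UNIV / 2" UNIV] that
        unfolding w_def by (metis less_imp_le measure_nonneg zero_le_divide_iff zero_le_numeral)
    qed (use that[of "{}"] in auto)
    have "\<exists>P. disjoint P \<and> \<Union>P \<subseteq> Y \<and> (\<forall>U\<in>P. diam_le U (S m)) \<and>
       (\<forall>U\<in>P. \<forall>V\<in>P. U \<noteq> V \<longrightarrow> (\<forall>x\<in>U. \<forall>y\<in>V. real m + 1 \<le> dist x y)) \<and> sum w Y \<le> 2 * sum w (\<Union>P)"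
      using Q[of m] Y(1) by (intro sparse_family_of_isoperimetry) (auto simp: Q_def w_def)
    then obtain P where P: "disjoint P" "\<Union>P \<subseteq> Y" "\<forall>U\<in>P. diam_le U (S m)"
       "\<forall>U\<in>P. \<forall>V\<in>P. U \<noteq> V \<longrightarrow> (\<forall>x\<in>U. \<forall>y\<in>V. real m + 1 \<le> dist x y)"
       "sum w Y \<le> 2 * sum w (\<Union>P)"
      by (elim exE conjE)
    show "\<exists>P. \<Union>P \<in> sets borel \<and> disjoint P \<and>
            (\<forall>U\<in>P. \<forall>V\<in>P. U \<noteq> V \<longrightarrow> (\<forall>x\<in>U. \<forall>y\<in>V. real m \<le> dist x y)) \<and>
            (\<forall>U\<in>P. diam_le U (real (f m))) \<and> 1/4 * measure \<mu> UNIV \<le> measure \<mu> (\<Union>P)"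
    proof (intro exI[of _ P] conjI ballI impI)
      show "real m \<le> dist x y" if "U \<in> P" "V \<in> P" "U \<noteq> V" "x \<in> U" "y \<in> V" for U V x y
        using P(4) that by fastforce
      show "diam_le U (real (f m))" if "U \<in> P" for U
        using P(3) that f[of m] by (force simp: diam_le_def)
      have "measure \<mu> (\<Union>P) = sum w (\<Union>P)"
        unfolding w_def using measure_finite_set[OF bg \<mu>(2,1)] finite_subset[OF P(2) Y(1)] by blast
      then show "1/4 * measure \<mu> UNIV \<le> measure \<mu> (\<Union>P)"
        using P(5) Y(2) by simp
    qed (use P(1) sets_borel_UNIV[OF bg] in auto)
  qed auto
qed

end

section \<open>From uniform local amenability to property A\<close>

text \<open>Ville's theorem of the alternative, proved by eliminating the coordinates one at a time.\<close>

lemma cone_alternative: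
  fixes C :: "('a \<Rightarrow> real) set"
  assumes "finite F" "F \<noteq> {}"
    and "\<And>u v. u \<in> C \<Longrightarrow> v \<in> C \<Longrightarrow> (\<lambda>x. u x + v x) \<in> C"
    and "\<And>c u. u \<in> C \<Longrightarrow> 0 < c \<Longrightarrow> (\<lambda>x. c * u x) \<in> C"
    and "\<not> (\<exists>v\<in>C. \<forall>x\<in>F. v x < 0)"
  shows "\<exists>w. (\<forall>x. 0 \<le> w x) \<and> 0 < sum w F \<and> (\<forall>v\<in>C. 0 \<le> (\<Sum>x\<in>F. w x * v x))"
  using assms
proof (induction F arbitrary: C rule: finite_ne_induct)
  case (singleton x)
  then show ?case
    by (intro exI[of _ "\<lambda>_. 1"]) (auto simp: not_less)
next
  case (insert x F)
  \<comment> \<open>No vector of \<open>K\<close> is negative on all of \<open>F\<close>, so the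
    inductive hypothesis gives weights on \<open>F\<close> that are correct for \<open>K\<close>.
    Only the weight \<open>t\<close> of \<open>x\<close> remains to be found. If \<open>K\<close> is
    empty, all weight can be placed at \<open>x\<close>.\<close>
  define K where "K = {v \<in> C. v x < 0}"
  show ?case
  proof (cases "K = {}")
    case True
    have "(\<Sum>y\<in>F. (if y = x then 1 else 0) * v y) = 0" for v :: "'a \<Rightarrow> real"
      using insert.hyps by (intro sum.neutral) auto
    then have "0 \<le> (\<Sum>y\<in>insert x F. (if y = x then 1 else 0) * v y)" if "v \<in> C" for v
      using that True insert.hyps by (auto simp: K_def not_less)
    then show ?thesis
      using insert.hyps by (intro exI[of _ "\<lambda>y. if y = x then 1 else 0"]) auto
  next
    case False
    have "\<not> (\<exists>v\<in>K. \<forall>x\<in>F. v x < 0)"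
      using insert.prems(3) by (auto simp: K_def)
    moreover have "(\<lambda>x. u x + v x) \<in> K" if "u \<in> K" "v \<in> K" for u v
      using insert.prems(1) that by (auto simp: K_def)
    moreover have "(\<lambda>x. c * u x) \<in> K" if "u \<in> K" "0 < c" for c u
      using insert.prems(2) that by (auto simp: K_def mult_pos_neg)
    ultimately obtain w where w: "\<And>y. 0 \<le> w y" "0 < sum w F" "\<And>v. v \<in> K \<Longrightarrow> 0 \<le> (\<Sum>x\<in>F. w x * v x)"
      using insert.IH[of K] by blast
    define p where "p v = (\<Sum>x\<in>F. w x * v x)" for v
    \<comment> \<open>Vectors negative at \<open>x\<close> require
      \<open>t \<le> p v / (- v x)\<close>, vectors positive at \<open>x\<close> require
      \<open>t \<ge> - p v / v x\<close>. By \<open>key\<close> every such lower bound lies below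
      every upper bound, so the infimum of the upper bounds satisfies both.\<close>
    define t where "t = (INF v\<in>K. p v / (- v x))"
    have nonneg: "0 \<le> p v / (- v x)" if "v \<in> K" for v
      using w(3)[OF that] that by (auto simp: p_def K_def intro!: divide_nonneg_neg)
    have bdd: "bdd_below ((\<lambda>v. p v / (- v x)) ` K)"
      using nonneg by (intro bdd_belowI[of _ 0]) auto
    have "0 \<le> t"
      unfolding t_def using False nonneg by (intro cINF_greatest)
    have key: "0 \<le> p v + (v x / (- k x)) * p k" if "v \<in> C" "0 \<le> v x" "k \<in> K" for v k
    proof (rule field_le_epsilon)
      fix e :: real assume "0 < e"
      have k: "k \<in> C" "k x < 0" "0 \<le> p k"
        using that(3) w(3) by (auto simp: K_def p_def)
      define d where "d = e / (p k + 1)"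
      have d: "0 < d" "d * p k \<le> e"
        using k \<open>0 < e\<close> by (auto simp: d_def field_simps)
      \<comment> \<open>The first summand alone would cancel the coordinate at \<open>x\<close>; the
        extra \<open>d\<close> makes it negative, so the combination falls into \<open>K\<close>, at
        a cost of at most \<open>e\<close>.\<close>
      define s where "s = v x / (- k x) + d"
      have "0 < s"
        unfolding s_def using d k that(2) by (intro add_nonneg_pos divide_nonneg_pos) auto
      have "v x + s * k x = d * k x"
        using k by (simp add: s_def field_simps)
      then have "(\<lambda>y. v y + s * k y) \<in> K"
        using insert.prems(1)[OF that(1) insert.prems(2)[OF k(1) \<open>0 < s\<close>]] d k
        by (simp add: K_def mult_pos_neg)
      then have "0 \<le> p (\<lambda>y. v y + s * k y)"
        using w(3) by (simp add: p_def)
      also have "\<dots> = p v + s * p k"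
        by (simp add: p_def algebra_simps sum.distrib sum_distrib_left)
      also have "\<dots> = p v + (v x / (- k x)) * p k + d * p k"
        by (simp add: s_def algebra_simps)
      finally show "0 \<le> p v + (v x / (- k x)) * p k + e"
        using d by simp
    qed
    have "0 \<le> p v + t * v x" if v: "v \<in> C" for v
    proof (cases "v x" "0 :: real" rule: linorder_cases)
      case less
      then have "t \<le> p v / (- v x)"
        unfolding t_def using v bdd by (intro cINF_lower) (auto simp: K_def)
      then show ?thesis
        using less by (simp add: field_simps)
    next
      case equal
      then show ?thesis
        using key[OF v] False by auto
    next
      case greater
      have "- p v / v x \<le> t"
        unfolding t_def
      proof (rule cINF_greatest[OF False])
        fix k assume k: "k \<in> K"
        then show "- p v / v x \<le> p k / - k x"
          using key[OF v _ k] greater by (auto simp: K_def field_simps)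
      qed
      then show ?thesis
        using greater by (simp add: field_simps)
    qed
    moreover have "(\<Sum>y\<in>insert x F. (w(x := t)) y * v y) = p v + t * v x" for v
    proof -
      have "(\<Sum>y\<in>F. (w(x := t)) y * v y) = p v"
        unfolding p_def using insert.hyps by (intro sum.cong) auto
      then show ?thesis
        using insert.hyps by simp
    qed
    moreover have "0 < sum (w(x := t)) (insert x F)"
    proof -
      have "sum (w(x := t)) F = sum w F"
        using insert.hyps by (intro sum.cong) auto
      then show ?thesis
        using insert.hyps w(2) \<open>0 \<le> t\<close> by simp
    qed
    ultimately show ?thesis
      using w(1) \<open>0 \<le> t\<close> by (intro exI[of _ "w(x := t)"]) auto
  qed
qed

section \<open>Duality and an almost invariant kernel on finite sets\<close>

context
  assumes bg: "bounded_geometry TYPE('a::metric_space)"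
begin

text \<open>Duality exchanges quantifiers: uniform local amenability supplies for each weight on
  \<open>F\<close> one set with small boundary on average, whereas here one weighted family of sets
  has small boundary at every point of \<open>F\<close>.\<close>

lemma ULA_mu_weighted_family:
  fixes R \<epsilon> :: real
  assumes "ULA_mu TYPE('a)" "0 < R" "0 < \<epsilon>"
  obtains S where "0 < S" "\<And>F :: 'a set. finite F \<Longrightarrow> \<exists>T l. finite T \<and> (\<forall>E\<in>T. finite E \<and> diam_le E S \<and> 0 \<le> l E) \<and>
     (\<forall>x\<in>F. (\<Sum>E\<in>T. l E * of_bool (x \<in> outer_boundary R E)) < \<epsilon> * (\<Sum>E\<in>T. l E * of_bool (x \<in> E)))"
proof (rule ULA_mu_finite_weights[OF bg assms])
  fix S :: real
  assume S: "0 < S" and ULA: "\<And>(w :: 'a \<Rightarrow> real) Y. finite Y \<Longrightarrow> (\<And>x. x \<in> Y \<Longrightarrow> 0 \<le> w x) \<Longrightarrow> 0 < sum w Y \<Longrightarrow>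
     \<exists>E. finite E \<and> diam_le E S \<and> sum w (outer_boundary R E \<inter> Y) < \<epsilon> * sum w (E \<inter> Y)"
  define ok :: "'a set set \<Rightarrow> ('a set \<Rightarrow> real) \<Rightarrow> bool"
    where "ok T l \<longleftrightarrow> finite T \<and> (\<forall>E\<in>T. finite E \<and> diam_le E S \<and> 0 \<le> l E)" for T l
  define vec :: "'a set set \<Rightarrow> ('a set \<Rightarrow> real) \<Rightarrow> 'a \<Rightarrow> real"
    where "vec T l = (\<lambda>x. \<Sum>E\<in>T. l E * (of_bool (x \<in> outer_boundary R E) - \<epsilon> * of_bool (x \<in> E)))" for T l
  show thesis
  proof (rule that[OF S])
    fix F :: "'a set" assume F: "finite F"
    show "\<exists>T l. finite T \<and> (\<forall>E\<in>T. finite E \<and> diam_le E S \<and> 0 \<le> l E) \<and>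
     (\<forall>x\<in>F. (\<Sum>E\<in>T. l E * of_bool (x \<in> outer_boundary R E)) < \<epsilon> * (\<Sum>E\<in>T. l E * of_bool (x \<in> E)))"
    proof (cases "F = {}")
      case False
      define C where "C = {vec T l | T l. ok T l}"
      have "\<exists>v\<in>C. \<forall>x\<in>F. v x < 0"
      proof (rule ccontr)
        assume "\<not> (\<exists>v\<in>C. \<forall>x\<in>F. v x < 0)"
        moreover have "(\<lambda>x. u x + v x) \<in> C" if "u \<in> C" "v \<in> C" for u v
        proof -
          obtain T l T' l' where *: "u = vec T l" "v = vec T' l'" "ok T l" "ok T' l'"
            using \<open>u \<in> C\<close> \<open>v \<in> C\<close> unfolding C_def by blast
          \<comment> \<open>A set that occurs in both families receives the sum of its two
            coefficients.\<close>
          define k where "k E = (if E \<in> T then l E else 0) + (if E \<in> T' then l' E else 0)" for E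
          have "vec T l x = (\<Sum>E\<in>T\<union>T'. (if E \<in> T then l E else 0) * (of_bool (x \<in> outer_boundary R E) - \<epsilon> * of_bool (x \<in> E)))"
            "vec T' l' x = (\<Sum>E\<in>T\<union>T'. (if E \<in> T' then l' E else 0) * (of_bool (x \<in> outer_boundary R E) - \<epsilon> * of_bool (x \<in> E)))" for x
            using *(3,4) unfolding vec_def ok_def by (auto intro!: sum.mono_neutral_cong_left)
          then have "(\<lambda>x. u x + v x) = vec (T \<union> T') k"
            unfolding *(1,2) by (auto simp: vec_def k_def sum.distrib[symmetric] ring_distribs(2))
          moreover have "ok (T \<union> T') k"
            using *(3,4) by (auto simp: ok_def k_def)
          ultimately show ?thesis
            unfolding C_def by blast
        qed
        moreover have "(\<lambda>x. c * u x) \<in> C" if "u \<in> C" "0 < c" for c u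
        proof -
          obtain T l where *: "u = vec T l" "ok T l"
            using \<open>u \<in> C\<close> unfolding C_def by blast
          have "(\<lambda>x. c * u x) = vec T (\<lambda>E. c * l E)"
            unfolding *(1) by (simp add: vec_def sum_distrib_left mult.assoc)
          moreover have "ok T (\<lambda>E. c * l E)"
            using *(2) \<open>0 < c\<close> by (auto simp: ok_def)
          ultimately show ?thesis
            unfolding C_def by blast
        qed
        ultimately obtain w where w: "\<And>x. 0 \<le> w x" "0 < sum w F" "\<And>v. v \<in> C \<Longrightarrow> 0 \<le> (\<Sum>x\<in>F. w x * v x)"
          using cone_alternative[OF F False, of C] by blast
        obtain E where E: "finite E" "diam_le E S" "sum w (outer_boundary R E \<inter> F) < \<epsilon> * sum w (E \<inter> F)"
          using ULA[of F w] F w by blast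
        have w_sum: "(\<Sum>x\<in>F. w x * of_bool (x \<in> A)) = sum w (A \<inter> F)" for A
          using F by (intro sum.mono_neutral_cong_right) auto
        \<comment> \<open>The single set supplied for the weight \<open>w\<close> is itself a member
          of the cone, and its pairing with \<open>w\<close> is negative.\<close>
        have "vec {E} (\<lambda>_. 1) \<in> C"
          unfolding C_def using E by (intro CollectI exI[of _ "{E}"] exI[of _ "\<lambda>_. 1"]) (simp add: ok_def)
        then have "0 \<le> (\<Sum>x\<in>F. w x * vec {E} (\<lambda>_. 1) x)"
          by (rule w(3))
        also have "\<dots> = (\<Sum>x\<in>F. w x * of_bool (x \<in> outer_boundary R E)) - \<epsilon> * (\<Sum>x\<in>F. w x * of_bool (x \<in> E))"
        proof -
          have eq: "vec {E} (\<lambda>_. 1) x = of_bool (x \<in> outer_boundary R E) - \<epsilon> * of_bool (x \<in> E)" for x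
            by (simp add: vec_def)
          show ?thesis
            unfolding eq by (simp add: algebra_simps sum_subtractf sum_distrib_left)
        qed
        finally show False
          using E(3) by (simp add: w_sum)
      qed
      then obtain T l where T: "ok T l" "\<And>x. x \<in> F \<Longrightarrow> vec T l x < 0"
        unfolding C_def by blast
      have "vec T l x = (\<Sum>E\<in>T. l E * of_bool (x \<in> outer_boundary R E)) - \<epsilon> * (\<Sum>E\<in>T. l E * of_bool (x \<in> E))" for x
        by (simp add: vec_def algebra_simps sum_subtractf sum_distrib_left)
      then show ?thesis
        using T unfolding ok_def by (intro exI[of _ T] exI[of _ l]) auto
    qed (intro exI[of _ "{}"], simp)
  qed
qed

end

context
  assumes bg: "bounded_geometry TYPE('a::metric_space)"
begin

text \<open>Each set \<open>E\<close> of the weighted family sends its weight to a chosen point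
  \<open>c E\<close> of \<open>E\<close>; \<open>g x\<close> is the normalized distribution of the
  weight of the sets that contain \<open>x\<close>. Two points within distance \<open>R\<close> are
  separated only by sets having one of them on the outer boundary, and these carry little
  weight.\<close>

lemma kernel_on_finite_set:
  fixes R \<epsilon> :: real
  assumes ULA: "ULA_mu TYPE('a)" and R: "0 < R" and e: "0 < \<epsilon>"
  obtains S where "0 < S" "\<And>F :: 'a set. finite F \<Longrightarrow> \<exists>g. (\<forall>x p. 0 \<le> g x p) \<and> (\<forall>x p. S < dist x p \<longrightarrow> g x p = 0) \<and>
     (\<forall>x. (\<Sum>p\<in>cball x S. g x p) = 1) \<and>
     (\<forall>x\<in>F. \<forall>y\<in>F. dist x y \<le> R \<longrightarrow> (\<Sum>p\<in>cball x S \<union> cball y S. \<bar>g x p - g y p\<bar>) \<le> \<epsilon>)"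
proof -
  \<comment> \<open>The bound 1/3 makes the normalizations \<open>s x\<close> and \<open>s y\<close>
    comparable up to a factor 2; then \<open>D \<le> 3 * \<delta> * s x\<close>, and normalizing
    doubles the error, which gives \<open>6 * \<delta>\<close>.\<close>
  define \<delta> where "\<delta> = min (1/3) (\<epsilon> / 6)"
  have \<delta>: "0 < \<delta>" "\<delta> \<le> 1/3" "6 * \<delta> \<le> \<epsilon>"
    using e by (auto simp: \<delta>_def)
  show thesis
  proof (rule ULA_mu_weighted_family[OF bg ULA R \<delta>(1)])
    fix S :: real
    assume S: "0 < S" and ex: "\<And>F :: 'a set. finite F \<Longrightarrow> \<exists>T l. finite T \<and> (\<forall>E\<in>T. finite E \<and> diam_le E S \<and> 0 \<le> l E) \<and>
       (\<forall>x\<in>F. (\<Sum>E\<in>T. l E * of_bool (x \<in> outer_boundary R E)) < \<delta> * (\<Sum>E\<in>T. l E * of_bool (x \<in> E)))"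
    show thesis
    proof (rule that[OF S])
      fix F :: "'a set" assume F: "finite F"
      obtain T l where T0: "finite T" "\<forall>E\<in>T. finite E \<and> diam_le E S \<and> 0 \<le> l E"
        "\<forall>x\<in>F. (\<Sum>E\<in>T. l E * of_bool (x \<in> outer_boundary R E)) < \<delta> * (\<Sum>E\<in>T. l E * of_bool (x \<in> E))"
        using ex[OF F] by (elim exE conjE)
      then have T: "finite T" "\<And>E. E \<in> T \<Longrightarrow> finite E" "\<And>E. E \<in> T \<Longrightarrow> diam_le E S" "\<And>E. E \<in> T \<Longrightarrow> 0 \<le> l E"
        by auto
      define s where "s x = (\<Sum>E\<in>T. l E * of_bool (x \<in> E))" for x
      define b where "b x = (\<Sum>E\<in>T. l E * of_bool (x \<in> outer_boundary R E))" for x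
      define c :: "'a set \<Rightarrow> 'a" where "c E = (SOME x. x \<in> E)" for E
      define G where "G x p = (\<Sum>E\<in>T. l E * of_bool (x \<in> E) * of_bool (c E = p))" for x p
      \<comment> \<open>Outside \<open>F\<close> nothing is known about the family; a point mass has
        the required support and total mass.\<close>
      define g where "g x p = (if x \<in> F then G x p / s x else of_bool (x = p))" for x p
      have b0: "0 \<le> b x" for x
        unfolding b_def using T by (intro sum_nonneg) auto
      have bs: "b x < \<delta> * s x" and s0: "0 < s x" if "x \<in> F" for x
      proof -
        show *: "b x < \<delta> * s x"
          using T0(3) that by (simp add: b_def s_def)
        show "0 < s x"
          using le_less_trans[OF b0[of x] *] \<delta>(1) by (simp add: zero_less_mult_iff)
      qed
      have G0: "0 \<le> G x p" for x p
        unfolding G_def using T by (intro sum_nonneg) auto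
      have c_dist: "dist x (c E) \<le> S" if "x \<in> E" "E \<in> T" for x E
        using that T diam_le_D[of E S x "c E"] someI[of "\<lambda>x. x \<in> E"] unfolding c_def by auto
      have G_far: "G x p = 0" if "S < dist x p" for x p
        unfolding G_def using that c_dist[of x] by (intro sum.neutral) (force simp: of_bool_def)
      have G_sum_le: "(\<Sum>p\<in>P. G x p) \<le> s x" if "finite P" for x P
      proof -
        have "(\<Sum>p\<in>P. G x p) = (\<Sum>E\<in>T. l E * of_bool (x \<in> E) * (\<Sum>p\<in>P. of_bool (c E = p)))"
          unfolding G_def by (subst sum.swap) (simp add: sum_distrib_left)
        also have "\<dots> \<le> (\<Sum>E\<in>T. l E * of_bool (x \<in> E))"
          using T(4) that by (intro sum_mono mult_left_le) (auto simp: of_bool_def)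
        finally show ?thesis
          by (simp add: s_def)
      qed
      have G_sum: "(\<Sum>p\<in>cball x S. G x p) = s x" for x
      proof -
        have "(\<Sum>p\<in>cball x S. G x p) = (\<Sum>E\<in>T. l E * of_bool (x \<in> E) * (\<Sum>p\<in>cball x S. of_bool (c E = p)))"
          unfolding G_def by (subst sum.swap) (simp add: sum_distrib_left)
        also have "\<dots> = (\<Sum>E\<in>T. l E * of_bool (x \<in> E))"
          using c_dist[of x] finite_cball[OF bg] by (intro sum.cong) (auto simp: of_bool_def)
        finally show ?thesis
          by (simp add: s_def)
      qed
      have main: "(\<Sum>p\<in>P. \<bar>G x p / s x - G y p / s y\<bar>) \<le> \<epsilon>"
        if P: "finite P" and xy: "x \<in> F" "y \<in> F" "dist x y \<le> R" for x y P
      proof -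
        define D where "D = (\<Sum>E\<in>T. l E * \<bar>of_bool (x \<in> E) - of_bool (y \<in> E)\<bar>)"
        have "D \<le> b x + b y"
          unfolding D_def b_def sum.distrib[symmetric]
        proof (rule sum_mono)
          fix E assume E: "E \<in> T"
          then have "\<bar>of_bool (x \<in> E) - of_bool (y \<in> E)\<bar> \<le>
              of_bool (x \<in> outer_boundary R E) + (of_bool (y \<in> outer_boundary R E) :: real)"
            using T(2)[OF E] xy(3) by (auto simp: of_bool_def outer_boundary_finite dist_commute)
          then show "l E * \<bar>of_bool (x \<in> E) - of_bool (y \<in> E)\<bar> \<le>
              l E * of_bool (x \<in> outer_boundary R E) + l E * of_bool (y \<in> outer_boundary R E)"
            unfolding distrib_left[symmetric] using T(4)[OF E] by (intro mult_left_mono)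
        qed
        then have D: "D \<le> \<delta> * (s x + s y)"
          using bs[OF xy(1)] bs[OF xy(2)] by (simp add: distrib_left)
        have "s y - s x \<le> D" and sd: "\<bar>s y - s x\<bar> \<le> D"
        proof -
          have "s y - s x = (\<Sum>E\<in>T. l E * (of_bool (y \<in> E) - of_bool (x \<in> E)))"
            by (simp add: s_def sum_subtractf right_diff_distrib)
          also have "\<bar>\<dots>\<bar> \<le> (\<Sum>E\<in>T. \<bar>l E * (of_bool (y \<in> E) - of_bool (x \<in> E))\<bar>)"
            by (rule sum_abs)
          also have "\<dots> = D"
            unfolding D_def using T(4) by (intro sum.cong) (auto simp: abs_mult abs_minus_commute)
          finally show "\<bar>s y - s x\<bar> \<le> D" .
          then show "s y - s x \<le> D"
            by simp
        qed
        then have "s y - s x \<le> (s x + s y) / 3"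
          using D mult_right_mono[OF \<delta>(2), of "s x + s y"] s0[OF xy(1)] s0[OF xy(2)] by linarith
        then have sy: "s y \<le> 2 * s x"
          by simp
        have "(\<Sum>p\<in>P. \<bar>G x p - G y p\<bar>) \<le> (\<Sum>p\<in>P. \<Sum>E\<in>T. l E * \<bar>of_bool (x \<in> E) - of_bool (y \<in> E)\<bar> * of_bool (c E = p))"
        proof (rule sum_mono)
          fix p
          have "G x p - G y p = (\<Sum>E\<in>T. l E * (of_bool (x \<in> E) - of_bool (y \<in> E)) * of_bool (c E = p))"
            by (simp add: G_def sum_subtractf algebra_simps)
          also have "\<bar>\<dots>\<bar> \<le> (\<Sum>E\<in>T. \<bar>l E * (of_bool (x \<in> E) - of_bool (y \<in> E)) * of_bool (c E = p)\<bar>)"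
            by (rule sum_abs)
          also have "\<dots> = (\<Sum>E\<in>T. l E * \<bar>of_bool (x \<in> E) - of_bool (y \<in> E)\<bar> * of_bool (c E = p))"
            using T(4) by (intro sum.cong) (auto simp: abs_mult)
          finally show "\<bar>G x p - G y p\<bar> \<le> (\<Sum>E\<in>T. l E * \<bar>of_bool (x \<in> E) - of_bool (y \<in> E)\<bar> * of_bool (c E = p))" .
        qed
        also have "\<dots> = (\<Sum>E\<in>T. l E * \<bar>of_bool (x \<in> E) - of_bool (y \<in> E)\<bar> * (\<Sum>p\<in>P. of_bool (c E = p)))"
          by (subst sum.swap) (simp add: sum_distrib_left)
        also have "\<dots> \<le> D"
          unfolding D_def using T(4) P by (intro sum_mono mult_left_le) (auto simp: of_bool_def)
        finally have GD: "(\<Sum>p\<in>P. \<bar>G x p - G y p\<bar>) \<le> D" .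
        have "(\<Sum>p\<in>P. \<bar>G x p / s x - G y p / s y\<bar>) \<le>
            (\<Sum>p\<in>P. \<bar>G x p - G y p\<bar> / s x + G y p * (\<bar>s y - s x\<bar> / (s x * s y)))"
        proof (rule sum_mono)
          fix p
          \<comment> \<open>The numerator is changed before the denominator; summed over
            \<open>p\<close>, either change costs at most \<open>D / s x\<close>.\<close>
          have "G x p / s x - G y p / s y = (G x p - G y p) / s x + G y p * ((s y - s x) / (s x * s y))"
            using s0[OF xy(1)] s0[OF xy(2)] by (simp add: field_simps)
          also have "\<bar>\<dots>\<bar> \<le> \<bar>(G x p - G y p) / s x\<bar> + \<bar>G y p * ((s y - s x) / (s x * s y))\<bar>"
            by (rule abs_triangle_ineq)
          also have "\<dots> = \<bar>G x p - G y p\<bar> / s x + G y p * (\<bar>s y - s x\<bar> / (s x * s y))"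
            using s0[OF xy(1)] s0[OF xy(2)] G0[of y p] by (simp add: abs_mult)
          finally show "\<bar>G x p / s x - G y p / s y\<bar> \<le> \<bar>G x p - G y p\<bar> / s x + G y p * (\<bar>s y - s x\<bar> / (s x * s y))" .
        qed
        also have "\<dots> = (\<Sum>p\<in>P. \<bar>G x p - G y p\<bar>) / s x + (\<Sum>p\<in>P. G y p) * (\<bar>s y - s x\<bar> / (s x * s y))"
          by (simp add: sum.distrib sum_divide_distrib sum_distrib_right)
        also have "\<dots> \<le> D / s x + s y * (D / (s x * s y))"
          using GD G_sum_le[OF P, of y] sd s0[OF xy(1)] s0[OF xy(2)]
          by (intro add_mono mult_mono divide_right_mono) auto
        also have "\<dots> = 2 * D / s x"
          using s0[OF xy(1)] s0[OF xy(2)] by (simp add: field_simps)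
        also have "\<dots> \<le> 6 * \<delta>"
        proof -
          have "D \<le> \<delta> * (3 * s x)"
            using sy \<delta>(1) by (intro order_trans[OF D mult_left_mono]) auto
          then show ?thesis
            using s0[OF xy(1)] by (simp add: field_simps)
        qed
        finally show ?thesis
          using \<delta>(3) by simp
      qed
      show "\<exists>g. (\<forall>x p. 0 \<le> g x p) \<and> (\<forall>x p. S < dist x p \<longrightarrow> g x p = 0) \<and>
         (\<forall>x. (\<Sum>p\<in>cball x S. g x p) = 1) \<and>
         (\<forall>x\<in>F. \<forall>y\<in>F. dist x y \<le> R \<longrightarrow> (\<Sum>p\<in>cball x S \<union> cball y S. \<bar>g x p - g y p\<bar>) \<le> \<epsilon>)"
      proof (intro exI[of _ g] conjI allI impI ballI)
        show "0 \<le> g x p" for x p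
          using G0[of x p] s0[of x] by (auto simp: g_def)
        show "g x p = 0" if "S < dist x p" for x p
          using G_far[OF that] that S by (auto simp: g_def)
        show "(\<Sum>p\<in>cball x S. g x p) = 1" for x
        proof (cases "x \<in> F")
          case True
          then show ?thesis
            using G_sum[of x] s0[of x] by (simp add: g_def sum_divide_distrib[symmetric])
        next
          case False
          then show ?thesis
            using S finite_cball[OF bg, of x S] by (simp add: g_def of_bool_def)
        qed
        show "(\<Sum>p\<in>cball x S \<union> cball y S. \<bar>g x p - g y p\<bar>) \<le> \<epsilon>" if "x \<in> F" "y \<in> F" "dist x y \<le> R" for x y
          using main[OF _ that, of "cball x S \<union> cball y S"] that finite_cball[OF bg] by (simp add: g_def)
      qed
    qed
  qed
qed

end

section \<open>Compactness and rounding to finite sets\<close>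

context
  assumes bg: "bounded_geometry TYPE('a::metric_space)"
begin

text \<open>Kernels are points of a power of the unit interval, compact by Tychonoff. The
  requirements attached to a pair of points are closed, and finitely many of them hold together by
  the construction on finite sets, whose \<open>S\<close> is the same for all of them.\<close>

lemma kernel_everywhere:
  fixes R \<epsilon> :: real
  assumes ULA: "ULA_mu TYPE('a)" and R: "0 < R" and e: "0 < \<epsilon>"
  obtains S and g :: "'a \<Rightarrow> 'a \<Rightarrow> real" where "0 < S" "\<And>x p. 0 \<le> g x p" "\<And>x p. S < dist x p \<Longrightarrow> g x p = 0"
    "\<And>x. (\<Sum>p\<in>cball x S. g x p) = 1"
    "\<And>x y. dist x y \<le> R \<Longrightarrow> (\<Sum>p\<in>cball x S \<union> cball y S. \<bar>g x p - g y p\<bar>) \<le> \<epsilon>"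
proof (rule kernel_on_finite_set[OF bg ULA R e])
  fix S :: real
  assume S: "0 < S" and ex: "\<And>F :: 'a set. finite F \<Longrightarrow> \<exists>g. (\<forall>x p. 0 \<le> g x p) \<and> (\<forall>x p. S < dist x p \<longrightarrow> g x p = 0) \<and>
     (\<forall>x. (\<Sum>p\<in>cball x S. g x p) = 1) \<and>
     (\<forall>x\<in>F. \<forall>y\<in>F. dist x y \<le> R \<longrightarrow> (\<Sum>p\<in>cball x S \<union> cball y S. \<bar>g x p - g y p\<bar>) \<le> \<epsilon>)"
  define K where "K = (UNIV :: ('a \<times> 'a) set) \<rightarrow>\<^sub>E {0..1::real}"
  have "compactin (product_topology (\<lambda>_. euclidean) UNIV) K"
    by (auto simp: K_def compactin_PiE)
  then have "compact K"
    by (simp add: euclidean_product_topology)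
  define good where "good z = {g. (\<forall>p. S < dist (fst z) p \<longrightarrow> g (fst z, p) = 0) \<and> (\<Sum>p\<in>cball (fst z) S. g (fst z, p)) = 1 \<and>
     (dist (fst z) (snd z) \<le> R \<longrightarrow> (\<Sum>p\<in>cball (fst z) S \<union> cball (snd z) S. \<bar>g (fst z, p) - g (snd z, p)\<bar>) \<le> \<epsilon>)}"
     for z :: "'a \<times> 'a"
  have "K \<inter> (\<Inter>z\<in>UNIV. good z) \<noteq> {}"
  proof (rule compact_imp_fip_image[OF \<open>compact K\<close>])
    show "closed (good z)" for z
      unfolding good_def
      by (intro closed_Collect_conj closed_Collect_all closed_Collect_imp closed_Collect_eq closed_Collect_le
            continuous_intros open_Collect_const) auto
    fix I :: "('a \<times> 'a) set" assume I: "finite I"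
    define F where "F = fst ` I \<union> snd ` I"
    have "finite F"
      using I by (simp add: F_def)
    obtain g where "\<forall>x p. 0 \<le> g x p" "\<forall>x p. S < dist x p \<longrightarrow> g x p = 0" "\<forall>x. (\<Sum>p\<in>cball x S. g x p) = 1"
      "\<forall>x\<in>F. \<forall>y\<in>F. dist x y \<le> R \<longrightarrow> (\<Sum>p\<in>cball x S \<union> cball y S. \<bar>g x p - g y p\<bar>) \<le> \<epsilon>"
      using ex[OF \<open>finite F\<close>] by (elim exE conjE)
    then have g: "\<And>x p. 0 \<le> g x p" "\<And>x p. S < dist x p \<Longrightarrow> g x p = 0" "\<And>x. (\<Sum>p\<in>cball x S. g x p) = 1"
      "\<And>x y. x \<in> F \<Longrightarrow> y \<in> F \<Longrightarrow> dist x y \<le> R \<Longrightarrow> (\<Sum>p\<in>cball x S \<union> cball y S. \<bar>g x p - g y p\<bar>) \<le> \<epsilon>"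
      by blast+
    have "g x p \<le> 1" for x p
    proof (cases "p \<in> cball x S")
      case True
      then have "g x p \<le> (\<Sum>p\<in>cball x S. g x p)"
        using g(1) finite_cball[OF bg] by (intro member_le_sum) auto
      then show ?thesis
        by (simp add: g)
    next
      case False
      then show ?thesis
        using g(2)[of x p] by (simp add: not_le)
    qed
    then have "(\<lambda>z. g (fst z) (snd z)) \<in> K"
      using g(1) by (auto simp: K_def)
    moreover have "(\<lambda>z. g (fst z) (snd z)) \<in> good z" if "z \<in> I" for z
      using g that by (auto simp: good_def F_def)
    ultimately show "K \<inter> (\<Inter>z\<in>I. good z) \<noteq> {}"
      by blast
  qed
  then obtain g where g: "g \<in> K" "\<And>z. g \<in> good z"
    by blast
  show thesis
  proof (rule that[OF S, of "\<lambda>x p. g (x, p)"])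
    show "0 \<le> g (x, p)" for x p
      using g(1) by (auto simp: K_def PiE_iff)
    fix x y
    show "g (x, y) = 0" if "S < dist x y"
      using g(2)[of "(x, y)"] that by (auto simp: good_def)
    show "(\<Sum>p\<in>cball x S. g (x, p)) = 1"
      using g(2)[of "(x, x)"] by (auto simp: good_def)
    show "(\<Sum>p\<in>cball x S \<union> cball y S. \<bar>g (x, p) - g (y, p)\<bar>) \<le> \<epsilon>" if "dist x y \<le> R"
      using g(2)[of "(x, y)"] that by (auto simp: good_def)
  qed
qed

text \<open>Over each \<open>p\<close> the set \<open>A x\<close> has a column of height
  \<open>N * g x p\<close> rounded down. Nested columns make the symmetric difference count the
  differences of the heights, that is, the variation of \<open>g\<close> times \<open>N\<close> up
  to one unit for each point of the base.\<close>

lemma ULA_mu_imp_property_A: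
  assumes "ULA_mu TYPE('a)"
  shows "property_A TYPE('a)"
  unfolding property_A_def
proof (intro allI impI)
  fix R \<epsilon> :: real assume R: "0 < R" and e: "0 < \<epsilon>"
  define \<delta> where "\<delta> = min (1/4) (\<epsilon> / 8)"
  have \<delta>: "0 < \<delta>" "\<delta> \<le> 1/4" "\<delta> \<le> \<epsilon> / 8"
    using e by (auto simp: \<delta>_def)
  obtain S and g :: "'a \<Rightarrow> 'a \<Rightarrow> real" where S: "0 < S" and g: "\<And>x p. 0 \<le> g x p" "\<And>x p. S < dist x p \<Longrightarrow> g x p = 0"
    "\<And>x. (\<Sum>p\<in>cball x S. g x p) = 1"
    "\<And>x y. dist x y \<le> R \<Longrightarrow> (\<Sum>p\<in>cball x S \<union> cball y S. \<bar>g x p - g y p\<bar>) \<le> \<delta>"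
    using kernel_everywhere[OF assms R \<delta>(1)] by blast
  obtain K :: nat where K: "\<And>x::'a. card (cball x S) \<le> K"
    using bg S unfolding bounded_geometry_def by metis
  \<comment> \<open>Large enough for the rounding errors, at most \<open>2 * K\<close> in the
    symmetric difference and \<open>3 * K\<close> in the intersection, to be absorbed by the gap
    between \<open>\<epsilon> * N / 8\<close> and \<open>3 * \<epsilon> * N / 4\<close>.\<close>
  obtain N :: nat where N: "4 * real K / \<epsilon> + 6 * real K + 1 \<le> real N"
    using real_arch_simple by blast
  define k where "k x p = nat \<lfloor>real N * g x p\<rfloor>" for x p
  have k: "real (k x p) \<le> real N * g x p" "real N * g x p - 1 \<le> real (k x p)" for x p
    using g(1)[of x p] by (auto simp: k_def)
  have k_far: "k x p = 0" if "S < dist x p" for x p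
    using g(2)[OF that] by (simp add: k_def)
  define A where "A x = Sigma (cball x S) (\<lambda>p. {..<k x p})" for x
  \<comment> \<open>Columns outside the ball are empty, so two of the sets can be compared over a
    common base \<open>U\<close>.\<close>
  have A_eq: "A x = Sigma U (\<lambda>p. {..<k x p})" if "cball x S \<subseteq> U" for x U
  proof -
    have "dist x p \<le> S" if "n < k x p" for n p
      using that k_far[of x p] by (metis not_le not_less0)
    then show ?thesis
      unfolding A_def using that by auto
  qed
  show "\<exists>S>0. \<exists>A :: 'a \<Rightarrow> ('a \<times> nat) set. (\<forall>x. finite (A x)) \<and>
        (\<forall>y z. dist y z \<le> R \<longrightarrow> real (card (sym_diff (A y) (A z))) < \<epsilon> * real (card (A y \<inter> A z))) \<and>
        (\<forall>x. A x \<subseteq> cball x S \<times> UNIV)"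
  proof (intro exI[of _ S] exI[of _ A] conjI allI impI S)
    show fin: "finite (A x)" for x
      using finite_cball[OF bg] by (auto simp: A_def)
    show "A x \<subseteq> cball x S \<times> UNIV" for x
      by (auto simp: A_def)
    fix x y :: 'a assume xy: "dist x y \<le> R"
    define U where "U = cball x S \<union> cball y S"
    have U: "finite U" "cball x S \<subseteq> U" "cball y S \<subseteq> U"
      using finite_cball[OF bg] by (auto simp: U_def)
    have "card U \<le> 2 * K"
      using card_Un_le[of "cball x S" "cball y S"] K[of x] K[of y] by (simp add: U_def)
    have Ax: "A x = Sigma U (\<lambda>p. {..<k x p})" and Ay: "A y = Sigma U (\<lambda>p. {..<k y p})"
      using A_eq U by auto
    have "A x - A y = Sigma U (\<lambda>p. {k y p..<k x p})" "A y - A x = Sigma U (\<lambda>p. {k x p..<k y p})"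
      unfolding Ax Ay by auto
    then have "card (A x - A y) = (\<Sum>p\<in>U. k x p - k y p)" "card (A y - A x) = (\<Sum>p\<in>U. k y p - k x p)"
      using U(1) by (simp_all add: card_SigmaI)
    then have "card (sym_diff (A x) (A y)) = (\<Sum>p\<in>U. (k x p - k y p) + (k y p - k x p))"
      using fin by (subst card_Un_disjoint) (auto simp: sum.distrib)
    then have "real (card (sym_diff (A x) (A y))) = (\<Sum>p\<in>U. real ((k x p - k y p) + (k y p - k x p)))"
      by simp
    also have "\<dots> \<le> (\<Sum>p\<in>U. real N * \<bar>g x p - g y p\<bar> + 1)"
    proof (rule sum_mono)
      fix p
      have "real ((k x p - k y p) + (k y p - k x p)) = \<bar>real (k x p) - real (k y p)\<bar>"
        by (cases "k x p \<le> k y p") (auto simp: of_nat_diff)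
      also have "\<dots> \<le> \<bar>real N * g x p - real N * g y p\<bar> + 1"
        using k[of x p] k[of y p] by linarith
      also have "\<dots> = real N * \<bar>g x p - g y p\<bar> + 1"
        by (simp add: abs_mult right_diff_distrib[symmetric])
      finally show "real ((k x p - k y p) + (k y p - k x p)) \<le> real N * \<bar>g x p - g y p\<bar> + 1" .
    qed
    also have "\<dots> = real N * (\<Sum>p\<in>U. \<bar>g x p - g y p\<bar>) + real (card U)"
      by (simp add: sum.distrib sum_distrib_left)
    also have "\<dots> \<le> real N * \<delta> + 2 * real K"
      using g(4)[OF xy] \<open>card U \<le> 2 * K\<close> by (intro add_mono mult_left_mono) (auto simp: U_def)
    finally have sd: "real (card (sym_diff (A x) (A y))) \<le> real N * \<delta> + 2 * real K" .
    have "real N - real K \<le> (\<Sum>p\<in>cball x S. real N * g x p - 1)"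
      using g(3)[of x] K[of x] by (simp add: sum_subtractf sum_distrib_left[symmetric])
    also have "\<dots> \<le> (\<Sum>p\<in>cball x S. real (k x p))"
      using k by (intro sum_mono)
    also have "\<dots> = real (card (A x))"
      using finite_cball[OF bg] by (simp add: A_def card_SigmaI)
    also have "card (A x) \<le> card (A x \<inter> A y) + card (sym_diff (A x) (A y))"
      using fin by (intro order_trans[OF card_mono card_Un_le]) auto
    finally have "real N - real K - (real N * \<delta> + 2 * real K) \<le> real (card (A x \<inter> A y))"
      using sd by simp
    moreover have "real N * \<delta> \<le> real N * (1/4)"
      using \<delta> by (intro mult_left_mono) auto
    ultimately have int: "real N * (3/4) - 3 * real K \<le> real (card (A x \<inter> A y))"
      by simp
    have "real N * \<delta> \<le> real N * (\<epsilon> / 8)"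
      using \<delta> by (intro mult_left_mono) auto
    then have "real N * \<delta> + 2 * real K \<le> real N * (\<epsilon> / 8) + 2 * real K"
      by simp
    also have "\<dots> < \<epsilon> * (real N * (3/4) - 3 * real K)"
    proof -
      have eqs: "real N * (\<epsilon> / 8) = (\<epsilon> * real N) / 8"
        "\<epsilon> * (real N * (3/4) - 3 * real K) = (\<epsilon> * real N) * (3/4) - 3 * (\<epsilon> * real K)"
        by (simp_all add: algebra_simps)
      have "\<epsilon> * (4 * real K / \<epsilon> + 6 * real K + 1) \<le> \<epsilon> * real N"
        using N e by (intro mult_left_mono) auto
      then have "4 * real K + 6 * (\<epsilon> * real K) + \<epsilon> \<le> \<epsilon> * real N"
        using e by (simp add: distrib_left mult.left_commute)
      moreover have "0 \<le> \<epsilon> * real K"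
        using e by simp
      ultimately show ?thesis
        unfolding eqs using e by linarith
    qed
    also have "\<dots> \<le> \<epsilon> * real (card (A x \<inter> A y))"
      using int e by (intro mult_left_mono) auto
    finally show "real (card (sym_diff (A x) (A y))) < \<epsilon> * real (card (A x \<inter> A y))"
      using sd by simp
  qed
qed

end

section \<open>Square-integrable functions and operators\<close>

definition restrict_to :: "'a set \<Rightarrow> ('a \<Rightarrow> 'h::zero) \<Rightarrow> 'a \<Rightarrow> 'h" where
  "restrict_to A \<xi> x = (if x \<in> A then \<xi> x else 0)"

lemma power2_norm_diff_le: "(norm (a - b))\<^sup>2 \<le> 2 * (norm a)\<^sup>2 + 2 * (norm (b::'b::real_normed_vector))\<^sup>2"
proof -
  have "(norm (a - b))\<^sup>2 \<le> (norm a + norm b)\<^sup>2"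
    by (intro power_mono norm_triangle_ineq4) auto
  also have "\<dots> \<le> 2 * (norm a)\<^sup>2 + 2 * (norm b)\<^sup>2"
    using sum_squares_bound[of "norm a" "norm b"] by (simp add: power2_sum)
  finally show ?thesis .
qed

lemma L2_norm_nonneg: "0 \<le> L2_norm \<nu> \<xi>"
  by (simp add: L2_norm_def)

lemma power2_L2_norm: "(L2_norm \<nu> \<xi>)\<^sup>2 = (\<integral>x. (norm (\<xi> x))\<^sup>2 \<partial>\<nu>)"
  by (simp add: L2_norm_def)

context
  fixes \<nu> :: "'a::metric_space measure"
  assumes bg: "bounded_geometry TYPE('a)"
    and sets_nu: "sets \<nu> = sets borel"
    and lf: "locally_finite_measure \<nu>"
begin

text \<open>Local finiteness makes point masses finite, so that norms become sums of real
  numbers.\<close>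

lemma emeasure_singleton: "emeasure \<nu> {x} = ennreal (measure \<nu> {x})"
proof -
  obtain U where "x \<in> U" "emeasure \<nu> U < \<infinity>"
    using lf unfolding locally_finite_measure_def by blast
  moreover have "emeasure \<nu> {x} \<le> emeasure \<nu> U"
    using \<open>x \<in> U\<close> sets_discrete[OF bg sets_nu] by (intro emeasure_mono) auto
  ultimately show ?thesis
    by (intro emeasure_eq_ennreal_measure) auto
qed

lemma sum_emeasure_singleton:
  assumes "\<And>x. 0 \<le> f x"
  shows "(\<Sum>x\<in>F. ennreal (f x) * emeasure \<nu> {x}) = ennreal (\<Sum>x\<in>F. measure \<nu> {x} * f x)"
  using assms by (simp add: emeasure_singleton ennreal_mult[symmetric] mult.commute)

lemma L2_I:
  assumes "\<And>F. finite F \<Longrightarrow> (\<Sum>x\<in>F. measure \<nu> {x} * (norm (\<xi> x))\<^sup>2) \<le> B"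
    and "\<And>x. measure \<nu> {x} = 0 \<Longrightarrow> \<xi> x = (0::'h::complex_hilbert)"
  shows "\<xi> \<in> L2 \<nu>"
proof -
  have "(\<integral>\<^sup>+x. ennreal ((norm (\<xi> x))\<^sup>2) \<partial>\<nu>) \<le> ennreal B"
    using assms(1) by (intro nn_integral_leI[OF bg sets_nu]) (auto simp: sum_emeasure_singleton ennreal_leI)
  then have "integrable \<nu> (\<lambda>x. (norm (\<xi> x))\<^sup>2)"
    by (intro integrableI_nonneg)
       (auto simp: measurable_discrete[OF bg sets_nu] less_top[symmetric] top_unique intro: le_less_trans)
  then show ?thesis
    using assms(2) by (auto simp: L2_def measurable_discrete[OF bg sets_nu] emeasure_singleton)
qed

lemma L2_D: "\<xi> \<in> L2 \<nu> \<Longrightarrow> measure \<nu> {x} = 0 \<Longrightarrow> \<xi> x = 0"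
  by (auto simp: L2_def emeasure_singleton)

lemma nn_integral_L2:
  "\<xi> \<in> L2 \<nu> \<Longrightarrow> (\<integral>\<^sup>+x. ennreal ((norm (\<xi> x))\<^sup>2) \<partial>\<nu>) = ennreal ((L2_norm \<nu> \<xi>)\<^sup>2)"
  unfolding power2_L2_norm by (intro nn_integral_eq_integral) (auto simp: L2_def)

lemma sum_le_L2_norm:
  assumes "\<xi> \<in> L2 \<nu>" "finite F"
  shows "(\<Sum>x\<in>F. measure \<nu> {x} * (norm (\<xi> x))\<^sup>2) \<le> (L2_norm \<nu> \<xi>)\<^sup>2"
  using sum_le_nn_integral[OF bg sets_nu assms(2), of "\<lambda>x. ennreal ((norm (\<xi> x))\<^sup>2)"]
  by (simp add: sum_emeasure_singleton nn_integral_L2[OF assms(1)])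

lemma L2_norm_leI:
  assumes "\<xi> \<in> L2 \<nu>" "\<And>F. finite F \<Longrightarrow> (\<Sum>x\<in>F. measure \<nu> {x} * (norm (\<xi> x))\<^sup>2) \<le> B"
  shows "(L2_norm \<nu> \<xi>)\<^sup>2 \<le> B"
proof -
  have "(\<integral>\<^sup>+x. ennreal ((norm (\<xi> x))\<^sup>2) \<partial>\<nu>) \<le> ennreal B"
    using assms(2) by (intro nn_integral_leI[OF bg sets_nu]) (auto simp: sum_emeasure_singleton ennreal_leI)
  moreover have "0 \<le> B"
    using assms(2)[of "{}"] by simp
  ultimately show ?thesis
    by (simp add: nn_integral_L2[OF assms(1)])
qed

lemma L2_norm_finite_support:
  assumes "\<xi> \<in> L2 \<nu>" "finite F" "\<And>x. x \<notin> F \<Longrightarrow> \<xi> x = 0"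
  shows "(L2_norm \<nu> \<xi>)\<^sup>2 = (\<Sum>x\<in>F. measure \<nu> {x} * (norm (\<xi> x))\<^sup>2)"
proof (rule antisym)
  show "(L2_norm \<nu> \<xi>)\<^sup>2 \<le> (\<Sum>x\<in>F. measure \<nu> {x} * (norm (\<xi> x))\<^sup>2)"
  proof (rule L2_norm_leI[OF assms(1)])
    fix G :: "'a set" assume "finite G"
    then have "(\<Sum>x\<in>G. measure \<nu> {x} * (norm (\<xi> x))\<^sup>2) = (\<Sum>x\<in>G \<inter> F. measure \<nu> {x} * (norm (\<xi> x))\<^sup>2)"
      using assms(3) by (intro sum.mono_neutral_right) auto
    also have "\<dots> \<le> (\<Sum>x\<in>F. measure \<nu> {x} * (norm (\<xi> x))\<^sup>2)"
      using assms(2) by (intro sum_mono2) auto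
    finally show "(\<Sum>x\<in>G. measure \<nu> {x} * (norm (\<xi> x))\<^sup>2) \<le> (\<Sum>x\<in>F. measure \<nu> {x} * (norm (\<xi> x))\<^sup>2)" .
  qed
qed (rule sum_le_L2_norm[OF assms(1,2)])

lemma L2_dominated:
  assumes "\<xi> \<in> L2 \<nu>" "\<And>x. norm (\<eta> x :: 'h::complex_hilbert) \<le> norm (\<xi> x :: 'h)"
  shows "\<eta> \<in> L2 \<nu>"
proof (rule L2_I)
  fix F :: "'a set" assume "finite F"
  then show "(\<Sum>x\<in>F. measure \<nu> {x} * (norm (\<eta> x))\<^sup>2) \<le> (L2_norm \<nu> \<xi>)\<^sup>2"
    using assms(2)
    by (intro order_trans[OF sum_mono sum_le_L2_norm[OF assms(1)]] mult_left_mono power_mono) auto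
next
  fix x assume "measure \<nu> {x} = 0"
  then show "\<eta> x = 0"
    using L2_D[OF assms(1)] assms(2)[of x] by simp
qed

lemma L2_restrict_to: "\<xi> \<in> L2 \<nu> \<Longrightarrow> restrict_to A \<xi> \<in> L2 \<nu>"
  by (erule L2_dominated) (simp add: restrict_to_def)

lemma L2_finite_support:
  assumes "finite F" "\<And>x. x \<notin> F \<Longrightarrow> \<xi> x = (0::'h::complex_hilbert)" "\<And>x. measure \<nu> {x} = 0 \<Longrightarrow> \<xi> x = 0"
  shows "\<xi> \<in> L2 \<nu>"
proof (rule L2_I)
  fix G :: "'a set" assume "finite G"
  then have "(\<Sum>x\<in>G. measure \<nu> {x} * (norm (\<xi> x))\<^sup>2) = (\<Sum>x\<in>G \<inter> F. measure \<nu> {x} * (norm (\<xi> x))\<^sup>2)"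
    using assms(2) by (intro sum.mono_neutral_right) auto
  also have "\<dots> \<le> (\<Sum>x\<in>F. measure \<nu> {x} * (norm (\<xi> x))\<^sup>2)"
    using assms(1) by (intro sum_mono2) auto
  finally show "(\<Sum>x\<in>G. measure \<nu> {x} * (norm (\<xi> x))\<^sup>2) \<le> (\<Sum>x\<in>F. measure \<nu> {x} * (norm (\<xi> x))\<^sup>2)" .
qed (use assms in auto)

lemma L2_zero: "(\<lambda>x. 0) \<in> L2 \<nu>"
  by (rule L2_finite_support[of "{}"]) auto

lemma L2_point_mass: "measure \<nu> {z} \<noteq> 0 \<Longrightarrow> (\<lambda>x. if x = z then h else 0) \<in> L2 \<nu>"
  by (rule L2_finite_support[of "{z}"]) auto

text \<open>Finitely supported functions are dense: a finite set that carries all but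
  \<open>e\<close> of the squared norm leaves at most \<open>e\<close> on its complement.\<close>

lemma L2_tail:
  assumes "\<xi> \<in> L2 \<nu>" "0 < e"
  obtains F where "finite F" "(L2_norm \<nu> (restrict_to (- F) \<xi>))\<^sup>2 \<le> e"
proof -
  have "\<exists>F. finite F \<and> (L2_norm \<nu> \<xi>)\<^sup>2 - e < (\<Sum>x\<in>F. measure \<nu> {x} * (norm (\<xi> x))\<^sup>2)"
    using L2_norm_leI[OF assms(1), of "(L2_norm \<nu> \<xi>)\<^sup>2 - e"] assms(2) by (auto simp: not_le[symmetric])
  then obtain F where F: "finite F" "(L2_norm \<nu> \<xi>)\<^sup>2 - e < (\<Sum>x\<in>F. measure \<nu> {x} * (norm (\<xi> x))\<^sup>2)"
    by blast
  have "(L2_norm \<nu> (restrict_to (- F) \<xi>))\<^sup>2 \<le> e"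
  proof (rule L2_norm_leI[OF L2_restrict_to[OF assms(1)]])
    fix G :: "'a set" assume G: "finite G"
    then have "(\<Sum>x\<in>G. measure \<nu> {x} * (norm (restrict_to (- F) \<xi> x))\<^sup>2) = (\<Sum>x\<in>G - F. measure \<nu> {x} * (norm (\<xi> x))\<^sup>2)"
      by (intro sum.mono_neutral_cong_right) (auto simp: restrict_to_def)
    also have "\<dots> + (\<Sum>x\<in>F. measure \<nu> {x} * (norm (\<xi> x))\<^sup>2) = (\<Sum>x\<in>(G - F) \<union> F. measure \<nu> {x} * (norm (\<xi> x))\<^sup>2)"
      using F G by (intro sum.union_disjoint[symmetric]) auto
    also have "\<dots> \<le> (L2_norm \<nu> \<xi>)\<^sup>2"
      using F G by (intro sum_le_L2_norm[OF assms(1)]) auto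
    finally show "(\<Sum>x\<in>G. measure \<nu> {x} * (norm (restrict_to (- F) \<xi> x))\<^sup>2) \<le> e"
      using F(2) by simp
  qed
  with F(1) show thesis
    by (rule that)
qed

context
  fixes a :: "('a \<Rightarrow> 'h::complex_hilbert) \<Rightarrow> 'a \<Rightarrow> 'h"
  assumes a: "L2_bounded_operator \<nu> a"
begin

lemma operator_closed: "\<xi> \<in> L2 \<nu> \<Longrightarrow> a \<xi> \<in> L2 \<nu>"
  using a by (simp add: L2_bounded_operator_def)

lemma operator_add: "\<xi> \<in> L2 \<nu> \<Longrightarrow> \<eta> \<in> L2 \<nu> \<Longrightarrow> a (\<lambda>x. \<xi> x + \<eta> x) y = a \<xi> y + a \<eta> y"
  using a by (simp add: L2_bounded_operator_def)

lemma operator_zero: "a (\<lambda>x. 0) y = 0"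
  using operator_add[OF L2_zero L2_zero, of y] by simp

lemma operator_restrict_to:
  assumes "\<xi> \<in> L2 \<nu>"
  shows "a \<xi> y = a (restrict_to A \<xi>) y + a (restrict_to (- A) \<xi>) y"
proof -
  have "\<xi> = (\<lambda>x. restrict_to A \<xi> x + restrict_to (- A) \<xi> x)"
    by (auto simp: restrict_to_def)
  then show ?thesis
    using operator_add[OF L2_restrict_to L2_restrict_to, OF assms assms, of A "- A" y] by simp
qed

lemma operator_bound:
  obtains K where "0 \<le> K" "\<And>\<xi>. \<xi> \<in> L2 \<nu> \<Longrightarrow> L2_norm \<nu> (a \<xi>) \<le> K * L2_norm \<nu> \<xi>"
proof -
  obtain K where K: "\<And>\<xi>. \<xi> \<in> L2 \<nu> \<Longrightarrow> L2_norm \<nu> (a \<xi>) \<le> K * L2_norm \<nu> \<xi>"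
    using a unfolding L2_bounded_operator_def by blast
  show thesis
  proof (rule that[of "max K 0"])
    fix \<xi> :: "'a \<Rightarrow> 'h" assume "\<xi> \<in> L2 \<nu>"
    then have "L2_norm \<nu> (a \<xi>) \<le> K * L2_norm \<nu> \<xi>"
      by (rule K)
    also have "\<dots> \<le> max K 0 * L2_norm \<nu> \<xi>"
      by (intro mult_right_mono) (auto simp: L2_norm_nonneg)
    finally show "L2_norm \<nu> (a \<xi>) \<le> max K 0 * L2_norm \<nu> \<xi>" .
  qed simp
qed

lemma bdd_above_operator_quotients: "bdd_above ((\<lambda>\<xi>. L2_norm \<nu> (a \<xi>) / L2_norm \<nu> \<xi>) ` L2 \<nu>)"
proof -
  obtain K where K: "0 \<le> K" "\<And>\<xi>. \<xi> \<in> L2 \<nu> \<Longrightarrow> L2_norm \<nu> (a \<xi>) \<le> K * L2_norm \<nu> \<xi>"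
    using operator_bound by blast
  show ?thesis
  proof (rule bdd_aboveI2)
    fix \<xi> :: "'a \<Rightarrow> 'h" assume "\<xi> \<in> L2 \<nu>"
    then show "L2_norm \<nu> (a \<xi>) / L2_norm \<nu> \<xi> \<le> K"
      using K(1) K(2)[of \<xi>] L2_norm_nonneg[of \<nu> \<xi>] by (cases "L2_norm \<nu> \<xi> = 0") (auto simp: divide_le_eq)
  qed
qed

text \<open>Matrix entries determine the operator on finitely supported functions by linearity. The
  tail of \<eta> is arbitrarily small in norm, and boundedness of \<open>a\<close> together with the
  positive mass of \<open>y\<close> makes its effect at \<open>y\<close> arbitrarily small as
  well.\<close>

lemma operator_local:
  assumes propag: "propagation \<nu> a \<le> of_nat R" and y: "measure \<nu> {y} \<noteq> 0"
    and \<eta>: "\<eta> \<in> L2 \<nu>" and van: "\<And>x. dist y x \<le> real R \<Longrightarrow> \<eta> x = 0"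
  shows "a \<eta> y = 0"
proof -
  have entry: "a (\<lambda>x. if x = z then \<eta> z else 0) y = 0" for z
  proof (cases "\<eta> z = 0")
    case True
    then have "(\<lambda>x. if x = z then \<eta> z else 0) = (\<lambda>x. 0)"
      by auto
    then show ?thesis
      by (simp add: operator_zero)
  next
    case False
    \<comment> \<open>\<open>propagation\<close> sees only points of positive mass; at the others
      \<eta> vanishes, being the distinguished representative.\<close>
    then have z: "measure \<nu> {z} \<noteq> 0" "real R < dist y z"
      using L2_D[OF \<eta>, of z] van[of z] by (auto intro: not_le_imp_less)
    have "matrix_entry a y z = (\<lambda>h. 0)"
    proof (rule ccontr)
      assume "matrix_entry a y z \<noteq> (\<lambda>h. 0)"
      then have "ennreal (dist y z) \<le> propagation \<nu> a"
        unfolding propagation_def using y z by (intro Sup_upper) (auto simp: emeasure_singleton less_le)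
      also note propag
      finally have "ennreal (dist y z) \<le> ennreal (real R)"
        by (simp add: ennreal_of_nat_eq_real_of_nat)
      then show False
        using z by simp
    qed
    then show ?thesis
      unfolding matrix_entry_def by metis
  qed
  have fin: "a (restrict_to F \<eta>) y = 0" if "finite F" for F
    using that
  proof induction
    case empty
    have "restrict_to {} \<eta> = (\<lambda>x. 0)"
      by (auto simp: restrict_to_def)
    then show ?case
      by (simp add: operator_zero)
  next
    case (insert z F)
    have "restrict_to (insert z F) \<eta> = (\<lambda>x. restrict_to F \<eta> x + restrict_to {z} \<eta> x)"
      using insert.hyps by (auto simp: restrict_to_def)
    moreover have "restrict_to {z} \<eta> = (\<lambda>x. if x = z then \<eta> z else 0)"
      by (auto simp: restrict_to_def)
    ultimately show ?case
      using operator_add[OF L2_restrict_to L2_restrict_to, OF \<eta> \<eta>, of F "{z}" y] insert.IH entry[of z] by simp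
  qed
  obtain K where K: "0 \<le> K" "\<And>\<xi>. \<xi> \<in> L2 \<nu> \<Longrightarrow> L2_norm \<nu> (a \<xi>) \<le> K * L2_norm \<nu> \<xi>"
    using operator_bound by blast
  have "measure \<nu> {y} * (norm (a \<eta> y))\<^sup>2 \<le> 0"
  proof (rule field_le_epsilon)
    fix e :: real assume e: "0 < e"
    define d where "d = e / (K\<^sup>2 + 1)"
    have "0 < K\<^sup>2 + 1"
      by (simp add: add_nonneg_pos)
    then have d: "0 < d" "K\<^sup>2 * d \<le> e"
      using e by (auto simp: d_def field_simps)
    obtain F where F: "finite F" "(L2_norm \<nu> (restrict_to (- F) \<eta>))\<^sup>2 \<le> d"
      by (rule L2_tail[OF \<eta> d(1)])
    have "measure \<nu> {y} * (norm (a \<eta> y))\<^sup>2 = measure \<nu> {y} * (norm (a (restrict_to (- F) \<eta>) y))\<^sup>2"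
      using operator_restrict_to[OF \<eta>, of y F] fin[OF F(1)] by simp
    also have "\<dots> \<le> (L2_norm \<nu> (a (restrict_to (- F) \<eta>)))\<^sup>2"
      using sum_le_L2_norm[OF operator_closed[OF L2_restrict_to[OF \<eta>, of "- F"]], of "{y}"] by simp
    also have "\<dots> \<le> (K * L2_norm \<nu> (restrict_to (- F) \<eta>))\<^sup>2"
      by (intro power_mono K L2_restrict_to \<eta> L2_norm_nonneg)
    also have "\<dots> \<le> K\<^sup>2 * d"
      using F(2) by (simp add: power_mult_distrib mult_left_mono)
    finally show "measure \<nu> {y} * (norm (a \<eta> y))\<^sup>2 \<le> 0 + e"
      using d by simp
  qed
  then show ?thesis
    using y measure_nonneg[of \<nu> "{y}"] by (simp add: mult_le_0_iff)
qed

end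

end

lemma infinite_dimensional_imp_nonzero:
  assumes "infinite_dimensional TYPE('h::complex_hilbert)"
  obtains h :: "'h::complex_hilbert" where "h \<noteq> 0"
proof (rule ccontr)
  assume "\<not> thesis"
  then have "h = 0" for h :: 'h
    using that by blast
  then have "UNIV = {0 :: 'h}"
    by blast
  moreover have "module.span (*\<^sub>C) {} = {0 :: 'h}"
    using module.span_empty[of "(*\<^sub>C)"] vector_space_scaleC by (simp add: module_iff_vector_space)
  ultimately show False
    using assms unfolding infinite_dimensional_def by (metis finite.emptyI)
qed

section \<open>From metric sparsification to operator norm localization\<close>

context
  assumes bg: "bounded_geometry TYPE('a::metric_space)"
begin

lemma exists_positive_mass:
  fixes \<nu> :: "'a measure"
  assumes sets: "sets \<nu> = sets borel" and ne: "emeasure \<nu> UNIV \<noteq> 0"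
  shows "\<exists>x. emeasure \<nu> {x} \<noteq> 0"
proof (rule ccontr)
  assume "\<not> ?thesis"
  then have "(\<integral>\<^sup>+x. 1 \<partial>\<nu>) \<le> 0"
    by (intro nn_integral_leI[OF bg sets]) auto
  then show False
    using ne space_discrete[OF bg sets] by simp
qed

text \<open>The cut-off of an almost norming vector \<open>\<xi>\<close> to the \<open>R\<close>-neighbourhoods of the pieces of a sparse
  family for the measure \<open>|a \<xi>|\<^sup>2 \<nu>\<close> has a component that is almost norming.\<close>

lemma MSP_imp_ONL:
  assumes nz: "(h0 :: 'h::complex_hilbert) \<noteq> 0" and "MSP TYPE('a)"
  shows "ONL TYPE('a) TYPE('h)"
proof -
  obtain c :: real and f :: "nat \<Rightarrow> nat" where c: "0 < c" "c \<le> 1" and msp: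
    "\<And>m (\<mu> :: 'a measure). finite_measure \<mu> \<Longrightarrow> sets \<mu> = sets borel \<Longrightarrow>
         (\<exists>P :: 'a set set. \<Union>P \<in> sets borel \<and> disjoint P \<and>
            (\<forall>U\<in>P. \<forall>V\<in>P. U \<noteq> V \<longrightarrow> (\<forall>x\<in>U. \<forall>y\<in>V. real m \<le> dist x y)) \<and>
            (\<forall>U\<in>P. diam_le U (real (f m))) \<and>
            c * measure \<mu> UNIV \<le> measure \<mu> (\<Union>P))"
    using assms(2) unfolding MSP_def by (elim exE conjE) blast
  \<comment> \<open>Pieces at distance at least \<open>2 * R + 1\<close> have disjoint
    \<open>R\<close>-neighbourhoods, and passing to the neighbourhood adds at most
    \<open>2 * R\<close> to the diameter.\<close>
  define f' where "f' R = f (2 * R + 1) + 2 * R" for R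
  have "ONL_relative TYPE('h) \<nu> f' (c / 2)"
    if sets: "sets \<nu> = sets borel" and ne: "emeasure \<nu> UNIV \<noteq> 0" and lf: "locally_finite_measure \<nu>" for \<nu> :: "'a measure"
    unfolding ONL_relative_def
  proof (intro allI impI, elim conjE)
    fix R :: nat and a :: "('a \<Rightarrow> 'h) \<Rightarrow> 'a \<Rightarrow> 'h"
    assume a: "L2_bounded_operator \<nu> a" and propag: "propagation \<nu> a \<le> of_nat R"
    note facts = bg sets lf
    define N where "N = L2_onorm \<nu> a"
    note bdd = bdd_above_operator_quotients[OF facts a]
    have "0 \<le> N"
    proof -
      have "L2_norm \<nu> (a (\<lambda>x. 0)) / L2_norm \<nu> (\<lambda>x. 0 :: 'h) \<le> N"
        unfolding N_def L2_onorm_def by (rule cSUP_upper[OF L2_zero[OF facts] bdd])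
      then show ?thesis
        using L2_norm_nonneg by (meson divide_nonneg_nonneg order_trans)
    qed
    show "\<exists>\<zeta>\<in>L2 \<nu>. \<zeta> \<noteq> (\<lambda>x. 0) \<and> diam_le (support_on UNIV \<zeta>) (real (f' R)) \<and>
           c / 2 * L2_onorm \<nu> a * L2_norm \<nu> \<zeta> \<le> L2_norm \<nu> (a \<zeta>)"
    proof (cases "N = 0")
      case True
      obtain x where x: "measure \<nu> {x} \<noteq> 0"
        using exists_positive_mass[OF sets ne] emeasure_singleton[OF facts] by auto
      show ?thesis
      proof (intro bexI[of _ "\<lambda>y. if y = x then h0 else 0"] conjI)
        show "diam_le (support_on UNIV (\<lambda>y. if y = x then h0 else 0)) (real (f' R))"
          by (intro diam_le_I) (auto simp: support_on_def split: if_splits)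
        show "(\<lambda>y. if y = x then h0 else 0) \<noteq> (\<lambda>x. 0)"
          using nz by (metis (full_types))
        show "c / 2 * L2_onorm \<nu> a * L2_norm \<nu> (\<lambda>y. if y = x then h0 else 0) \<le> L2_norm \<nu> (a (\<lambda>y. if y = x then h0 else 0))"
          using True by (simp add: N_def L2_norm_nonneg)
      qed (rule L2_point_mass[OF facts x])
    next
      case False
      then have "N / 2 < N"
        using \<open>0 \<le> N\<close> by simp
      \<comment> \<open>The supremum need not be attained; a vector reaching half of it is paid for
        by the 1/2 in the constant \<open>c / 2\<close>.\<close>
      then obtain \<xi> where \<xi>: "\<xi> \<in> L2 \<nu>" "N / 2 < L2_norm \<nu> (a \<xi>) / L2_norm \<nu> \<xi>"
        unfolding N_def L2_onorm_def using less_cSUP_iff[OF _ bdd] L2_zero[OF facts] by blast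
      have "L2_norm \<nu> \<xi> \<noteq> 0"
        using \<xi>(2) \<open>0 \<le> N\<close> by auto
      then have \<xi>_pos: "0 < L2_norm \<nu> \<xi>"
        using L2_norm_nonneg[of \<nu> \<xi>] by simp
      then have almost: "N * L2_norm \<nu> \<xi> < 2 * L2_norm \<nu> (a \<xi>)"
        using \<xi>(2) by (simp add: field_simps)
      note a\<xi> = operator_closed[OF facts a \<xi>(1)]
      define k where "k = (c / 2 * N)\<^sup>2"
      define u where "u x = measure \<nu> {x} * (norm (a \<xi> x))\<^sup>2" for x
      have u: "0 \<le> u x" for x
        by (simp add: u_def)
      define \<mu> where "\<mu> = weight_measure u"
      have sets_\<mu>: "sets \<mu> = sets borel"
        by (simp add: \<mu>_def sets_weight_measure[OF bg])
      have em: "emeasure \<mu> {x} = ennreal (u x)" for x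
        by (simp add: \<mu>_def emeasure_weight_measure_singleton)
      have "(\<integral>\<^sup>+x. 1 \<partial>\<mu>) \<le> ennreal ((L2_norm \<nu> (a \<xi>))\<^sup>2)"
        using sum_le_L2_norm[OF facts a\<xi>] u
        by (intro nn_integral_leI[OF bg sets_\<mu>]) (simp add: em u_def ennreal_leI)
      then have "emeasure \<mu> UNIV \<le> ennreal ((L2_norm \<nu> (a \<xi>))\<^sup>2)"
        using space_discrete[OF bg sets_\<mu>] by simp
      then have fin_\<mu>: "finite_measure \<mu>"
        using space_discrete[OF bg sets_\<mu>] by (intro finite_measureI) (auto simp: top_unique)
      then interpret finite_measure \<mu> .
      have m: "measure \<mu> {x} = u x" for x
        using em[of x] u[of x] by (simp add: measure_def)
      have total: "(L2_norm \<nu> (a \<xi>))\<^sup>2 \<le> measure \<mu> UNIV"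
      proof (rule L2_norm_leI[OF facts a\<xi>])
        fix F :: "'a set" assume "finite F"
        then have "(\<Sum>x\<in>F. measure \<nu> {x} * (norm (a \<xi> x))\<^sup>2) = measure \<mu> F"
          using measure_finite_set[OF bg sets_\<mu> fin_\<mu>] by (simp add: m u_def)
        also have "\<dots> \<le> measure \<mu> UNIV"
          using sets_discrete[OF bg sets_\<mu>] by (intro finite_measure_mono) auto
        finally show "(\<Sum>x\<in>F. measure \<nu> {x} * (norm (a \<xi> x))\<^sup>2) \<le> measure \<mu> UNIV" .
      qed
      obtain P where P: "disjoint P"
            "\<forall>U\<in>P. \<forall>V\<in>P. U \<noteq> V \<longrightarrow> (\<forall>x\<in>U. \<forall>y\<in>V. real (2 * R + 1) \<le> dist x y)"
            "\<forall>U\<in>P. diam_le U (real (f (2 * R + 1)))" "c * measure \<mu> UNIV \<le> measure \<mu> (\<Union>P)"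
        using msp[OF fin_\<mu> sets_\<mu>, of "2 * R + 1"] by (elim exE conjE)
      define nb where "nb U = {x. \<exists>y\<in>U. dist x y \<le> real R}" for U :: "'a set"
      show ?thesis
      proof (rule ccontr)
        assume neg: "\<not> ?thesis"
        have fin_nb: "finite (nb U)" if "U \<in> P" for U
          unfolding nb_def using P(3) that by (intro finite_neighbourhood[OF bg] finite_of_diam_le[OF bg]) auto
        have piece: "(\<Sum>x\<in>G \<inter> U. u x) \<le> k * (\<Sum>x\<in>nb U. measure \<nu> {x} * (norm (\<xi> x))\<^sup>2)"
          if U: "U \<in> P" and G: "finite G" for U G
        proof -
          define \<zeta> where "\<zeta> = restrict_to (nb U) \<xi>"
          have \<zeta>: "\<zeta> \<in> L2 \<nu>"
            unfolding \<zeta>_def by (rule L2_restrict_to[OF facts \<xi>(1)])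
          have \<zeta>_norm: "(L2_norm \<nu> \<zeta>)\<^sup>2 = (\<Sum>x\<in>nb U. measure \<nu> {x} * (norm (\<xi> x))\<^sup>2)"
            using L2_norm_finite_support[OF facts \<zeta> fin_nb[OF U]] by (simp add: \<zeta>_def restrict_to_def)
          have "L2_norm \<nu> (a \<zeta>) \<le> c / 2 * N * L2_norm \<nu> \<zeta>"
          proof (cases "\<zeta> = (\<lambda>x. 0)")
            case True
            then have "a \<zeta> = (\<lambda>x. 0)"
              using operator_zero[OF facts a] by auto
            then show ?thesis
              using c \<open>0 \<le> N\<close> by (simp add: L2_norm_def)
          next
            case False
            have "diam_le (support_on UNIV \<zeta>) (real (f' R))"
            proof (rule diam_le_I)
              fix x y assume "x \<in> support_on UNIV \<zeta>" "y \<in> support_on UNIV \<zeta>"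
              then obtain x' y' where *: "x' \<in> U" "dist x x' \<le> real R" "y' \<in> U" "dist y y' \<le> real R"
                unfolding \<zeta>_def support_on_def restrict_to_def nb_def by (auto split: if_splits)
              then have "dist x' y' \<le> real (f (2 * R + 1))"
                using P(3) U diam_le_D by blast
              then show "dist x y \<le> real (f' R)"
                using * dist_triangle[of x y x'] dist_triangle[of x' y y'] by (simp add: f'_def dist_commute)
            qed simp
            then show ?thesis
              using neg \<zeta> False unfolding N_def by force
          qed
          then have "(L2_norm \<nu> (a \<zeta>))\<^sup>2 \<le> k * (L2_norm \<nu> \<zeta>)\<^sup>2"
            unfolding k_def power_mult_distrib[symmetric] by (intro power_mono L2_norm_nonneg)
          moreover have "(\<Sum>x\<in>G \<inter> U. u x) \<le> (L2_norm \<nu> (a \<zeta>))\<^sup>2"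
          proof -
            \<comment> \<open>On \<open>U\<close> the images of \<xi> and of its cut-off \<zeta>
              agree: what was cut off vanishes within distance \<open>R\<close> of
              \<open>U\<close>.\<close>
            have "u x = measure \<nu> {x} * (norm (a \<zeta> x))\<^sup>2" if "x \<in> U" for x
            proof (cases "measure \<nu> {x} = 0")
              case False
              have "a (restrict_to (- nb U) \<xi>) x = 0"
                using that by (intro operator_local[OF facts a propag False L2_restrict_to[OF facts \<xi>(1)]])
                  (auto simp: restrict_to_def nb_def dist_commute)
              then show ?thesis
                using operator_restrict_to[OF facts a \<xi>(1), of x "nb U"] by (simp add: u_def \<zeta>_def)
            qed (simp add: u_def)
            then have "(\<Sum>x\<in>G \<inter> U. u x) = (\<Sum>x\<in>G \<inter> U. measure \<nu> {x} * (norm (a \<zeta> x))\<^sup>2)"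
              by (intro sum.cong) auto
            also have "\<dots> \<le> (L2_norm \<nu> (a \<zeta>))\<^sup>2"
              using G by (intro sum_le_L2_norm[OF facts operator_closed[OF facts a \<zeta>]]) auto
            finally show ?thesis .
          qed
          ultimately show ?thesis
            by (simp add: \<zeta>_norm)
        qed
        have "measure \<mu> (\<Union>P) \<le> k * (L2_norm \<nu> \<xi>)\<^sup>2"
        proof (rule ccontr)
          assume "\<not> ?thesis"
          then have "k * (L2_norm \<nu> \<xi>)\<^sup>2 < measure \<mu> (\<Union>P)"
            by simp
          moreover have "0 \<le> k * (L2_norm \<nu> \<xi>)\<^sup>2"
            by (simp add: k_def)
          ultimately obtain G where G: "finite G" "G \<subseteq> \<Union>P" "k * (L2_norm \<nu> \<xi>)\<^sup>2 < (\<Sum>x\<in>G. u x)"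
            using finite_subset_measure[OF bg sets_\<mu> fin_\<mu>] unfolding m by metis
          \<comment> \<open>The family may be infinite, but only finitely many pieces meet
            \<open>G\<close>, since by disjointness their nonempty traces on \<open>G\<close> are
            distinct.\<close>
          define Q where "Q = {U \<in> P. U \<inter> G \<noteq> {}}"
          have QP: "U \<in> P" if "U \<in> Q" for U
            using that by (simp add: Q_def)
          have "inj_on (\<lambda>U. U \<inter> G) Q"
            using P(1) unfolding Q_def disjoint_def by (intro inj_onI) blast
          moreover have "(\<lambda>U. U \<inter> G) ` Q \<subseteq> Pow G"
            by auto
          ultimately have "finite Q"
            using G(1) by (meson finite_Pow_iff finite_imageD finite_subset)
          have "(\<Sum>x\<in>G. u x) = (\<Sum>x\<in>(\<Union>U\<in>Q. G \<inter> U). u x)"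
            using G(2) by (intro sum.cong) (auto simp: Q_def)
          also have "\<dots> = (\<Sum>U\<in>Q. \<Sum>x\<in>G \<inter> U. u x)"
            using \<open>finite Q\<close> G(1) P(1) by (intro sum.UNION_disjoint) (auto simp: Q_def disjoint_def)
          also have "\<dots> \<le> (\<Sum>U\<in>Q. k * (\<Sum>x\<in>nb U. measure \<nu> {x} * (norm (\<xi> x))\<^sup>2))"
            using piece QP G(1) by (intro sum_mono) auto
          also have "\<dots> = k * (\<Sum>U\<in>Q. \<Sum>x\<in>nb U. measure \<nu> {x} * (norm (\<xi> x))\<^sup>2)"
            by (simp add: sum_distrib_left)
          also have "(\<Sum>U\<in>Q. \<Sum>x\<in>nb U. measure \<nu> {x} * (norm (\<xi> x))\<^sup>2) =
              (\<Sum>x\<in>(\<Union>U\<in>Q. nb U). measure \<nu> {x} * (norm (\<xi> x))\<^sup>2)"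
          proof (rule sum.UNION_disjoint[symmetric, OF \<open>finite Q\<close>])
            show "\<forall>U\<in>Q. finite (nb U)"
              using fin_nb QP by blast
            show "\<forall>U\<in>Q. \<forall>V\<in>Q. U \<noteq> V \<longrightarrow> nb U \<inter> nb V = {}"
            proof (intro ballI impI, rule ccontr)
              fix U V assume UV: "U \<in> Q" "V \<in> Q" "U \<noteq> V" "nb U \<inter> nb V \<noteq> {}"
              then obtain x y z where *: "y \<in> U" "z \<in> V" "dist x y \<le> real R" "dist x z \<le> real R"
                unfolding nb_def by blast
              then have "real (2 * R + 1) \<le> dist y z"
                using P(2) UV QP by blast
              then show False
                using * dist_triangle[of y z x] by (simp add: dist_commute)
            qed
          qed
          also have "k * \<dots> \<le> k * (L2_norm \<nu> \<xi>)\<^sup>2"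
            using \<open>finite Q\<close> fin_nb QP
            by (intro mult_left_mono sum_le_L2_norm[OF facts \<xi>(1)]) (auto simp: k_def)
          finally show False
            using G(3) by simp
        qed
        \<comment> \<open>The 1/2 cancels against the factor 2 in \<open>almost\<close>, leaving
          \<open>c\<^sup>2\<close>, which is at most \<open>c\<close> because
          \<open>c \<le> 1\<close>. The strict inequality then contradicts the mass captured by the
          sparse family.\<close>
        also have "k * (L2_norm \<nu> \<xi>)\<^sup>2 = (c / 2)\<^sup>2 * (N * L2_norm \<nu> \<xi>)\<^sup>2"
          by (simp add: k_def power_mult_distrib power_divide)
        also have "\<dots> < (c / 2)\<^sup>2 * (2 * L2_norm \<nu> (a \<xi>))\<^sup>2"
          using almost c \<open>0 \<le> N\<close> \<xi>_pos by (intro mult_strict_left_mono power_strict_mono) auto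
        also have "\<dots> = c\<^sup>2 * (L2_norm \<nu> (a \<xi>))\<^sup>2"
          by (simp add: power2_eq_square)
        also have "\<dots> \<le> c * measure \<mu> UNIV"
          using c total by (intro mult_mono) (auto simp: power2_eq_square mult_left_le)
        finally show False
          using P(4) by simp
      qed
    qed
  qed
  then show ?thesis
    unfolding ONL_def using c by (intro exI[of _ "c / 2"] exI[of _ f']) auto
qed

end

section \<open>The lazy random walk\<close>

text \<open>The real part is a symmetric real bilinear form with the same norm, which is all that
  the energy estimates involve.\<close>

definition re_inner :: "'h::complex_hilbert \<Rightarrow> 'h \<Rightarrow> real" where
  "re_inner x y = Re (cinner x y)"

lemma re_inner_commute: "re_inner x y = re_inner y x"
  unfolding re_inner_def by (subst cinner_commute) simp

lemma re_inner_add_right: "re_inner x (y + z) = re_inner x y + re_inner x z"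
  by (simp add: re_inner_def cinner_add_right)

lemma re_inner_scaleR_right: "re_inner x (r *\<^sub>R y) = r * re_inner x y"
  by (simp add: re_inner_def scaleR_scaleC cinner_scaleC_right)

lemma re_inner_diff_right: "re_inner x (y - z) = re_inner x y - re_inner x z"
  using re_inner_add_right[of x y "(-1) *\<^sub>R z"] re_inner_scaleR_right[of x "-1" z] by simp

lemma re_inner_add_left: "re_inner (y + z) x = re_inner y x + re_inner z x"
  and re_inner_scaleR_left: "re_inner (r *\<^sub>R y) x = r * re_inner y x"
  and re_inner_diff_left: "re_inner (y - z) x = re_inner y x - re_inner z x"
  by (simp_all add: re_inner_commute[of _ x] re_inner_add_right re_inner_scaleR_right re_inner_diff_right)

lemma re_inner_sum_left: "re_inner (\<Sum>i\<in>I. f i) y = (\<Sum>i\<in>I. re_inner (f i) y)"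
  using re_inner_scaleR_left[of 0 0 y] by (induction I rule: infinite_finite_induct) (auto simp: re_inner_add_left)

lemma re_inner_self: "re_inner x x = (norm x)\<^sup>2"
proof -
  have "0 \<le> re_inner x x"
    using norm_ge_zero[of x] unfolding norm_eq_sqrt_cinner re_inner_def by (simp add: real_sqrt_ge_0_iff)
  then show ?thesis
    unfolding norm_eq_sqrt_cinner re_inner_def by simp
qed

lemma power2_norm_add: "(norm (x + y))\<^sup>2 = (norm x)\<^sup>2 + 2 * re_inner x y + (norm (y::'h::complex_hilbert))\<^sup>2"
  using re_inner_commute[of x y]
  by (simp add: re_inner_self[symmetric] re_inner_add_left re_inner_add_right)

lemma power2_norm_diff: "(norm (x - y))\<^sup>2 = (norm x)\<^sup>2 - 2 * re_inner x y + (norm (y::'h::complex_hilbert))\<^sup>2"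
  using re_inner_commute[of x y]
  by (simp add: re_inner_self[symmetric] re_inner_diff_left re_inner_diff_right)

lemma scaleC_scaleR: "c *\<^sub>C (r *\<^sub>R x) = r *\<^sub>R (c *\<^sub>C (x::'h::complex_hilbert))"
  by (simp add: scaleR_scaleC scaleC_scaleC mult.commute)

lemma scaleC_sum_right: "c *\<^sub>C (\<Sum>i\<in>I. f i) = (\<Sum>i\<in>I. c *\<^sub>C (f i :: 'h::complex_hilbert))"
proof -
  have "c *\<^sub>C (0::'h) = 0"
    using scaleC_add_right[of c 0 "0::'h"] by simp
  then show ?thesis
    by (induction I rule: infinite_finite_induct) (auto simp: scaleC_add_right)
qed

text \<open>By convexity the decrements do not increase, so the last one is the smallest of
  \<open>k + 1\<close> decrements, whose sum telescopes to at most \<open>h 0\<close>.\<close>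

lemma convex_sequence_decay:
  fixes h :: "nat \<Rightarrow> real"
  assumes convex: "\<And>i. i < k \<Longrightarrow> 0 \<le> h i - 2 * h (Suc i) + h (Suc (Suc i))" and "0 \<le> h (Suc k)"
  shows "(real k + 1) * (h k - h (Suc k)) \<le> h 0"
proof -
  have "h k - h (Suc k) \<le> h i - h (Suc i)" if "i \<le> k" for i
    using that
  proof (induction rule: inc_induct)
    case (step i)
    then show ?case
      using convex[of i] by simp
  qed simp
  then have "(\<Sum>i\<le>k. h k - h (Suc k)) \<le> (\<Sum>i\<le>k. h i - h (Suc i))"
    by (intro sum_mono) auto
  also have "\<dots> = h 0 - h (Suc k)"
    by (simp add: sum_telescope)
  finally show ?thesis
    using assms(2) by (simp add: algebra_simps)
qed

locale weighted_walk =
  fixes m :: "'a::metric_space \<Rightarrow> real" and R :: real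
  assumes bg: "bounded_geometry TYPE('a)" and m: "\<And>x. 0 \<le> m x" and R: "0 \<le> R"
begin

text \<open>Symmetry makes the walk reversible. The value dominates \<open>m x\<close> for every
  \<open>y\<close> within distance \<open>R\<close>, so the variation in \<open>coarea\<close> is
  bounded by an edge sum; the case \<open>y = x\<close> is included and yields
  \<open>mass_le_degree\<close>.\<close>

definition conductance :: "'a \<Rightarrow> 'a \<Rightarrow> real" where
  "conductance x y = (if dist x y \<le> R then m x + m y else 0)"

definition degree :: "'a \<Rightarrow> real" where
  "degree x = (\<Sum>y\<in>cball x R. conductance x y)"

text \<open>The average of the identity and the walk with transition probabilities
  \<open>conductance x y / degree x\<close>. Where the degree is zero, division by zero removes the
  second summand.\<close>

definition step :: "('a \<Rightarrow> 'h::complex_hilbert) \<Rightarrow> 'a \<Rightarrow> 'h" where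
  "step \<xi> x = (1/2) *\<^sub>R \<xi> x + (\<Sum>y\<in>cball x R. (conductance x y / (2 * degree x)) *\<^sub>R \<xi> y)"

lemma conductance_nonneg: "0 \<le> conductance x y"
  using m by (simp add: conductance_def)

lemma conductance_commute: "conductance x y = conductance y x"
  by (simp add: conductance_def dist_commute)

lemma sum_conductance_le: "finite F \<Longrightarrow> (\<Sum>y\<in>F. conductance x y) \<le> degree x"
proof -
  assume F: "finite F"
  have "(\<Sum>y\<in>F. conductance x y) = (\<Sum>y\<in>F \<inter> cball x R. conductance x y)"
    using F by (intro sum.mono_neutral_right) (auto simp: conductance_def)
  also have "\<dots> \<le> degree x"
    unfolding degree_def using finite_cball[OF bg] conductance_nonneg by (intro sum_mono2) auto
  finally show ?thesis .
qed

lemma conductance_le_degree: "conductance x y \<le> degree x" "conductance x y \<le> degree y"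
  using sum_conductance_le[of "{y}" x] sum_conductance_le[of "{x}" y] conductance_commute[of x y] by auto

lemma degree_nonneg: "0 \<le> degree x"
  unfolding degree_def using conductance_nonneg by (intro sum_nonneg)

lemma mass_le_degree: "m x \<le> degree x"
  using conductance_le_degree(1)[of x x] m[of x] R by (simp add: conductance_def)

lemma conductance_eq_0: "degree x = 0 \<or> degree y = 0 \<Longrightarrow> conductance x y = 0"
  using conductance_le_degree[of x y] conductance_nonneg[of x y] by auto

lemma step_add: "step (\<lambda>x. \<xi> x + \<eta> x) = (\<lambda>x. step \<xi> x + step \<eta> x)"
  by (auto simp: step_def scaleR_add_right sum.distrib)

lemma step_diff: "step (\<lambda>x. \<xi> x - \<eta> x) = (\<lambda>x. step \<xi> x - step \<eta> x)"
  by (auto simp: step_def scaleR_diff_right sum_subtractf)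

lemma step_scaleC: "step (\<lambda>x. c *\<^sub>C \<xi> x) = (\<lambda>x. c *\<^sub>C step \<xi> x)"
  by (auto simp: step_def scaleC_add_right scaleC_sum_right scaleC_scaleR)

lemma funpow_step_add: "(step ^^ n) (\<lambda>x. \<xi> x + \<eta> x) = (\<lambda>x. (step ^^ n) \<xi> x + (step ^^ n) \<eta> x)"
  by (induction n) (simp_all add: step_add)

lemma funpow_step_scaleC: "(step ^^ n) (\<lambda>x. c *\<^sub>C \<xi> x) = (\<lambda>x. c *\<^sub>C (step ^^ n) \<xi> x)"
  by (induction n) (simp_all add: step_scaleC)

lemma step_eq_0: "\<xi> x = 0 \<Longrightarrow> degree x = 0 \<Longrightarrow> step \<xi> x = 0"
  by (simp add: step_def)

lemma step_support:
  assumes "\<And>x. \<xi> x \<noteq> 0 \<Longrightarrow> dist x0 x \<le> r" "step \<xi> x \<noteq> 0"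
  shows "dist x0 x \<le> r + R"
proof (rule ccontr)
  assume far: "\<not> ?thesis"
  have "\<xi> y = 0" if "dist x y \<le> R" for y
    using assms(1)[of y] far that dist_triangle[of x0 x y] by (auto simp: dist_commute)
  then have "step \<xi> x = 0"
    using R by (simp add: step_def)
  then show False
    using assms(2) by simp
qed

lemma funpow_step_support:
  assumes "\<And>x. \<xi> x \<noteq> 0 \<Longrightarrow> dist x0 x \<le> r" "(step ^^ n) \<xi> x \<noteq> 0"
  shows "dist x0 x \<le> r + real n * R"
  using assms(2)
proof (induction n arbitrary: x)
  case (Suc n)
  have "dist x0 x \<le> (r + real n * R) + R"
    using Suc by (intro step_support[of "(step ^^ n) \<xi>"]) auto
  then show ?case
    by (simp add: algebra_simps)
qed (use assms(1) in auto)

text \<open>Convexity of the squared norm, used for the average of staying and moving and for the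
  transition probabilities; the latter is Cauchy-Schwarz with each \<open>p y\<close> split into two
  square roots.\<close>

lemma degree_norm_step_le:
  "degree x * (norm (step \<xi> x))\<^sup>2 \<le>
    degree x * (norm (\<xi> x))\<^sup>2 / 2 + (\<Sum>y\<in>cball x R. conductance x y * (norm (\<xi> y))\<^sup>2) / 2"
proof (cases "degree x = 0")
  case True
  then show ?thesis
    using conductance_nonneg by (auto intro!: sum_nonneg)
next
  case False
  then have d: "0 < degree x"
    using degree_nonneg[of x] by simp
  define p where "p y = conductance x y / degree x" for y
  have p: "0 \<le> p y" "sum p (cball x R) = 1" for y
    using d conductance_nonneg by (auto simp: p_def sum_divide_distrib[symmetric] degree_def[symmetric])
  define v where "v = (\<Sum>y\<in>cball x R. p y *\<^sub>R \<xi> y)"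
  have "norm v \<le> (\<Sum>y\<in>cball x R. sqrt (p y) * (sqrt (p y) * norm (\<xi> y)))"
    unfolding v_def using p by (intro sum_norm_le) (auto simp: mult.assoc[symmetric])
  then have "(norm v)\<^sup>2 \<le> (\<Sum>y\<in>cball x R. sqrt (p y) * (sqrt (p y) * norm (\<xi> y)))\<^sup>2"
    by (intro power_mono) auto
  also have "\<dots> \<le> (\<Sum>y\<in>cball x R. (sqrt (p y))\<^sup>2) * (\<Sum>y\<in>cball x R. (sqrt (p y) * norm (\<xi> y))\<^sup>2)"
    by (rule Cauchy_Schwarz_ineq_sum)
  also have "\<dots> = (\<Sum>y\<in>cball x R. p y * (norm (\<xi> y))\<^sup>2)"
    using p by (simp add: power_mult_distrib)
  finally have v: "(norm v)\<^sup>2 \<le> (\<Sum>y\<in>cball x R. p y * (norm (\<xi> y))\<^sup>2)" .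
  have "step \<xi> x = (1/2) *\<^sub>R (\<xi> x + v)"
    by (simp add: step_def v_def p_def scaleR_add_right scaleR_sum_right)
  then have "(norm (step \<xi> x))\<^sup>2 = (norm (\<xi> x - (- v)))\<^sup>2 / 4"
    by (simp add: power_divide)
  also have "\<dots> \<le> (2 * (norm (\<xi> x))\<^sup>2 + 2 * (norm (- v))\<^sup>2) / 4"
    by (intro divide_right_mono power2_norm_diff_le) simp
  also have "\<dots> \<le> (norm (\<xi> x))\<^sup>2 / 2 + (\<Sum>y\<in>cball x R. p y * (norm (\<xi> y))\<^sup>2) / 2"
    using v by simp
  finally have "degree x * (norm (step \<xi> x))\<^sup>2 \<le>
      degree x * ((norm (\<xi> x))\<^sup>2 / 2 + (\<Sum>y\<in>cball x R. p y * (norm (\<xi> y))\<^sup>2) / 2)"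
    using d by (intro mult_left_mono) auto
  also have "\<dots> = degree x * (norm (\<xi> x))\<^sup>2 / 2 + (\<Sum>y\<in>cball x R. conductance x y * (norm (\<xi> y))\<^sup>2) / 2"
    using d by (simp add: distrib_left sum_distrib_left p_def)
  finally show ?thesis .
qed

text \<open>Contractivity on finite sums: after exchanging the order of summation, the conductances
  at each \<open>y\<close> add up to at most its degree. \<open>G\<close> is the region reached from
  \<open>F\<close> in one move.\<close>

lemma sum_step_le:
  assumes F: "finite F"
  obtains G where "finite G"
    "(\<Sum>x\<in>F. degree x * (norm (step \<xi> x))\<^sup>2) \<le> (\<Sum>x\<in>G. degree x * (norm (\<xi> x))\<^sup>2)"
proof
  define G where "G = F \<union> (\<Union>x\<in>F. cball x R)"
  show G: "finite G"
    using F finite_cball[OF bg] by (simp add: G_def)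
  have "(\<Sum>x\<in>F. \<Sum>y\<in>cball x R. conductance x y * (norm (\<xi> y))\<^sup>2) \<le> (\<Sum>x\<in>F. \<Sum>y\<in>G. conductance x y * (norm (\<xi> y))\<^sup>2)"
    using G conductance_nonneg by (intro sum_mono sum_mono2) (auto simp: G_def)
  also have "\<dots> = (\<Sum>y\<in>G. (\<Sum>x\<in>F. conductance y x) * (norm (\<xi> y))\<^sup>2)"
    by (subst sum.swap) (simp add: sum_distrib_right conductance_commute)
  also have "\<dots> \<le> (\<Sum>y\<in>G. degree y * (norm (\<xi> y))\<^sup>2)"
    using F by (intro sum_mono mult_right_mono sum_conductance_le) auto
  finally have 1: "(\<Sum>x\<in>F. \<Sum>y\<in>cball x R. conductance x y * (norm (\<xi> y))\<^sup>2) \<le> (\<Sum>y\<in>G. degree y * (norm (\<xi> y))\<^sup>2)" .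
  have 2: "(\<Sum>x\<in>F. degree x * (norm (\<xi> x))\<^sup>2) \<le> (\<Sum>x\<in>G. degree x * (norm (\<xi> x))\<^sup>2)"
    using G degree_nonneg by (intro sum_mono2) (auto simp: G_def)
  have "(\<Sum>x\<in>F. degree x * (norm (step \<xi> x))\<^sup>2) \<le>
     (\<Sum>x\<in>F. degree x * (norm (\<xi> x))\<^sup>2 / 2 + (\<Sum>y\<in>cball x R. conductance x y * (norm (\<xi> y))\<^sup>2) / 2)"
    by (intro sum_mono degree_norm_step_le)
  also have "\<dots> = (\<Sum>x\<in>F. degree x * (norm (\<xi> x))\<^sup>2) / 2 + (\<Sum>x\<in>F. \<Sum>y\<in>cball x R. conductance x y * (norm (\<xi> y))\<^sup>2) / 2"
    by (simp add: sum.distrib sum_divide_distrib)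
  also have "\<dots> \<le> (\<Sum>x\<in>G. degree x * (norm (\<xi> x))\<^sup>2)"
    using 1 2 by simp
  finally show "(\<Sum>x\<in>F. degree x * (norm (step \<xi> x))\<^sup>2) \<le> (\<Sum>x\<in>G. degree x * (norm (\<xi> x))\<^sup>2)" .
qed

section \<open>Quadratic forms of the walk and decay of energy\<close>

definition form :: "'a set \<Rightarrow> ('a \<Rightarrow> 'h::complex_hilbert) \<Rightarrow> ('a \<Rightarrow> 'h) \<Rightarrow> real" where
  "form F \<xi> \<eta> = (\<Sum>x\<in>F. degree x * re_inner (\<xi> x) (\<eta> x))"

text \<open>For functions supported in \<open>F\<close> this is the form of the walk without
  laziness: multiplying by the degree cancels the denominator of the transition probabilities, and a
  manifestly symmetric sum remains.\<close>

definition walk_form :: "'a set \<Rightarrow> ('a \<Rightarrow> 'h::complex_hilbert) \<Rightarrow> ('a \<Rightarrow> 'h) \<Rightarrow> real" where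
  "walk_form F \<xi> \<eta> = (\<Sum>x\<in>F. \<Sum>y\<in>F. conductance x y * re_inner (\<xi> y) (\<eta> x))"

lemma form_self: "form F \<xi> \<xi> = (\<Sum>x\<in>F. degree x * (norm (\<xi> x))\<^sup>2)"
  by (simp add: form_def re_inner_self)

lemma form_commute: "form F \<xi> \<eta> = form F \<eta> \<xi>"
  by (simp add: form_def re_inner_commute)

lemma form_diff_left: "form F (\<lambda>x. \<xi> x - \<zeta> x) \<eta> = form F \<xi> \<eta> - form F \<zeta> \<eta>"
  by (simp add: form_def re_inner_diff_left right_diff_distrib sum_subtractf)

lemma form_diff_right: "form F \<eta> (\<lambda>x. \<xi> x - \<zeta> x) = form F \<eta> \<xi> - form F \<eta> \<zeta>"
  by (simp add: form_def re_inner_diff_right right_diff_distrib sum_subtractf)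

lemma walk_form_commute: "walk_form F \<xi> \<eta> = walk_form F \<eta> \<xi>"
  unfolding walk_form_def by (subst sum.swap) (simp add: re_inner_commute conductance_commute)

lemma form_step:
  assumes F: "finite F" and supp: "\<And>x. x \<notin> F \<Longrightarrow> \<xi> x = 0"
  shows "form F (step \<xi>) \<eta> = (form F \<xi> \<eta> + walk_form F \<xi> \<eta>) / 2"
proof -
  have "degree x * re_inner (step \<xi> x) (\<eta> x) =
      degree x * re_inner (\<xi> x) (\<eta> x) / 2 + (\<Sum>y\<in>F. conductance x y * re_inner (\<xi> y) (\<eta> x)) / 2" for x
  proof -
    have "(\<Sum>y\<in>cball x R. (conductance x y / (2 * degree x)) *\<^sub>R \<xi> y) = (\<Sum>y\<in>F. (conductance x y / (2 * degree x)) *\<^sub>R \<xi> y)"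
      using finite_cball[OF bg] F supp
      by (intro sum.mono_neutral_cong) (auto simp: conductance_def)
    then have "re_inner (step \<xi> x) (\<eta> x) = re_inner (\<xi> x) (\<eta> x) / 2 +
        (\<Sum>y\<in>F. conductance x y / (2 * degree x) * re_inner (\<xi> y) (\<eta> x))"
      by (simp add: step_def re_inner_add_left re_inner_scaleR_left re_inner_sum_left)
    then have "degree x * re_inner (step \<xi> x) (\<eta> x) = degree x * re_inner (\<xi> x) (\<eta> x) / 2 +
        (\<Sum>y\<in>F. degree x * (conductance x y / (2 * degree x) * re_inner (\<xi> y) (\<eta> x)))"
      by (simp only: distrib_left sum_distrib_left times_divide_eq_right)
    also have "(\<Sum>y\<in>F. degree x * (conductance x y / (2 * degree x) * re_inner (\<xi> y) (\<eta> x))) =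
        (\<Sum>y\<in>F. conductance x y * re_inner (\<xi> y) (\<eta> x) / 2)"
      using conductance_eq_0[of x] by (intro sum.cong) auto
    finally show ?thesis
      by (simp add: sum_divide_distrib)
  qed
  then show ?thesis
    by (simp add: form_def walk_form_def sum.distrib sum_divide_distrib add_divide_distrib)
qed

lemma form_step_commute:
  assumes "finite F" "\<And>x. x \<notin> F \<Longrightarrow> \<xi> x = 0" "\<And>x. x \<notin> F \<Longrightarrow> \<eta> x = 0"
  shows "form F (step \<xi>) \<eta> = form F \<xi> (step \<eta>)"
proof -
  have "form F (step \<xi>) \<eta> = (form F \<xi> \<eta> + walk_form F \<xi> \<eta>) / 2"
    "form F (step \<eta>) \<xi> = (form F \<eta> \<xi> + walk_form F \<eta> \<xi>) / 2"
    using assms by (simp_all add: form_step)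
  then show ?thesis
    using form_commute[of F \<xi> "step \<eta>"] form_commute[of F \<eta> \<xi>] walk_form_commute[of F \<eta> \<xi>] by simp
qed

lemma sum_conductance_norm_le:
  assumes "finite F"
  shows "(\<Sum>x\<in>F. \<Sum>y\<in>F. conductance x y * ((norm (\<xi> x))\<^sup>2 + (norm (\<xi> y))\<^sup>2)) \<le> 2 * form F \<xi> \<xi>"
proof -
  have "(\<Sum>x\<in>F. \<Sum>y\<in>F. conductance x y * (norm (\<xi> x))\<^sup>2) \<le> form F \<xi> \<xi>"
    unfolding form_self sum_distrib_right[symmetric]
    by (intro sum_mono mult_right_mono sum_conductance_le assms) auto
  moreover have "(\<Sum>x\<in>F. \<Sum>y\<in>F. conductance x y * (norm (\<xi> y))\<^sup>2) = (\<Sum>x\<in>F. \<Sum>y\<in>F. conductance x y * (norm (\<xi> x))\<^sup>2)"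
    by (subst sum.swap) (simp add: conductance_commute)
  ultimately show ?thesis
    by (simp add: distrib_left sum.distrib)
qed

text \<open>Expand the sum of \<open>conductance x y * (norm (\<xi> y + \<xi> x))\<^sup>2\<close>.
  The non-lazy walk need not be positive; the identity added by laziness compensates exactly for its
  lower bound.\<close>

lemma form_step_nonneg:
  assumes "finite F" "\<And>x. x \<notin> F \<Longrightarrow> \<xi> x = 0"
  shows "0 \<le> form F (step \<xi>) \<xi>"
proof -
  have "0 \<le> (\<Sum>x\<in>F. \<Sum>y\<in>F. conductance x y * (norm (\<xi> y + \<xi> x))\<^sup>2)"
    using conductance_nonneg by (intro sum_nonneg) auto
  also have "\<dots> = (\<Sum>x\<in>F. \<Sum>y\<in>F. conductance x y * ((norm (\<xi> x))\<^sup>2 + (norm (\<xi> y))\<^sup>2)) + 2 * walk_form F \<xi> \<xi>"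
    unfolding power2_norm_add walk_form_def by (simp add: distrib_left sum.distrib sum_distrib_left algebra_simps)
  finally show ?thesis
    using sum_conductance_norm_le[OF assms(1), of \<xi>] by (simp add: form_step[OF assms])
qed

lemma energy_le:
  assumes "finite F" "\<And>x. x \<notin> F \<Longrightarrow> \<xi> x = 0"
  shows "(\<Sum>x\<in>F. \<Sum>y\<in>F. conductance x y * (norm (\<xi> y - \<xi> x))\<^sup>2) \<le> 4 * (form F \<xi> \<xi> - form F (step \<xi>) \<xi>)"
proof -
  have "(\<Sum>x\<in>F. \<Sum>y\<in>F. conductance x y * (norm (\<xi> y - \<xi> x))\<^sup>2) =
      (\<Sum>x\<in>F. \<Sum>y\<in>F. conductance x y * ((norm (\<xi> x))\<^sup>2 + (norm (\<xi> y))\<^sup>2)) - 2 * walk_form F \<xi> \<xi>"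
    unfolding power2_norm_diff walk_form_def by (simp add: distrib_left right_diff_distrib sum.distrib sum_subtractf sum_distrib_left algebra_simps)
  moreover have "2 * form F (step \<xi>) \<xi> = form F \<xi> \<xi> + walk_form F \<xi> \<xi>"
    by (simp add: form_step[OF assms])
  moreover have "e \<le> 4 * (i - s)" if "e = d - 2 * w" "2 * s = i + w" "d \<le> 2 * i" for e d w i s :: real
    using that by simp
  ultimately show ?thesis
    using sum_conductance_norm_le[OF assms(1), of \<xi>] by blast
qed

text \<open>Self-adjointness carries the steps across one at a time; \<open>F\<close> must hold the
  supports of all iterates up to \<open>N\<close>, since \<open>form\<close> is truncated to
  \<open>F\<close>.\<close>

lemma form_funpow_step:
  assumes F: "finite F" and supp: "\<And>k x. k \<le> N \<Longrightarrow> x \<notin> F \<Longrightarrow> (step ^^ k) \<zeta> x = 0" and "i + j \<le> N"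
  shows "form F ((step ^^ i) \<zeta>) ((step ^^ j) \<zeta>) = form F \<zeta> ((step ^^ (i + j)) \<zeta>)"
  using assms(3)
proof (induction i arbitrary: j)
  case (Suc i)
  have "form F (step ((step ^^ i) \<zeta>)) ((step ^^ j) \<zeta>) = form F ((step ^^ i) \<zeta>) (step ((step ^^ j) \<zeta>))"
    using Suc.prems by (intro form_step_commute F supp) auto
  then show ?case
    using Suc.IH[of "Suc j"] Suc.prems by simp
qed simp

text \<open>By self-adjointness the numbers \<open>\<langle>P\<^sup>i \<zeta>, P\<^sup>j \<zeta>\<rangle>\<close> depend on \<open>i + j\<close> only, and since \<open>P\<close> is positive
  they form a convex sequence; its increments therefore decay.\<close>

lemma energy_decay:
  assumes F: "finite F" and supp: "\<And>k x. k \<le> 2 * n + 2 \<Longrightarrow> x \<notin> F \<Longrightarrow> (step ^^ k) \<zeta> x = 0"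
  shows "(2 * real n + 1) * (form F ((step ^^ n) \<zeta>) ((step ^^ n) \<zeta>) - form F (step ((step ^^ n) \<zeta>)) ((step ^^ n) \<zeta>))
     \<le> form F \<zeta> \<zeta>"
proof -
  define h where "h k = form F \<zeta> ((step ^^ k) \<zeta>)" for k
  have h: "form F ((step ^^ i) \<zeta>) ((step ^^ j) \<zeta>) = h (i + j)" if "i + j \<le> 2 * n + 2" for i j
    unfolding h_def by (rule form_funpow_step[OF F supp that]) auto
  have convex: "0 \<le> h i - 2 * h (Suc i) + h (Suc (Suc i))" if "i < 2 * n" for i
  proof -
    \<comment> \<open>The second difference of \<open>h\<close> at \<open>i\<close> is the form of
      \<delta> with itself when \<open>i\<close> is even, and of \<open>step \<delta>\<close> with
      \<delta> when \<open>i\<close> is odd. Both are non-negative, the latter because of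
      laziness.\<close>
    define j where "j = i div 2"
    define \<delta> where "\<delta> = (\<lambda>x. (step ^^ j) \<zeta> x - (step ^^ Suc j) \<zeta> x)"
    have step_\<delta>: "step \<delta> = (\<lambda>x. (step ^^ Suc j) \<zeta> x - (step ^^ Suc (Suc j)) \<zeta> x)"
      by (simp add: \<delta>_def step_diff)
    have \<delta>: "\<delta> x = 0" if "x \<notin> F" for x
      using supp[of j x] supp[of "Suc j" x] that \<open>i < 2 * n\<close> by (simp add: \<delta>_def j_def)
    consider "i = j + j" | "i = Suc (j + j)"
      unfolding j_def by linarith
    then show ?thesis
    proof cases
      case 1
      have "0 \<le> form F \<delta> \<delta>"
        unfolding form_self using degree_nonneg by (intro sum_nonneg) auto
      also have "\<dots> = h (j + j) - h (j + Suc j) - (h (Suc j + j) - h (Suc j + Suc j))"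
        using that 1 unfolding \<delta>_def form_diff_left form_diff_right
        by (subst (1 2 3 4) h) auto
      finally show ?thesis
        using 1 by simp
    next
      case 2
      have "0 \<le> form F (step \<delta>) \<delta>"
        by (rule form_step_nonneg[OF F \<delta>])
      also have "\<dots> = h (Suc j + j) - h (Suc j + Suc j) - (h (Suc (Suc j) + j) - h (Suc (Suc j) + Suc j))"
        using that 2 unfolding step_\<delta> unfolding \<delta>_def form_diff_left form_diff_right
        by (subst (1 2 3 4) h) auto
      finally show ?thesis
        using 2 by simp
    qed
  qed
  have h_0: "h 0 = form F \<zeta> \<zeta>"
    by (simp add: h_def)
  have step_n: "form F (step ((step ^^ n) \<zeta>)) ((step ^^ n) \<zeta>) = h (Suc (2 * n))"
    using h[of "Suc n" n] unfolding mult_2 by simp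
  have h_n: "form F ((step ^^ n) \<zeta>) ((step ^^ n) \<zeta>) = h (2 * n)"
    unfolding mult_2 by (rule h) simp
  have "(real (2 * n) + 1) * (h (2 * n) - h (Suc (2 * n))) \<le> h 0"
  proof (rule convex_sequence_decay)
    show "0 \<le> h (Suc (2 * n))"
      unfolding step_n[symmetric] by (intro form_step_nonneg F supp) auto
  qed (rule convex)
  then show ?thesis
    unfolding step_n h_n h_0 by simp
qed

text \<open>Cheeger's argument: \<open>coarea\<close> for the squared norm of \<xi>, whose
  increments factor into a difference and a sum of norms. Cauchy-Schwarz over pairs of points then
  separates the energy, at most 4 times
  \<open>form F \<xi> \<xi> - form F (step \<xi>) \<xi>\<close>, from a term of at most
  \<open>4 * form F \<xi> \<xi>\<close>.\<close>

lemma mass_form_le: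
  assumes F: "finite F" and e: "0 \<le> \<epsilon>" and S: "0 \<le> S"
    and iso: "\<And>E. finite E \<Longrightarrow> E \<noteq> {} \<Longrightarrow> diam_le E S \<Longrightarrow> \<epsilon> * sum m E \<le> sum m (outer_boundary R E)"
    and diam: "\<And>x y. \<xi> x \<noteq> 0 \<Longrightarrow> \<xi> y \<noteq> 0 \<Longrightarrow> dist x y \<le> S"
    and supp: "\<And>x y. \<xi> x \<noteq> 0 \<Longrightarrow> dist x y \<le> R \<Longrightarrow> y \<in> F"
  shows "(\<epsilon> * (\<Sum>x\<in>F. m x * (norm (\<xi> x))\<^sup>2))\<^sup>2 \<le> 16 * (form F \<xi> \<xi> - form F (step \<xi>) \<xi>) * form F \<xi> \<xi>"
proof -
  define g where "g x = (norm (\<xi> x))\<^sup>2" for x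
  have supp0: "\<xi> x = 0" if "x \<notin> F" for x
    using supp[of x x] R that by auto
  have g_diff: "\<bar>g y - g x\<bar> \<le> norm (\<xi> y - \<xi> x) * (norm (\<xi> x) + norm (\<xi> y))" for x y
  proof -
    have "\<bar>g y - g x\<bar> = \<bar>norm (\<xi> y) - norm (\<xi> x)\<bar> * (norm (\<xi> x) + norm (\<xi> y))"
    proof -
      have "g y - g x = (norm (\<xi> y) - norm (\<xi> x)) * (norm (\<xi> x) + norm (\<xi> y))"
        by (simp add: g_def power2_eq_square algebra_simps)
      then show ?thesis
        by (simp add: abs_mult)
    qed
    also have "\<dots> \<le> norm (\<xi> y - \<xi> x) * (norm (\<xi> x) + norm (\<xi> y))"
      by (intro mult_right_mono norm_triangle_ineq3) auto
    finally show ?thesis .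
  qed
  have "\<epsilon> * (\<Sum>x\<in>F. m x * g x) \<le> (\<Sum>x\<in>F. m x * (\<Sum>y\<in>cball x R. \<bar>g y - g x\<bar>))"
    by (rule coarea[OF bg, where S = S]) (use assms m R in \<open>auto simp: g_def\<close>)
  also have "\<dots> \<le> (\<Sum>x\<in>F. \<Sum>y\<in>F. conductance x y * \<bar>g y - g x\<bar>)"
  proof (rule sum_mono)
    fix x
    \<comment> \<open>If \<open>x\<close> has a neighbour outside \<open>F\<close>, then \<xi>
      vanishes at both, so truncation to \<open>F\<close> loses no variation.\<close>
    have "g y = g x" if "y \<in> cball x R" "y \<notin> F" for y
      using supp[of x y] supp0[of y] that by (auto simp: g_def)
    then have "(\<Sum>y\<in>cball x R. \<bar>g y - g x\<bar>) = (\<Sum>y\<in>cball x R \<inter> F. \<bar>g y - g x\<bar>)"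
      using finite_cball[OF bg] by (intro sum.mono_neutral_right) auto
    then have "m x * (\<Sum>y\<in>cball x R. \<bar>g y - g x\<bar>) = (\<Sum>y\<in>cball x R \<inter> F. m x * \<bar>g y - g x\<bar>)"
      by (simp add: sum_distrib_left)
    also have "\<dots> \<le> (\<Sum>y\<in>cball x R \<inter> F. conductance x y * \<bar>g y - g x\<bar>)"
      using m by (intro sum_mono mult_right_mono) (auto simp: conductance_def)
    also have "\<dots> \<le> (\<Sum>y\<in>F. conductance x y * \<bar>g y - g x\<bar>)"
      using F conductance_nonneg by (intro sum_mono2) auto
    finally show "m x * (\<Sum>y\<in>cball x R. \<bar>g y - g x\<bar>) \<le> (\<Sum>y\<in>F. conductance x y * \<bar>g y - g x\<bar>)" .
  qed
  also have "\<dots> \<le> (\<Sum>x\<in>F. \<Sum>y\<in>F. (sqrt (conductance x y) * norm (\<xi> y - \<xi> x)) * (sqrt (conductance x y) * (norm (\<xi> x) + norm (\<xi> y))))"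
  proof (intro sum_mono)
    fix x y
    have "conductance x y * \<bar>g y - g x\<bar> \<le> conductance x y * (norm (\<xi> y - \<xi> x) * (norm (\<xi> x) + norm (\<xi> y)))"
      by (intro mult_left_mono g_diff conductance_nonneg)
    also have "\<dots> = (sqrt (conductance x y) * sqrt (conductance x y)) * (norm (\<xi> y - \<xi> x) * (norm (\<xi> x) + norm (\<xi> y)))"
      using conductance_nonneg by simp
    finally show "conductance x y * \<bar>g y - g x\<bar> \<le>
      (sqrt (conductance x y) * norm (\<xi> y - \<xi> x)) * (sqrt (conductance x y) * (norm (\<xi> x) + norm (\<xi> y)))"
      by (simp only: mult_ac)
  qed
  also have "\<dots> = (\<Sum>z\<in>F\<times>F. (sqrt (conductance (fst z) (snd z)) * norm (\<xi> (snd z) - \<xi> (fst z))) *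
      (sqrt (conductance (fst z) (snd z)) * (norm (\<xi> (fst z)) + norm (\<xi> (snd z)))))"
    unfolding sum.cartesian_product case_prod_beta by (rule refl)
  finally have "(\<epsilon> * (\<Sum>x\<in>F. m x * g x))\<^sup>2 \<le> (\<Sum>z\<in>F\<times>F. (sqrt (conductance (fst z) (snd z)) * norm (\<xi> (snd z) - \<xi> (fst z))) *
      (sqrt (conductance (fst z) (snd z)) * (norm (\<xi> (fst z)) + norm (\<xi> (snd z)))))\<^sup>2"
    using e m by (intro power_mono) (auto intro!: mult_nonneg_nonneg sum_nonneg simp: g_def)
  also have "\<dots> \<le> (\<Sum>z\<in>F\<times>F. (sqrt (conductance (fst z) (snd z)) * norm (\<xi> (snd z) - \<xi> (fst z)))\<^sup>2) *
      (\<Sum>z\<in>F\<times>F. (sqrt (conductance (fst z) (snd z)) * (norm (\<xi> (fst z)) + norm (\<xi> (snd z))))\<^sup>2)"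
    by (rule Cauchy_Schwarz_ineq_sum)
  also have "\<dots> = (\<Sum>x\<in>F. \<Sum>y\<in>F. conductance x y * (norm (\<xi> y - \<xi> x))\<^sup>2) *
      (\<Sum>x\<in>F. \<Sum>y\<in>F. conductance x y * (norm (\<xi> x) + norm (\<xi> y))\<^sup>2)"
    unfolding sum.cartesian_product case_prod_beta power_mult_distrib using conductance_nonneg by simp
  also have "\<dots> \<le> (4 * (form F \<xi> \<xi> - form F (step \<xi>) \<xi>)) * (4 * form F \<xi> \<xi>)"
  proof (intro mult_mono energy_le F supp0)
    have "(\<Sum>x\<in>F. \<Sum>y\<in>F. conductance x y * (norm (\<xi> x) + norm (\<xi> y))\<^sup>2) \<le>
        (\<Sum>x\<in>F. \<Sum>y\<in>F. 2 * (conductance x y * ((norm (\<xi> x))\<^sup>2 + (norm (\<xi> y))\<^sup>2)))"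
    proof (intro sum_mono)
      fix x y
      have "(norm (\<xi> x) + norm (\<xi> y))\<^sup>2 \<le> 2 * ((norm (\<xi> x))\<^sup>2 + (norm (\<xi> y))\<^sup>2)"
        using sum_squares_bound[of "norm (\<xi> x)" "norm (\<xi> y)"] by (simp add: power2_sum)
      from mult_left_mono[OF this conductance_nonneg[of x y]]
      show "conductance x y * (norm (\<xi> x) + norm (\<xi> y))\<^sup>2 \<le> 2 * (conductance x y * ((norm (\<xi> x))\<^sup>2 + (norm (\<xi> y))\<^sup>2))"
        by (simp only: mult.left_commute)
    qed
    also have "\<dots> \<le> 4 * form F \<xi> \<xi>"
      using sum_conductance_norm_le[OF F, of \<xi>] by (simp add: sum_distrib_left[symmetric])
    finally show "(\<Sum>x\<in>F. \<Sum>y\<in>F. conductance x y * (norm (\<xi> x) + norm (\<xi> y))\<^sup>2) \<le> 4 * form F \<xi> \<xi>" .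
    have "0 \<le> (\<Sum>x\<in>F. \<Sum>y\<in>F. conductance x y * (norm (\<xi> y - \<xi> x))\<^sup>2)"
      using conductance_nonneg by (intro sum_nonneg) auto
    also have "\<dots> \<le> 4 * (form F \<xi> \<xi> - form F (step \<xi>) \<xi>)"
      by (rule energy_le[OF F supp0])
    finally show "0 \<le> 4 * (form F \<xi> \<xi> - form F (step \<xi>) \<xi>)" .
    show "0 \<le> (\<Sum>x\<in>F. \<Sum>y\<in>F. conductance x y * (norm (\<xi> x) + norm (\<xi> y))\<^sup>2)"
      using conductance_nonneg by (intro sum_nonneg) auto
  qed
  finally show ?thesis
    by (simp add: g_def algebra_simps)
qed

section \<open>The localized operator on the degree measure\<close>

definition walk_measure :: "'a measure" where
  "walk_measure = weight_measure degree"

text \<open>The factor turns the norm for the degree measure into the \<open>m\<close>-weighted norm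
  of the iterate, see \<open>degree_norm_walk_operator\<close>; it is at most 1, so the operator is
  a contraction.\<close>

definition walk_operator :: "nat \<Rightarrow> ('a \<Rightarrow> 'h::complex_hilbert) \<Rightarrow> 'a \<Rightarrow> 'h" where
  "walk_operator n \<xi> x = sqrt (m x / degree x) *\<^sub>R (step ^^ n) \<xi> x"

lemma sets_walk_measure: "sets walk_measure = sets borel"
  by (simp add: walk_measure_def sets_weight_measure[OF bg])

lemma emeasure_walk_measure: "emeasure walk_measure {x} = ennreal (degree x)"
  by (simp add: walk_measure_def emeasure_weight_measure_singleton)

lemma measure_walk_measure: "measure walk_measure {x} = degree x"
  using emeasure_walk_measure[of x] degree_nonneg[of x] by (simp add: measure_def)

lemma locally_finite_walk_measure: "locally_finite_measure walk_measure"
  unfolding locally_finite_measure_def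
proof
  fix x
  show "\<exists>U. open U \<and> x \<in> U \<and> emeasure walk_measure U < \<infinity>"
    using open_any[OF bg, of "{x}"] emeasure_walk_measure[of x] by (intro exI[of _ "{x}"]) auto
qed

lemmas walk_facts = bg sets_walk_measure locally_finite_walk_measure

lemma walk_L2_I:
  assumes "\<And>F. finite F \<Longrightarrow> (\<Sum>x\<in>F. degree x * (norm (\<xi> x))\<^sup>2) \<le> B" "\<And>x. degree x = 0 \<Longrightarrow> \<xi> x = (0::'h::complex_hilbert)"
  shows "\<xi> \<in> L2 walk_measure"
  by (rule L2_I[OF walk_facts]) (use assms in \<open>auto simp: measure_walk_measure\<close>)

lemma walk_L2_D: "\<xi> \<in> L2 walk_measure \<Longrightarrow> degree x = 0 \<Longrightarrow> \<xi> x = 0"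
  using L2_D[OF walk_facts] by (auto simp: measure_walk_measure)

lemma walk_sum_le: "\<xi> \<in> L2 walk_measure \<Longrightarrow> finite F \<Longrightarrow> (\<Sum>x\<in>F. degree x * (norm (\<xi> x))\<^sup>2) \<le> (L2_norm walk_measure \<xi>)\<^sup>2"
  using sum_le_L2_norm[OF walk_facts] by (simp add: measure_walk_measure)

lemma walk_L2_norm_leI:
  assumes "\<xi> \<in> L2 walk_measure" "\<And>F. finite F \<Longrightarrow> (\<Sum>x\<in>F. degree x * (norm (\<xi> x))\<^sup>2) \<le> B\<^sup>2" "0 \<le> B"
  shows "L2_norm walk_measure \<xi> \<le> B"
proof -
  have "(L2_norm walk_measure \<xi>)\<^sup>2 \<le> B\<^sup>2"
    by (rule L2_norm_leI[OF walk_facts assms(1)]) (use assms in \<open>auto simp: measure_walk_measure\<close>)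
  then show ?thesis
    using assms(3) power2_le_imp_le by blast
qed

lemma step_contraction:
  assumes "\<xi> \<in> L2 walk_measure"
  shows "step \<xi> \<in> L2 walk_measure" "L2_norm walk_measure (step \<xi>) \<le> L2_norm walk_measure \<xi>"
proof -
  have le: "(\<Sum>x\<in>F. degree x * (norm (step \<xi> x))\<^sup>2) \<le> (L2_norm walk_measure \<xi>)\<^sup>2" if F: "finite F" for F
  proof (rule sum_step_le[OF F])
    fix G assume "finite G"
      "(\<Sum>x\<in>F. degree x * (norm (step \<xi> x))\<^sup>2) \<le> (\<Sum>x\<in>G. degree x * (norm (\<xi> x))\<^sup>2)"
    then show ?thesis
      using walk_sum_le[OF assms] order_trans by blast
  qed
  show "step \<xi> \<in> L2 walk_measure"
    by (rule walk_L2_I[OF le]) (auto intro: step_eq_0 walk_L2_D[OF assms])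
  then show "L2_norm walk_measure (step \<xi>) \<le> L2_norm walk_measure \<xi>"
    by (rule walk_L2_norm_leI[OF _ le L2_norm_nonneg])
qed

lemma funpow_step_contraction:
  assumes "\<xi> \<in> L2 walk_measure"
  shows "(step ^^ n) \<xi> \<in> L2 walk_measure \<and> L2_norm walk_measure ((step ^^ n) \<xi>) \<le> L2_norm walk_measure \<xi>"
proof (induction n)
  case (Suc n)
  then show ?case
    using step_contraction[of "(step ^^ n) \<xi>"] by auto
qed (simp add: assms)

lemma degree_norm_walk_operator: "degree x * (norm (walk_operator n \<xi> x))\<^sup>2 = m x * (norm ((step ^^ n) \<xi> x))\<^sup>2"
proof (cases "degree x = 0")
  case True
  then show ?thesis
    using mass_le_degree[of x] m[of x] by simp
next
  case False
  then show ?thesis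
    using m[of x] degree_nonneg[of x] by (simp add: walk_operator_def power_mult_distrib)
qed

lemma norm_walk_operator_le: "norm (walk_operator n \<xi> x) \<le> norm ((step ^^ n) \<xi> x)"
proof -
  have "sqrt (m x / degree x) \<le> 1"
    using mass_le_degree[of x] m[of x] degree_nonneg[of x] by (auto simp: divide_le_eq_1 less_le)
  moreover have "0 \<le> sqrt (m x / degree x)"
    using m[of x] degree_nonneg[of x] by simp
  ultimately show ?thesis
    unfolding walk_operator_def norm_scaleR by (intro mult_left_le_one_le) auto
qed

lemma walk_operator_bounded:
  "L2_bounded_operator walk_measure (walk_operator n :: ('a \<Rightarrow> 'h::complex_hilbert) \<Rightarrow> 'a \<Rightarrow> 'h)"
  unfolding L2_bounded_operator_def
proof (intro conjI ballI allI exI[of _ 1])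
  fix \<xi> :: "'a \<Rightarrow> 'h" assume \<xi>: "\<xi> \<in> L2 walk_measure"
  note step_\<xi> = funpow_step_contraction[OF \<xi>, of n]
  show a\<xi>: "walk_operator n \<xi> \<in> L2 walk_measure"
    using step_\<xi> L2_dominated[OF walk_facts, of "(step ^^ n) \<xi>"] norm_walk_operator_le by blast
  have "L2_norm walk_measure (walk_operator n \<xi>) \<le> L2_norm walk_measure ((step ^^ n) \<xi>)"
  proof (rule walk_L2_norm_leI[OF a\<xi> _ L2_norm_nonneg])
    fix F :: "'a set" assume "finite F"
    have "(\<Sum>x\<in>F. degree x * (norm (walk_operator n \<xi> x))\<^sup>2) \<le> (\<Sum>x\<in>F. degree x * (norm ((step ^^ n) \<xi> x))\<^sup>2)"
      by (intro sum_mono mult_left_mono power_mono norm_walk_operator_le degree_nonneg norm_ge_zero)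
    also have "\<dots> \<le> (L2_norm walk_measure ((step ^^ n) \<xi>))\<^sup>2"
      using step_\<xi> \<open>finite F\<close> walk_sum_le by blast
    finally show "(\<Sum>x\<in>F. degree x * (norm (walk_operator n \<xi> x))\<^sup>2) \<le> (L2_norm walk_measure ((step ^^ n) \<xi>))\<^sup>2" .
  qed
  then show "L2_norm walk_measure (walk_operator n \<xi>) \<le> 1 * L2_norm walk_measure \<xi>"
    using step_\<xi> by simp
next
  fix \<xi> \<eta> :: "'a \<Rightarrow> 'h"
  show "walk_operator n (\<lambda>x. \<xi> x + \<eta> x) = (\<lambda>x. walk_operator n \<xi> x + walk_operator n \<eta> x)"
    by (auto simp: walk_operator_def funpow_step_add scaleR_add_right)
next
  fix c and \<xi> :: "'a \<Rightarrow> 'h"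
  show "walk_operator n (\<lambda>x. c *\<^sub>C \<xi> x) = (\<lambda>x. c *\<^sub>C walk_operator n \<xi> x)"
    by (auto simp: walk_operator_def funpow_step_scaleC scaleC_scaleR)
qed

lemma propagation_walk_operator:
  assumes "real n * R \<le> real r"
  shows "propagation walk_measure (walk_operator n :: ('a \<Rightarrow> 'h::complex_hilbert) \<Rightarrow> 'a \<Rightarrow> 'h) \<le> of_nat r"
  unfolding propagation_def
proof (rule Sup_least, clarify)
  fix y z assume "matrix_entry (walk_operator n :: ('a \<Rightarrow> 'h) \<Rightarrow> 'a \<Rightarrow> 'h) y z \<noteq> (\<lambda>h. 0)"
  then obtain h :: 'h where "(step ^^ n) (\<lambda>x. if x = z then h else 0) y \<noteq> 0"
    unfolding matrix_entry_def walk_operator_def by fastforce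
  then have "dist z y \<le> 0 + real n * R"
    by (rule funpow_step_support[rotated]) (auto split: if_splits)
  then show "ennreal (dist y z) \<le> of_nat r"
    using assms by (simp add: ennreal_of_nat_eq_real_of_nat dist_commute)
qed

text \<open>Constant up to the points of degree zero, where elements of \<open>L2\<close> must
  vanish.\<close>

definition const_vector :: "'h::complex_hilbert \<Rightarrow> 'a \<Rightarrow> 'h" where
  "const_vector h x = (if degree x = 0 then 0 else h)"

lemma step_const_vector: "step (const_vector h) = const_vector h"
proof
  fix x
  show "step (const_vector h) x = const_vector h x"
  proof (cases "degree x = 0")
    case False
    have "(\<Sum>y\<in>cball x R. (conductance x y / (2 * degree x)) *\<^sub>R const_vector h y) =
        (\<Sum>y\<in>cball x R. (conductance x y / (2 * degree x)) *\<^sub>R h)"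
      using conductance_eq_0[of x] by (intro sum.cong) (auto simp: const_vector_def)
    also have "\<dots> = (1/2) *\<^sub>R h"
      using False by (simp add: scaleR_sum_left[symmetric] sum_divide_distrib[symmetric] degree_def[symmetric])
    finally show ?thesis
      using False scaleR_add_left[of "1/2" "1/2" h] by (simp add: step_def const_vector_def)
  qed (simp add: step_def const_vector_def)
qed

text \<open>The constant vector is fixed by every power of the walk, which makes the bound
  independent of \<open>n\<close>. Its squared norm is at most the total degree \<open>2 * K\<close>
  times that of \<open>h\<close>, and its image keeps more than half of the squared norm of
  \<open>h\<close> on \<open>F0\<close>.\<close>

lemma onorm_walk_operator_ge:
  fixes h :: "'h::complex_hilbert" and K :: nat
  assumes h: "h \<noteq> 0" and le1: "\<And>F. finite F \<Longrightarrow> sum m F \<le> 1" and F0: "finite F0" "1/2 < sum m F0"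
    and K: "\<And>x::'a. card (cball x R) \<le> K"
  shows "1 \<le> 4 * real K * (L2_onorm walk_measure (walk_operator n :: ('a \<Rightarrow> 'h) \<Rightarrow> 'a \<Rightarrow> 'h))\<^sup>2"
proof -
  define a :: "('a \<Rightarrow> 'h) \<Rightarrow> 'a \<Rightarrow> 'h" where "a = walk_operator n"
  have a: "L2_bounded_operator walk_measure a"
    unfolding a_def by (rule walk_operator_bounded)
  define \<xi> where "\<xi> = const_vector h"
  \<comment> \<open>Each \<open>m x\<close> is counted at most \<open>K\<close> times as the first
    endpoint of a pair and at most \<open>K\<close> times as the second.\<close>
  have sum_deg: "sum degree F \<le> 2 * real K" if F: "finite F" for F
  proof -
    define G where "G = (\<Union>x\<in>F. cball x R)"
    have G: "finite G"
      using F finite_cball[OF bg] by (simp add: G_def)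
    have "sum degree F = (\<Sum>x\<in>F. \<Sum>y\<in>cball x R. m x) + (\<Sum>x\<in>F. \<Sum>y\<in>cball x R. m y)"
      by (simp add: degree_def conductance_def sum.distrib)
    also have "(\<Sum>x\<in>F. \<Sum>y\<in>cball x R. m x) \<le> (\<Sum>x\<in>F. real K * m x)"
      using K m by (auto intro!: sum_mono mult_right_mono)
    also have "\<dots> \<le> real K"
      using le1[OF F] by (simp add: sum_distrib_left[symmetric] mult_left_le)
    also have "(\<Sum>x\<in>F. \<Sum>y\<in>cball x R. m y) = (\<Sum>x\<in>F. \<Sum>y\<in>G. if dist x y \<le> R then m y else 0)"
      using G by (intro sum.cong sum.mono_neutral_cong_left) (auto simp: G_def)
    also have "\<dots> = (\<Sum>y\<in>G. \<Sum>x\<in>F. if dist x y \<le> R then m y else 0)"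
      by (rule sum.swap)
    also have "\<dots> \<le> (\<Sum>y\<in>G. real K * m y)"
    proof (rule sum_mono)
      fix y
      have "(\<Sum>x\<in>F. if dist x y \<le> R then m y else 0) \<le> (\<Sum>x\<in>cball y R. m y)"
        using F finite_cball[OF bg] m
        by (subst sum.inter_filter[symmetric]) (auto intro!: mult_right_mono card_mono simp: dist_commute)
      also have "\<dots> \<le> real K * m y"
        using K m by (auto intro!: mult_right_mono)
      finally show "(\<Sum>x\<in>F. if dist x y \<le> R then m y else 0) \<le> real K * m y" .
    qed
    also have "\<dots> \<le> real K"
      using le1[OF G] by (simp add: sum_distrib_left[symmetric] mult_left_le)
    finally show ?thesis
      by simp
  qed
  have sum_\<xi>: "(\<Sum>x\<in>F. degree x * (norm (\<xi> x))\<^sup>2) \<le> 2 * real K * (norm h)\<^sup>2" if F: "finite F" for F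
  proof -
    have "(\<Sum>x\<in>F. degree x * (norm (\<xi> x))\<^sup>2) = sum degree F * (norm h)\<^sup>2"
      unfolding sum_distrib_right by (intro sum.cong) (auto simp: \<xi>_def const_vector_def)
    also have "\<dots> \<le> 2 * real K * (norm h)\<^sup>2"
      by (intro mult_right_mono sum_deg F) simp
    finally show ?thesis .
  qed
  have \<xi>: "\<xi> \<in> L2 walk_measure"
    by (rule walk_L2_I[OF sum_\<xi>]) (auto simp: \<xi>_def const_vector_def)
  have \<xi>_norm: "(L2_norm walk_measure \<xi>)\<^sup>2 \<le> 2 * real K * (norm h)\<^sup>2"
    using sum_\<xi> by (intro L2_norm_leI[OF walk_facts \<xi>]) (simp add: measure_walk_measure)
  have fix_\<xi>: "(step ^^ n) \<xi> = \<xi>"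
    by (induction n) (auto simp: \<xi>_def step_const_vector)
  have "sum m F0 * (norm h)\<^sup>2 = (\<Sum>x\<in>F0. m x * (norm (\<xi> x))\<^sup>2)"
    unfolding sum_distrib_right
  proof (intro sum.cong)
    fix x
    show "m x * (norm h)\<^sup>2 = m x * (norm (\<xi> x))\<^sup>2"
      using mass_le_degree[of x] m[of x] by (auto simp: \<xi>_def const_vector_def)
  qed simp
  also have "\<dots> = (\<Sum>x\<in>F0. degree x * (norm (a \<xi> x))\<^sup>2)"
    by (simp add: a_def degree_norm_walk_operator fix_\<xi>)
  also have "\<dots> \<le> (L2_norm walk_measure (a \<xi>))\<^sup>2"
    by (intro walk_sum_le operator_closed[OF walk_facts a] \<xi> F0)
  finally have lower: "sum m F0 * (norm h)\<^sup>2 \<le> (L2_norm walk_measure (a \<xi>))\<^sup>2" .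
  have "(norm h)\<^sup>2 / 2 < sum m F0 * (norm h)\<^sup>2"
    using F0(2) h mult_strict_right_mono[of "1/2" "sum m F0" "(norm h)\<^sup>2"] by simp
  with lower have lower': "(norm h)\<^sup>2 / 2 < (L2_norm walk_measure (a \<xi>))\<^sup>2"
    by simp
  define N where "N = L2_onorm walk_measure a"
  have quot: "L2_norm walk_measure (a \<xi>) / L2_norm walk_measure \<xi> \<le> N"
    unfolding N_def L2_onorm_def by (rule cSUP_upper[OF \<xi> bdd_above_operator_quotients[OF walk_facts a]])
  have "L2_norm walk_measure (a \<xi>) \<noteq> 0"
    using lower' by (auto simp: not_less)
  \<comment> \<open>A zero denominator would make the quotient zero and hence useless; boundedness
    excludes it because the image is nonzero.\<close>
  have "L2_norm walk_measure \<xi> \<noteq> 0"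
  proof
    assume "L2_norm walk_measure \<xi> = 0"
    moreover obtain C where "0 \<le> C" "\<And>\<eta>. \<eta> \<in> L2 walk_measure \<Longrightarrow> L2_norm walk_measure (a \<eta>) \<le> C * L2_norm walk_measure \<eta>"
      using operator_bound[OF walk_facts a] by blast
    ultimately have "L2_norm walk_measure (a \<xi>) \<le> 0"
      using \<xi> by fastforce
    then show False
      using \<open>L2_norm walk_measure (a \<xi>) \<noteq> 0\<close> L2_norm_nonneg[of walk_measure "a \<xi>"] by simp
  qed
  then have "L2_norm walk_measure (a \<xi>) \<le> N * L2_norm walk_measure \<xi>"
    using quot L2_norm_nonneg[of walk_measure \<xi>] by (simp add: divide_le_eq)
  then have "(L2_norm walk_measure (a \<xi>))\<^sup>2 \<le> (N * L2_norm walk_measure \<xi>)\<^sup>2"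
    by (intro power_mono L2_norm_nonneg)
  also have "\<dots> \<le> N\<^sup>2 * (2 * real K * (norm h)\<^sup>2)"
    unfolding power_mult_distrib by (intro mult_left_mono \<xi>_norm) simp
  finally have "(norm h)\<^sup>2 / 2 < N\<^sup>2 * (2 * real K * (norm h)\<^sup>2)"
    using lower' by simp
  then have "1 * (norm h)\<^sup>2 < 4 * real K * N\<^sup>2 * (norm h)\<^sup>2"
    by (simp add: field_simps)
  then have "1 < 4 * real K * N\<^sup>2"
    by (rule mult_right_less_imp_less) simp
  then show ?thesis
    by (simp add: N_def a_def)
qed

text \<open>Decay of energy is combined with Cheeger's argument for \<eta>, the \<open>n\<close>-th
  iterate, which is still supported in a ball of radius \<open>r + n R\<close>: small energy leaves
  little \<open>m\<close>-mass, which is the squared norm of the image.\<close>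

lemma walk_operator_localized_le:
  fixes \<zeta> :: "'a \<Rightarrow> 'h::complex_hilbert"
  assumes \<zeta>: "\<zeta> \<in> L2 walk_measure" and supp: "\<And>x. \<zeta> x \<noteq> 0 \<Longrightarrow> dist x0 x \<le> r" and r: "0 \<le> r" and e: "0 \<le> \<epsilon>"
    and S: "2 * (r + real n * R) \<le> S"
    and iso: "\<And>E. finite E \<Longrightarrow> E \<noteq> {} \<Longrightarrow> diam_le E S \<Longrightarrow> \<epsilon> * sum m E \<le> sum m (outer_boundary R E)"
  shows "(2 * real n + 1) * (\<epsilon> * (L2_norm walk_measure (walk_operator n \<zeta>))\<^sup>2)\<^sup>2 \<le> 16 * ((L2_norm walk_measure \<zeta>)\<^sup>2)\<^sup>2"
proof -
  \<comment> \<open>Holds the iterates up to order \<open>2 * n + 2\<close>, as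
    \<open>energy_decay\<close> requires, and the \<open>R\<close>-neighbourhood of the support of
    \<eta>.\<close>
  define F where "F = cball x0 (r + (2 * real n + 2) * R)"
  define \<eta> where "\<eta> = (step ^^ n) \<zeta>"
  have F: "finite F"
    by (simp add: F_def finite_cball[OF bg])
  have supp_k: "(step ^^ k) \<zeta> x = 0" if "k \<le> 2 * n + 2" "x \<notin> F" for k x
  proof (rule ccontr)
    assume "(step ^^ k) \<zeta> x \<noteq> 0"
    then have "dist x0 x \<le> r + real k * R"
      by (rule funpow_step_support[rotated]) (rule supp)
    also have "\<dots> \<le> r + (2 * real n + 2) * R"
      using that(1) R by (intro add_left_mono mult_right_mono) auto
    finally show False
      using that(2) by (simp add: F_def)
  qed
  have supp_\<eta>: "dist x0 x \<le> r + real n * R" if "\<eta> x \<noteq> 0" for x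
    using that unfolding \<eta>_def by (rule funpow_step_support[rotated]) (rule supp)
  have form_\<zeta>: "form F \<zeta> \<zeta> = (L2_norm walk_measure \<zeta>)\<^sup>2"
  proof -
    have "(L2_norm walk_measure \<zeta>)\<^sup>2 = (\<Sum>x\<in>F. measure walk_measure {x} * (norm (\<zeta> x))\<^sup>2)"
      using supp_k[of 0] by (intro L2_norm_finite_support[OF walk_facts \<zeta> F]) auto
    then show ?thesis
      by (simp add: form_self measure_walk_measure)
  qed
  have form_\<eta>: "form F \<eta> \<eta> \<le> (L2_norm walk_measure \<zeta>)\<^sup>2"
  proof -
    have "form F \<eta> \<eta> \<le> (L2_norm walk_measure \<eta>)\<^sup>2"
      unfolding form_self \<eta>_def using funpow_step_contraction[OF \<zeta>] by (intro walk_sum_le F) auto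
    also have "\<dots> \<le> (L2_norm walk_measure \<zeta>)\<^sup>2"
      unfolding \<eta>_def using funpow_step_contraction[OF \<zeta>] by (intro power_mono L2_norm_nonneg) auto
    finally show ?thesis .
  qed
  have norm_a: "(L2_norm walk_measure (walk_operator n \<zeta>))\<^sup>2 = (\<Sum>x\<in>F. m x * (norm (\<eta> x))\<^sup>2)"
  proof -
    have "(L2_norm walk_measure (walk_operator n \<zeta>))\<^sup>2 = (\<Sum>x\<in>F. measure walk_measure {x} * (norm (walk_operator n \<zeta> x))\<^sup>2)"
      using supp_k[of n]
      by (intro L2_norm_finite_support[OF walk_facts operator_closed[OF walk_facts walk_operator_bounded \<zeta>] F])
         (auto simp: walk_operator_def)
    then show ?thesis
      by (simp add: measure_walk_measure degree_norm_walk_operator \<eta>_def)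
  qed
  define D where "D = form F \<eta> \<eta> - form F (step \<eta>) \<eta>"
  have decay: "(2 * real n + 1) * D \<le> (L2_norm walk_measure \<zeta>)\<^sup>2"
    unfolding D_def \<eta>_def form_\<zeta>[symmetric] by (rule energy_decay[OF F supp_k])
  have "(\<epsilon> * (\<Sum>x\<in>F. m x * (norm (\<eta> x))\<^sup>2))\<^sup>2 \<le> 16 * D * form F \<eta> \<eta>"
    unfolding D_def
  proof (rule mass_form_le[OF F e _ iso])
    have "0 \<le> 2 * (r + real n * R)"
      using r R by simp
    then show "0 \<le> S"
      using S by (rule order_trans)
    fix x y
    assume x: "\<eta> x \<noteq> 0"
    show "dist x y \<le> S" if "\<eta> y \<noteq> 0"
      using supp_\<eta>[OF x] supp_\<eta>[OF that] S dist_triangle[of x y x0] by (simp add: dist_commute)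
    show "y \<in> F" if "dist x y \<le> R"
    proof -
      have "dist x0 y \<le> r + real n * R + R"
        using supp_\<eta>[OF x] that dist_triangle[of x0 y x] by (simp add: dist_commute)
      also have "\<dots> \<le> r + (2 * real n + 2) * R"
        using R mult_nonneg_nonneg[of "real n" R] by (simp add: algebra_simps)
      finally show ?thesis
        by (simp add: F_def)
    qed
  qed
  then have "(2 * real n + 1) * (\<epsilon> * (L2_norm walk_measure (walk_operator n \<zeta>))\<^sup>2)\<^sup>2 \<le> (2 * real n + 1) * (16 * D * form F \<eta> \<eta>)"
    unfolding norm_a by (intro mult_left_mono) auto
  also have "\<dots> = 16 * (((2 * real n + 1) * D) * form F \<eta> \<eta>)"
    by simp
  also have "\<dots> \<le> 16 * ((L2_norm walk_measure \<zeta>)\<^sup>2 * (L2_norm walk_measure \<zeta>)\<^sup>2)"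
  proof (intro mult_left_mono mult_mono decay form_\<eta>)
    show "0 \<le> form F \<eta> \<eta>"
      unfolding form_self using degree_nonneg by (intro sum_nonneg) auto
  qed auto
  finally show ?thesis
    by (simp add: power2_eq_square)
qed

end

section \<open>From operator norm localization to uniform local amenability\<close>

lemma ONL_imp_ULA_mu:
  assumes bg: "bounded_geometry TYPE('a::metric_space)" and nz: "(h :: 'h::complex_hilbert) \<noteq> 0"
    and ONL: "ONL TYPE('a) TYPE('h)"
  shows "ULA_mu TYPE('a)"
proof (rule ULA_mu_I[OF bg])
  fix R \<epsilon> :: real assume R: "0 < R" and e: "0 < \<epsilon>"
  obtain K :: nat where K: "\<And>x::'a. card (cball x R) \<le> K"
    using bg R unfolding bounded_geometry_def by metis
  have "0 < card (cball (undefined::'a) R)"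
    using R finite_cball[OF bg] by (auto simp: card_gt_0_iff)
  then have K0: "0 < K"
    using K[of undefined] by linarith
  obtain c :: real and f :: "nat \<Rightarrow> nat" where c: "0 < c" and onl: "\<And>\<nu> :: 'a measure. sets \<nu> = sets borel \<Longrightarrow>
      emeasure \<nu> UNIV \<noteq> 0 \<Longrightarrow> locally_finite_measure \<nu> \<Longrightarrow> ONL_relative TYPE('h) \<nu> f c"
    using ONL unfolding ONL_def by blast
  \<comment> \<open>Localization and \<open>N\<^sup>2 \<ge> 1 / (4 * K)\<close> will give
    \<open>\<epsilon> * (norm of a \<zeta>)\<^sup>2 \<ge> q * z\<close>, whereas energy decay will
    force \<open>(2 * n + 1) * q\<^sup>2 \<le> 16\<close>. The choice of \<open>n\<close>
    contradicts this and involves no weight.\<close>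
  define q where "q = \<epsilon> * c\<^sup>2 / (4 * real K)"
  have q: "0 < q"
    using e c K0 by (simp add: q_def)
  obtain n :: nat where n: "16 / q\<^sup>2 < real n"
    using reals_Archimedean2 by blast
  have n': "16 < (2 * real n + 1) * q\<^sup>2"
  proof -
    have "16 < real n * q\<^sup>2"
      using n q by (simp add: pos_divide_less_eq)
    also have "\<dots> \<le> (2 * real n + 1) * q\<^sup>2"
      by (intro mult_right_mono) auto
    finally show ?thesis .
  qed
  define r where "r = nat \<lceil>real n * R\<rceil>"
  have r: "real n * R \<le> real r"
    by (simp add: r_def real_nat_ceiling_ge)
  \<comment> \<open>Bounds the diameter of the support of the \<open>n\<close>-th iterate of a
    vector supported within \<open>f r\<close> of one of its points; the final 1 ensures
    positivity.\<close>
  define S where "S = 2 * (real (f r) + real n * R) + 1"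
  show "\<exists>S>0. \<forall>w :: 'a \<Rightarrow> real.
     (\<forall>x. 0 \<le> w x) \<longrightarrow> (\<forall>F. finite F \<longrightarrow> sum w F \<le> 1) \<longrightarrow> (\<exists>F. finite F \<and> 1/2 < sum w F) \<longrightarrow>
     (\<forall>E. finite E \<longrightarrow> E \<noteq> {} \<longrightarrow> diam_le E S \<longrightarrow> \<epsilon> * sum w E \<le> sum w (outer_boundary R E)) \<longrightarrow> False"
  proof (intro exI[of _ S] conjI allI impI)
    show "0 < S"
      using R by (simp add: S_def add_nonneg_pos)
    fix w :: "'a \<Rightarrow> real"
    assume w: "\<forall>x. 0 \<le> w x" and le1: "\<forall>F. finite F \<longrightarrow> sum w F \<le> 1"
      and half: "\<exists>F. finite F \<and> 1/2 < sum w F"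
      and iso: "\<forall>E. finite E \<longrightarrow> E \<noteq> {} \<longrightarrow> diam_le E S \<longrightarrow> \<epsilon> * sum w E \<le> sum w (outer_boundary R E)"
    obtain F0 where F0: "finite F0" "1/2 < sum w F0"
      using half by blast
    interpret W: weighted_walk w R
      by unfold_locales (use bg w R in auto)
    define a :: "('a \<Rightarrow> 'h) \<Rightarrow> 'a \<Rightarrow> 'h" where "a = W.walk_operator n"
    define N where "N = L2_onorm W.walk_measure a"
    have N: "1 \<le> 4 * real K * N\<^sup>2"
      unfolding N_def a_def using W.onorm_walk_operator_ge[OF nz _ F0 K] le1 by blast
    have "emeasure W.walk_measure UNIV \<noteq> 0"
    proof
      assume 0: "emeasure W.walk_measure UNIV = 0"
      have "W.degree x = 0" for x
      proof -
        have "emeasure W.walk_measure {x} \<le> emeasure W.walk_measure UNIV"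
          using sets_discrete[OF bg W.sets_walk_measure] by (intro emeasure_mono) auto
        then show ?thesis
          using 0 W.degree_nonneg[of x] by (simp add: W.emeasure_walk_measure)
      qed
      then have "w x = 0" for x
        using W.mass_le_degree[of x] w by (metis antisym)
      then show False
        using F0(2) by simp
    qed
    then have "ONL_relative TYPE('h) W.walk_measure f c"
      by (intro onl W.sets_walk_measure W.locally_finite_walk_measure)
    moreover have "L2_bounded_operator W.walk_measure a" "propagation W.walk_measure a \<le> of_nat r"
      unfolding a_def by (rule W.walk_operator_bounded, rule W.propagation_walk_operator[OF r])
    ultimately obtain \<zeta> where \<zeta>: "\<zeta> \<in> L2 W.walk_measure" "\<zeta> \<noteq> (\<lambda>x. 0)"
      "diam_le (support_on UNIV \<zeta>) (real (f r))" "c * N * L2_norm W.walk_measure \<zeta> \<le> L2_norm W.walk_measure (a \<zeta>)"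
      unfolding ONL_relative_def N_def by blast
    obtain x0 where x0: "\<zeta> x0 \<noteq> 0"
      using \<zeta>(2) by auto
    define z where "z = (L2_norm W.walk_measure \<zeta>)\<^sup>2"
    \<comment> \<open>Elements of \<open>L2\<close> vanish where the degree is zero, so a nonzero
      vector has positive norm.\<close>
    have "0 < W.degree x0 * (norm (\<zeta> x0))\<^sup>2"
      using x0 W.walk_L2_D[OF \<zeta>(1), of x0] W.degree_nonneg[of x0] by (auto simp: less_le)
    also have "\<dots> \<le> z"
      unfolding z_def using W.walk_sum_le[OF \<zeta>(1), of "{x0}"] by simp
    finally have z: "0 < z" .
    have upper: "(2 * real n + 1) * (\<epsilon> * (L2_norm W.walk_measure (a \<zeta>))\<^sup>2)\<^sup>2 \<le> 16 * z\<^sup>2"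
      unfolding a_def z_def
    proof (rule W.walk_operator_localized_le[OF \<zeta>(1), where ?x0.0 = x0 and r = "real (f r)" and S = S])
      show "dist x0 x \<le> real (f r)" if "\<zeta> x \<noteq> 0" for x
        using diam_le_D[OF \<zeta>(3)] x0 that by (auto simp: support_on_def)
    qed (use e iso in \<open>auto simp: S_def\<close>)
    have "0 \<le> N"
    proof -
      have "L2_norm W.walk_measure (a (\<lambda>x. 0)) / L2_norm W.walk_measure (\<lambda>x. 0 :: 'h) \<le> N"
        unfolding N_def L2_onorm_def a_def
        by (intro cSUP_upper L2_zero[OF W.walk_facts] bdd_above_operator_quotients[OF W.walk_facts W.walk_operator_bounded])
      then show ?thesis
        using L2_norm_nonneg by (meson divide_nonneg_nonneg order_trans)
    qed
    then have "(c * N * L2_norm W.walk_measure \<zeta>)\<^sup>2 \<le> (L2_norm W.walk_measure (a \<zeta>))\<^sup>2"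
      using \<zeta>(4) c by (intro power_mono) (auto intro!: mult_nonneg_nonneg L2_norm_nonneg)
    then have "c\<^sup>2 * N\<^sup>2 * z \<le> (L2_norm W.walk_measure (a \<zeta>))\<^sup>2"
      by (simp add: z_def power_mult_distrib)
    then have le: "\<epsilon> * (c\<^sup>2 * N\<^sup>2 * z) \<le> \<epsilon> * (L2_norm W.walk_measure (a \<zeta>))\<^sup>2"
      using e by (intro mult_left_mono) auto
    have "q * z \<le> \<epsilon> * (c\<^sup>2 * N\<^sup>2 * z)"
    proof -
      have "q * z * 1 \<le> q * z * (4 * real K * N\<^sup>2)"
        using N q z by (intro mult_left_mono) auto
      also have "\<dots> = \<epsilon> * (c\<^sup>2 * N\<^sup>2 * z)"
        using K0 by (simp add: q_def)
      finally show ?thesis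
        by simp
    qed
    then have "(q * z)\<^sup>2 \<le> (\<epsilon> * (L2_norm W.walk_measure (a \<zeta>))\<^sup>2)\<^sup>2"
      using q z le by (intro power_mono order_trans[OF _ le]) auto
    then have "(2 * real n + 1) * (q * z)\<^sup>2 \<le> (2 * real n + 1) * (\<epsilon> * (L2_norm W.walk_measure (a \<zeta>))\<^sup>2)\<^sup>2"
      by (intro mult_left_mono) auto
    also note upper
    finally have "((2 * real n + 1) * q\<^sup>2) * z\<^sup>2 \<le> 16 * z\<^sup>2"
      by (simp add: power_mult_distrib mult.assoc)
    then show False
      using n' z by simp
  qed
qed

theorem theorem5p1:
  assumes "bounded_geometry TYPE('a::metric_space)"
    and "separable_space (euclidean :: 'h::complex_hilbert topology)"
    and "infinite_dimensional TYPE('h)"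
  shows "(property_A TYPE('a) \<longleftrightarrow> ULA_mu TYPE('a)) \<and>
         (ULA_mu TYPE('a) \<longleftrightarrow> MSP TYPE('a)) \<and>
         (MSP TYPE('a) \<longleftrightarrow> ONL TYPE('a) TYPE('h))"
proof -
  obtain h :: 'h where h: "h \<noteq> 0"
    using infinite_dimensional_imp_nonzero[OF assms(3)] .
  note bg = assms(1)
  show ?thesis
    using property_A_imp_ULA_mu[OF bg] ULA_mu_imp_property_A[OF bg] ULA_mu_imp_MSP[OF bg]
      MSP_imp_ONL[OF bg h] ONL_imp_ULA_mu[OF bg h] by blast
qed

end
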